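(* Let $\mathcal A$ be an abelian arrangement in $T=\operatorname{Hom}(\Gamma,\mathbb G)$ and $Y$ an admissible subgroup of $T$ such that $\mathcal P(\mathcal A_Y)$ is a TM-ideal of $\mathcal P(\mathcal A)$. Then there exist an integer $\ell$ and a continuous map $g:M(\mathcal A/Y)\to\operatorname{Conf}_\ell(\mathbb G)$ such that $p:M(\mathcal A)\to M(\mathcal A/Y)$ is the pullback along $g$ of the Fadell–Neuwirth bundle $\operatorname{Conf}_{\ell+1}(\mathbb G)\to\operatorname{Conf}_\ell(\mathbb G)$ (forgetting the last point).
   Context: $\operatorname{Conf}_m(\mathbb G)$ is the space of ordered $m$-tuples of pairwise distinct points of $\mathbb G$. $\mathbb G\cong(S^1)^d\times\mathbb R^v$ connected abelian Lie group, $\Gamma$ free abelian of finite rank, $T=\operatorname{Hom}(\Gamma,\mathbb G)$, $\mathcal A\subseteq\Gamma$ finite, $H_\alpha=\{t:t(\alpha)=0\}$, $M(\mathcal A)=T\setminus\bigcup_\alpha H_\alpha$. Standing assumptions: $\mathcal A$ essential (generates finite-index subgroup) and irredundant (distinct $H_\alpha,H_\beta$ share no connected component). Poset of layers $\mathcal P(\mathcal A)$: connected components of nonempty intersections $\bigcap_{\alpha\in S}H_\alpha$ (minimum $T$), reverse inclusion; locally geometric (graded, bounded below, each $\mathcal P_{\le x}$ a geometric lattice). Admissible subgroup: $\Gamma=\Gamma'\oplus\Gamma''$ with $\Gamma'=\langle\beta_0\rangle$ rank one, $Y=\{t\in T:t(\Gamma'')=0\}$; $c(\alpha)\ge0$ with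 $\Gamma'$-component of $\alpha$ equal to $\pm c(\alpha)\beta_0$; $\mathcal A_Y=\{\alpha\in\mathcal A:c(\alpha)=0\}$; $\mathcal P(\mathcal A_Y)$ is the poset of layers of $\{H_\alpha:\alpha\in\mathcal A_Y\}$, a subposet of $\mathcal P(\mathcal A)$. $q:\Gamma\to\Gamma/\Gamma'$ quotient, $\mathcal A/Y=q(\mathcal A_Y)$ an arrangement in $\operatorname{Hom}(\Gamma/\Gamma',\mathbb G)$; $p(t)=t\circ\sigma$ with $\sigma:\Gamma/\Gamma'\to\Gamma''$ inverse to $q|_{\Gamma''}$; $p$ restricts to $M(\mathcal A)\to M(\mathcal A/Y)$. TM-ideal: in a poset $x\vee y$ is the set of minimal common upper bounds; an element of a geometric lattice is modular if its complements form an antichain; an order ideal $\mathcal Q$ is pure if its maximal elements share a rank, join-closed if it contains all minimal upper bounds of its subsets; a TM-ideal of $\mathcal P$ is a pure join-closed order ideal $\mathcal Q$ with (TM1) $|a\vee y|=1$ whenever $y\in\mathcal Q$ and $a$ is an atom of $\mathcal P$ not in $\mathcal Q$, (TM2) for every maximal $x\in\mathcal P$ some maximal $y\in\mathcal Q$ is modular in $\mathcal P_{\le x}$.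
   Formalization: The formal statement also assumes that the quotient arrangement A/Y is essential; without this the claim fails, e.g. for Γ=Z², A={e1,e2}, Γ'=⟨e2⟩, Γ''=⟨e1+e2⟩, where A_Y is empty, {T} is a TM-ideal, and the fibres of p are not all homeomorphic. *)

theory Defs
  imports "HOL-Analysis.Analysis" "HOL-Algebra.Free_Abelian_Groups"
    "HOL-Algebra.Generated_Groups" "HOL-Algebra.Complete_Lattice"
begin

text \<open>Abelian groups are group records in the sense of HOL-Algebra, hence written
  multiplicatively; in particular \<open>t \<alpha> = \<one>\<close> below renders the equation $t(\alpha) = 0$.\<close>

subsection \<open>The groups \<open>\<Gamma>\<close> and \<open>G\<close>\<close>

definition free_abelian_of_rank :: "('a, 'm) monoid_scheme \<Rightarrow> nat \<Rightarrow> bool" where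
  "free_abelian_of_rank \<Gamma> n \<longleftrightarrow> comm_group \<Gamma> \<and> \<Gamma> \<cong> free_Abelian_group {..<n}"

definition circle_group :: "complex monoid" where
  "circle_group = \<lparr>carrier = sphere 0 1, monoid.mult = (*), one = 1\<rparr>"

definition real_group :: "real monoid" where
  "real_group = \<lparr>carrier = UNIV, monoid.mult = (+), one = 0\<rparr>"

definition torus_vector_group :: "nat \<Rightarrow> nat \<Rightarrow> ((nat \<Rightarrow> complex) \<times> (nat \<Rightarrow> real)) monoid" where
  "torus_vector_group d v =
     product_group {..<d} (\<lambda>_. circle_group) \<times>\<times> product_group {..<v} (\<lambda>_. real_group)"

definition torus_vector_topology :: "nat \<Rightarrow> nat \<Rightarrow> ((nat \<Rightarrow> complex) \<times> (nat \<Rightarrow> real)) topology" where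
  "torus_vector_topology d v =
     prod_topology (product_topology (\<lambda>_. top_of_set (sphere 0 1)) {..<d})
                   (product_topology (\<lambda>_. euclidean) {..<v})"

text \<open>A connected abelian Lie group is a group \<open>G\<close> with a topology \<open>\<tau>\<close> on its carrier which is
  isomorphic, as a topological group, to some $(S^1)^d \times \mathbb{R}^v$.\<close>

definition connected_abelian_Lie_group ::
    "('b, 'n) monoid_scheme \<Rightarrow> 'b topology \<Rightarrow> nat \<Rightarrow> nat \<Rightarrow> bool" where
  "connected_abelian_Lie_group G \<tau> d v \<longleftrightarrow>
     comm_group G \<and> topspace \<tau> = carrier G \<and>
     (\<exists>\<phi>. \<phi> \<in> iso G (torus_vector_group d v) \<and>
          homeomorphic_map \<tau> (torus_vector_topology d v) \<phi>)"


subsection \<open>Arrangements and their complements\<close>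

text \<open>Homomorphisms are taken extensional, so that each is represented by one function. The topology
  is that of pointwise convergence; for \<open>\<Gamma>\<close> free of rank \<open>r\<close> it is the topology of $G^r$.\<close>

definition Hom :: "('a, 'm) monoid_scheme \<Rightarrow> ('b, 'n) monoid_scheme \<Rightarrow> ('a \<Rightarrow> 'b) set" where
  "Hom \<Gamma> G = hom \<Gamma> G \<inter> extensional (carrier \<Gamma>)"

definition Hom_topology ::
    "('a, 'm) monoid_scheme \<Rightarrow> ('b, 'n) monoid_scheme \<Rightarrow> 'b topology \<Rightarrow> ('a \<Rightarrow> 'b) topology" where
  "Hom_topology \<Gamma> G \<tau> = subtopology (product_topology (\<lambda>_. \<tau>) (carrier \<Gamma>)) (Hom \<Gamma> G)"

definition hypersurface ::
    "('a, 'm) monoid_scheme \<Rightarrow> ('b, 'n) monoid_scheme \<Rightarrow> 'a \<Rightarrow> ('a \<Rightarrow> 'b) set" where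
  "hypersurface \<Gamma> G \<alpha> = {t \<in> Hom \<Gamma> G. t \<alpha> = \<one>\<^bsub>G\<^esub>}"

definition arr_complement ::
    "('a, 'm) monoid_scheme \<Rightarrow> ('b, 'n) monoid_scheme \<Rightarrow> 'a set \<Rightarrow> ('a \<Rightarrow> 'b) set" where
  "arr_complement \<Gamma> G \<A> = Hom \<Gamma> G - (\<Union>\<alpha>\<in>\<A>. hypersurface \<Gamma> G \<alpha>)"

definition arr_complement_topology ::
    "('a, 'm) monoid_scheme \<Rightarrow> ('b, 'n) monoid_scheme \<Rightarrow> 'b topology \<Rightarrow> 'a set
       \<Rightarrow> ('a \<Rightarrow> 'b) topology" where
  "arr_complement_topology \<Gamma> G \<tau> \<A> =
     subtopology (Hom_topology \<Gamma> G \<tau>) (arr_complement \<Gamma> G \<A>)"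

definition essential :: "('a, 'm) monoid_scheme \<Rightarrow> 'a set \<Rightarrow> bool" where
  "essential \<Gamma> \<A> \<longleftrightarrow> finite (rcosets\<^bsub>\<Gamma>\<^esub> (generate \<Gamma> \<A>))"

definition irredundant ::
    "('a, 'm) monoid_scheme \<Rightarrow> ('b, 'n) monoid_scheme \<Rightarrow> 'b topology \<Rightarrow> 'a set \<Rightarrow> bool" where
  "irredundant \<Gamma> G \<tau> \<A> \<longleftrightarrow>
     (\<forall>\<alpha>\<in>\<A>. \<forall>\<beta>\<in>\<A>. hypersurface \<Gamma> G \<alpha> \<noteq> hypersurface \<Gamma> G \<beta> \<longrightarrow>
        connected_components_of (subtopology (Hom_topology \<Gamma> G \<tau>) (hypersurface \<Gamma> G \<alpha>)) \<inter>
        connected_components_of (subtopology (Hom_topology \<Gamma> G \<tau>) (hypersurface \<Gamma> G \<beta>)) = {})"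

definition abelian_arrangement ::
    "('a, 'm) monoid_scheme \<Rightarrow> ('b, 'n) monoid_scheme \<Rightarrow> 'b topology \<Rightarrow> 'a set \<Rightarrow> bool" where
  "abelian_arrangement \<Gamma> G \<tau> \<A> \<longleftrightarrow>
     finite \<A> \<and> \<A> \<subseteq> carrier \<Gamma> \<and> essential \<Gamma> \<A> \<and> irredundant \<Gamma> G \<tau> \<A>"


subsection \<open>The poset of layers\<close>

definition layers ::
    "('a, 'm) monoid_scheme \<Rightarrow> ('b, 'n) monoid_scheme \<Rightarrow> 'b topology \<Rightarrow> 'a set
       \<Rightarrow> ('a \<Rightarrow> 'b) set set" where
  "layers \<Gamma> G \<tau> \<A> =
     (\<Union>S\<in>Pow \<A>. connected_components_of
        (subtopology (Hom_topology \<Gamma> G \<tau>) (Hom \<Gamma> G \<inter> (\<Inter>\<alpha>\<in>S. hypersurface \<Gamma> G \<alpha>))))"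

definition layer_poset ::
    "('a, 'm) monoid_scheme \<Rightarrow> ('b, 'n) monoid_scheme \<Rightarrow> 'b topology \<Rightarrow> 'a set
       \<Rightarrow> ('a \<Rightarrow> 'b) set gorder" where
  "layer_poset \<Gamma> G \<tau> \<A> =
     \<lparr>carrier = layers \<Gamma> G \<tau> \<A>, eq = (=), le = (\<lambda>C D. D \<subseteq> C)\<rparr>"


subsection \<open>TM-ideals\<close>

definition maximal_elements :: "('x, 'k) gorder_scheme \<Rightarrow> 'x set \<Rightarrow> 'x set" where
  "maximal_elements L Q = {x \<in> Q. \<forall>y\<in>Q. x \<sqsubseteq>\<^bsub>L\<^esub> y \<longrightarrow> y = x}"

definition minimal_upper_bounds :: "('x, 'k) gorder_scheme \<Rightarrow> 'x set \<Rightarrow> 'x set" where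
  "minimal_upper_bounds L S = {u \<in> Upper L S. \<forall>w\<in>Upper L S. w \<sqsubseteq>\<^bsub>L\<^esub> u \<longrightarrow> w = u}"

definition atoms :: "('x, 'k) gorder_scheme \<Rightarrow> 'x set" where
  "atoms L = {a \<in> carrier L. a \<noteq> \<bottom>\<^bsub>L\<^esub> \<and> (\<forall>y\<in>carrier L. y \<sqsubseteq>\<^bsub>L\<^esub> a \<longrightarrow> y = \<bottom>\<^bsub>L\<^esub> \<or> y = a)}"

text \<open>The rank of \<open>x\<close> is the length of a longest chain ending in \<open>x\<close>, so the number of its elements
  other than \<open>x\<close>. In a graded poset with a minimum this is the value of the rank function.\<close>

definition poset_rank :: "('x, 'k) gorder_scheme \<Rightarrow> 'x \<Rightarrow> nat" where
  "poset_rank L x =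
     Max {card C | C. finite C \<and> C \<subseteq> {y \<in> carrier L. y \<sqsubseteq>\<^bsub>L\<^esub> x \<and> y \<noteq> x} \<and>
                      (\<forall>y\<in>C. \<forall>z\<in>C. y \<sqsubseteq>\<^bsub>L\<^esub> z \<or> z \<sqsubseteq>\<^bsub>L\<^esub> y)}"

definition lower_interval :: "('x, 'k) gorder_scheme \<Rightarrow> 'x \<Rightarrow> ('x, 'k) gorder_scheme" where
  "lower_interval L x = L\<lparr>carrier := {y \<in> carrier L. y \<sqsubseteq>\<^bsub>L\<^esub> x}\<rparr>"

definition lattice_complements :: "('x, 'k) gorder_scheme \<Rightarrow> 'x \<Rightarrow> 'x set" where
  "lattice_complements L y =
     {z \<in> carrier L. is_lub L \<top>\<^bsub>L\<^esub> {y, z} \<and> is_glb L \<bottom>\<^bsub>L\<^esub> {y, z}}"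

definition modular_element :: "('x, 'k) gorder_scheme \<Rightarrow> 'x \<Rightarrow> bool" where
  "modular_element L y \<longleftrightarrow> y \<in> carrier L \<and>
     (\<forall>z\<in>lattice_complements L y. \<forall>w\<in>lattice_complements L y. z \<sqsubseteq>\<^bsub>L\<^esub> w \<longrightarrow> z = w)"

definition order_ideal :: "('x, 'k) gorder_scheme \<Rightarrow> 'x set \<Rightarrow> bool" where
  "order_ideal L Q \<longleftrightarrow> Q \<subseteq> carrier L \<and> (\<forall>y\<in>Q. \<forall>x\<in>carrier L. x \<sqsubseteq>\<^bsub>L\<^esub> y \<longrightarrow> x \<in> Q)"

definition pure :: "('x, 'k) gorder_scheme \<Rightarrow> 'x set \<Rightarrow> bool" where
  "pure L Q \<longleftrightarrow> (\<forall>x\<in>maximal_elements L Q. \<forall>y\<in>maximal_elements L Q.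
                   poset_rank L x = poset_rank L y)"

definition join_closed :: "('x, 'k) gorder_scheme \<Rightarrow> 'x set \<Rightarrow> bool" where
  "join_closed L Q \<longleftrightarrow> (\<forall>S\<subseteq>Q. minimal_upper_bounds L S \<subseteq> Q)"

definition TM_ideal :: "('x, 'k) gorder_scheme \<Rightarrow> 'x set \<Rightarrow> bool" where
  "TM_ideal L Q \<longleftrightarrow>
     order_ideal L Q \<and> pure L Q \<and> join_closed L Q \<and>
     (\<forall>y\<in>Q. \<forall>a\<in>atoms L - Q. card (minimal_upper_bounds L {a, y}) = 1) \<and>
     (\<forall>x\<in>maximal_elements L (carrier L). \<exists>y\<in>maximal_elements L Q.
        modular_element (lower_interval L x) y)"


subsection \<open>Admissible subgroups and the projection\<close>

definition admissible_subgroup ::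
    "('a, 'm) monoid_scheme \<Rightarrow> ('b, 'n) monoid_scheme \<Rightarrow> 'a \<Rightarrow> 'a set \<Rightarrow> 'a set
       \<Rightarrow> ('a \<Rightarrow> 'b) set \<Rightarrow> bool" where
  "admissible_subgroup \<Gamma> G \<beta>0 \<Gamma>' \<Gamma>'' Y \<longleftrightarrow>
     subgroup \<Gamma>' \<Gamma> \<and> subgroup \<Gamma>'' \<Gamma> \<and>
     \<Gamma>' <#>\<^bsub>\<Gamma>\<^esub> \<Gamma>'' = carrier \<Gamma> \<and> \<Gamma>' \<inter> \<Gamma>'' = {\<one>\<^bsub>\<Gamma>\<^esub>} \<and>
     \<beta>0 \<in> carrier \<Gamma> \<and> \<Gamma>' = generate \<Gamma> {\<beta>0} \<and>
     free_abelian_of_rank (\<Gamma>\<lparr>carrier := \<Gamma>'\<rparr>) 1 \<and>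
     Y = {t \<in> Hom \<Gamma> G. \<forall>\<gamma>\<in>\<Gamma>''. t \<gamma> = \<one>\<^bsub>G\<^esub>}"

definition adm_coeff :: "('a, 'm) monoid_scheme \<Rightarrow> 'a \<Rightarrow> 'a set \<Rightarrow> 'a \<Rightarrow> nat" where
  "adm_coeff \<Gamma> \<beta>0 \<Gamma>'' \<alpha> =
     (THE c. \<exists>k::int. \<exists>\<gamma>\<in>\<Gamma>''. \<alpha> = (\<beta>0 [^]\<^bsub>\<Gamma>\<^esub> k) \<otimes>\<^bsub>\<Gamma>\<^esub> \<gamma> \<and> (k = int c \<or> k = - int c))"

definition sub_arrangement :: "('a, 'm) monoid_scheme \<Rightarrow> 'a \<Rightarrow> 'a set \<Rightarrow> 'a set \<Rightarrow> 'a set" where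
  "sub_arrangement \<Gamma> \<beta>0 \<Gamma>'' \<A> = {\<alpha> \<in> \<A>. adm_coeff \<Gamma> \<beta>0 \<Gamma>'' \<alpha> = 0}"

definition quotient_arrangement ::
    "('a, 'm) monoid_scheme \<Rightarrow> 'a \<Rightarrow> 'a set \<Rightarrow> 'a set \<Rightarrow> 'a set \<Rightarrow> 'a set set" where
  "quotient_arrangement \<Gamma> \<beta>0 \<Gamma>' \<Gamma>'' \<A> =
     (\<lambda>\<alpha>. \<Gamma>' #>\<^bsub>\<Gamma>\<^esub> \<alpha>) ` sub_arrangement \<Gamma> \<beta>0 \<Gamma>'' \<A>"

text \<open>The hypothesis that the layers of the subarrangement form a TM-ideal does not force the
  quotient arrangement to be essential: the one-element ideal consisting of the minimum is always a
  TM-ideal. For $\Gamma = \mathbb{Z}^2$, $\mathcal{A} = \{e_1, e_2\}$, $\Gamma' = \langle e_2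
  \rangle$, $\Gamma'' = \langle e_1 + e_2 \rangle$ the subarrangement is empty, and the fibres of
  the projection are $G$ without two points or, over $0$, without one. The standing assumption
  that arrangements are essential therefore has to be imposed on the quotient arrangement
  as well.\<close>

definition quotient_section ::
    "('a, 'm) monoid_scheme \<Rightarrow> 'a set \<Rightarrow> 'a set \<Rightarrow> 'a set \<Rightarrow> 'a" where
  "quotient_section \<Gamma> \<Gamma>' \<Gamma>'' = inv_into \<Gamma>'' (\<lambda>\<gamma>. \<Gamma>' #>\<^bsub>\<Gamma>\<^esub> \<gamma>)"

definition Hom_projection ::
    "('a, 'm) monoid_scheme \<Rightarrow> 'a set \<Rightarrow> 'a set \<Rightarrow> ('a \<Rightarrow> 'b) \<Rightarrow> 'a set \<Rightarrow> 'b" where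
  "Hom_projection \<Gamma> \<Gamma>' \<Gamma>'' t =
     restrict (t \<circ> quotient_section \<Gamma> \<Gamma>' \<Gamma>'') (carrier (\<Gamma> Mod \<Gamma>'))"


subsection \<open>Configuration spaces and pullbacks\<close>

definition Conf_topology :: "nat \<Rightarrow> 'b topology \<Rightarrow> (nat \<Rightarrow> 'b) topology" where
  "Conf_topology m \<tau> = subtopology (product_topology (\<lambda>_. \<tau>) {..<m}) {x. inj_on x {..<m}}"

definition forget_last :: "nat \<Rightarrow> (nat \<Rightarrow> 'b) \<Rightarrow> nat \<Rightarrow> 'b" where
  "forget_last l x = restrict x {..<l}"

definition pullback_topology_along ::
    "'b topology \<Rightarrow> 'e topology \<Rightarrow> ('b \<Rightarrow> 'c) \<Rightarrow> ('e \<Rightarrow> 'c) \<Rightarrow> ('b \<times> 'e) topology" where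
  "pullback_topology_along B E g \<pi> = subtopology (prod_topology B E) {(b, e). g b = \<pi> e}"

text \<open>\<open>p : X \<rightarrow> B\<close> is (isomorphic over \<open>B\<close> to) the pullback along \<open>g\<close> of \<open>\<pi> : E \<rightarrow> C\<close>.\<close>

definition is_pullback_along ::
    "'x topology \<Rightarrow> 'b topology \<Rightarrow> ('x \<Rightarrow> 'b) \<Rightarrow> 'e topology \<Rightarrow> ('e \<Rightarrow> 'c) \<Rightarrow> ('b \<Rightarrow> 'c) \<Rightarrow> bool" where
  "is_pullback_along X B p E \<pi> g \<longleftrightarrow>
     (\<exists>h. homeomorphic_map X (pullback_topology_along B E g \<pi>) h \<and>
          (\<forall>x\<in>topspace X. fst (h x) = p x))"

end

theory Submission
  imports Defs "HOL-Library.Function_Algebras"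
begin

text \<open>
  Evaluation at \<open>\<beta>0\<close> and restriction to \<open>\<Gamma>''\<close> identify \<open>Hom \<Gamma> G\<close> with the product of \<open>G\<close> and the
  base \<open>Hom (\<Gamma> Mod \<Gamma>') G\<close>. Over a point \<open>s\<close> of the base, a hypersurface
  $k \beta_0 + \gamma = 0$ with $k \neq 0$ removes from the fibre \<open>G\<close> the solutions \<open>g\<close> of
  $k g = - s(\gamma)$. They form finitely many continuous sections: if \<open>G\<close> is a vector space, divide
  by \<open>k\<close>; if \<open>G\<close> has a circle factor, (TM1) for the identity components of the hypersurface and of
  the intersection of the subarrangement forces $\gamma = k \delta$, and the sections are
  $\zeta - s(\delta)$ with $k \zeta = 0$. The graph of each section is a connected component of its
  hypersurface, hence an atom \<open>a\<close> of the poset of layers. If the graphs \<open>a\<close> and \<open>a'\<close> of two sections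
  meet over a point of \<open>M(A/Y)\<close>, let \<open>y\<close> be the modular element which (TM2) provides below a maximal
  layer contained in a component \<open>C\<close> of the intersection of the two hypersurfaces. Both \<open>a\<close> and \<open>C\<close>
  are complements of \<open>y\<close>, so \<open>a = C\<close>, and likewise \<open>a' = C\<close>. Thus two sections which agree somewhere
  over \<open>M(A/Y)\<close> agree everywhere, and the distinct ones define the map to the configuration space.
\<close>

subsection \<open>One-parameter subgroups, torsion and roots in connected abelian Lie groups\<close>

text \<open>Configurations are ordered, so the points removed from the fibres need labels that are
  consistent over all of M(A/Y). Two things can prevent this. With circle factors the solutions of k
  g = - s(\<gamma>) may be permuted by monodromy: for G = S^1 and \<gamma> primitive, 2 g = -
  s(\<gamma>) defines a connected double cover of the base. Divisibility of \<gamma> by k excludes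
  this. Moreover two sections might meet over a part of M(A/Y) only, and M(A/Y) can be disconnected,
  as for G = R. Hence connectedness is used for T and for layers, with graphs over the whole base; a
  point over M(A/Y) enters only by avoiding the subarrangement. Two moves carry most arguments. A
  one-parameter subgroup of G composed with a real character of \<Gamma> moves a point inside a
  layer, and a torsion-valued continuous function is constant on a layer. Which one applies is
  decided by rational linear dependence in \<Gamma>.\<close>

definition one_param :: "('b, 'n) monoid_scheme \<Rightarrow> 'b topology \<Rightarrow> (real \<Rightarrow> 'b) \<Rightarrow> bool" where
  "one_param G \<tau> e \<longleftrightarrow>
     continuous_map euclideanreal \<tau> e \<and> (\<forall>x y. e (x + y) = e x \<otimes>\<^bsub>G\<^esub> e y)"

text \<open>The last assumption separates the groups with \<open>d = 0\<close> from those with \<open>d > 0\<close>.\<close>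

locale lie_target = comm_group G for G :: "('b, 'n) monoid_scheme" (structure) +
  fixes \<tau> :: "'b topology"
  assumes topspace_eq: "topspace \<tau> = carrier G"
    and Hausdorff: "Hausdorff_space \<tau>"
    and mult_cont: "continuous_map (prod_topology \<tau> \<tau>) \<tau> (\<lambda>(x, y). x \<otimes> y)"
    and inv_cont: "continuous_map \<tau> \<tau> (\<lambda>x. inv x)"
    and ex_one_param: "g \<in> carrier G \<Longrightarrow> \<exists>e. one_param G \<tau> e \<and> e 1 = g"
    and finite_torsion_nat: "0 < n \<Longrightarrow> finite {g \<in> carrier G. g [^] (n::nat) = \<one>}"
    and root_or_circle_nat:
      "(\<forall>n::nat. 0 < n \<longrightarrow> (\<exists>\<rho>. continuous_map \<tau> \<tau> \<rho> \<and> (\<forall>g\<in>carrier G. \<rho> g [^] n \<otimes> g = \<one>))) \<or>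
       (\<exists>e. one_param G \<tau> e \<and> (\<forall>x. e x = \<one> \<longleftrightarrow> x \<in> \<int>))"

text \<open>Each property in the locale is invariant under isomorphism of topological groups, so
  only the model \<open>torus_vector_group d v\<close> has to be examined.\<close>

lemma lie_target_transport:
  assumes H: "lie_target H \<sigma>" and G: "comm_group G" and top: "topspace \<tau> = carrier G"
    and iso: "\<phi> \<in> iso G H" and homeo: "homeomorphic_map \<tau> \<sigma> \<phi>"
  shows "lie_target G \<tau>"
proof -
  interpret H: lie_target H \<sigma> by fact
  interpret G: comm_group G by fact
  obtain \<psi> where hm: "homeomorphic_maps \<tau> \<sigma> \<phi> \<psi>"
    using homeo homeomorphic_map_maps by blast
  have c\<phi>: "continuous_map \<tau> \<sigma> \<phi>" and c\<psi>: "continuous_map \<sigma> \<tau> \<psi>"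
    and \<psi>\<phi>: "\<And>x. x \<in> carrier G \<Longrightarrow> \<psi> (\<phi> x) = x" and \<phi>\<psi>: "\<And>y. y \<in> carrier H \<Longrightarrow> \<phi> (\<psi> y) = y"
    using hm by (auto simp: homeomorphic_maps_def top H.topspace_eq)
  have \<psi>c: "\<psi> y \<in> carrier G" if "y \<in> carrier H" for y
    using c\<psi> that by (auto simp: continuous_map_def top H.topspace_eq)
  interpret \<phi>: group_hom G H \<phi>
    using iso by unfold_locales (auto simp: iso_def)
  have \<psi>_mult: "\<psi> (x \<otimes>\<^bsub>H\<^esub> y) = \<psi> x \<otimes>\<^bsub>G\<^esub> \<psi> y" if "x \<in> carrier H" "y \<in> carrier H" for x y
  proof -
    have "x \<otimes>\<^bsub>H\<^esub> y = \<phi> (\<psi> x \<otimes>\<^bsub>G\<^esub> \<psi> y)" using that by (simp add: \<phi>\<psi> \<psi>c)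
    then have "\<psi> (x \<otimes>\<^bsub>H\<^esub> y) = \<psi> (\<phi> (\<psi> x \<otimes>\<^bsub>G\<^esub> \<psi> y))" by (rule arg_cong)
    then show ?thesis using that by (simp only: \<psi>\<phi> \<psi>c G.m_closed)
  qed
  interpret \<psi>: group_hom H G \<psi>
    by unfold_locales (auto simp: hom_def \<psi>c \<psi>_mult)
  have \<psi>par: "one_param G \<tau> (\<psi> \<circ> e)" if e: "one_param H \<sigma> e" for e
  proof -
    have "e x \<in> carrier H" for x
      using e by (auto simp: one_param_def continuous_map_def H.topspace_eq)
    then show ?thesis
      using e c\<psi> by (auto simp: one_param_def \<psi>_mult intro: continuous_map_compose)
  qed
  show ?thesis
  proof (unfold_locales, fact top)
    show "Hausdorff_space \<tau>"
      using homeomorphic_Hausdorff_space[of \<tau> \<sigma>] homeo H.Hausdorff homeomorphic_space_def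
        hm by blast
    have "continuous_map (prod_topology \<tau> \<tau>) \<tau> (\<psi> \<circ> ((\<lambda>(x, y). x \<otimes>\<^bsub>H\<^esub> y) \<circ> (\<lambda>z. (\<phi> (fst z), \<phi> (snd z)))))"
      by (intro continuous_map_compose[OF _ c\<psi>] continuous_map_compose[OF _ H.mult_cont])
        (auto simp: continuous_map_pairwise o_def intro!: continuous_map_of_fst continuous_map_of_snd
          continuous_map_compose[OF continuous_map_fst c\<phi>, unfolded o_def]
          continuous_map_compose[OF continuous_map_snd c\<phi>, unfolded o_def])
    then show "continuous_map (prod_topology \<tau> \<tau>) \<tau> (\<lambda>(x, y). x \<otimes>\<^bsub>G\<^esub> y)"
      by (rule continuous_map_eq) (auto simp: top \<psi>\<phi>)
    have "continuous_map \<tau> \<tau> (\<psi> \<circ> ((\<lambda>x. inv\<^bsub>H\<^esub> x) \<circ> \<phi>))"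
      by (intro continuous_map_compose[OF _ c\<psi>] continuous_map_compose[OF c\<phi> H.inv_cont])
    then show "continuous_map \<tau> \<tau> (\<lambda>x. inv\<^bsub>G\<^esub> x)"
      by (rule continuous_map_eq) (auto simp: top \<psi>\<phi>)
  next
    fix g assume g: "g \<in> carrier G"
    obtain e where "one_param H \<sigma> e" "e 1 = \<phi> g" using H.ex_one_param[OF \<phi>.hom_closed[OF g]] by blast
    with \<psi>par[of e] g show "\<exists>e. one_param G \<tau> e \<and> e 1 = g"
      by (intro exI[of _ "\<psi> \<circ> e"]) (simp add: \<psi>\<phi>)
  next
    fix n :: nat assume "0 < n"
    then have "finite {g \<in> carrier H. g [^]\<^bsub>H\<^esub> n = \<one>\<^bsub>H\<^esub>}" by (rule H.finite_torsion_nat)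
    moreover have "{g \<in> carrier G. g [^]\<^bsub>G\<^esub> n = \<one>\<^bsub>G\<^esub>} \<subseteq> \<psi> ` {g \<in> carrier H. g [^]\<^bsub>H\<^esub> n = \<one>\<^bsub>H\<^esub>}"
    proof
      fix g assume g: "g \<in> {g \<in> carrier G. g [^]\<^bsub>G\<^esub> n = \<one>\<^bsub>G\<^esub>}"
      then have "\<phi> g [^]\<^bsub>H\<^esub> n = \<one>\<^bsub>H\<^esub>" using \<phi>.hom_nat_pow[of g n] by simp
      with g show "g \<in> \<psi> ` {g \<in> carrier H. g [^]\<^bsub>H\<^esub> n = \<one>\<^bsub>H\<^esub>}"
        by (intro image_eqI[of _ _ "\<phi> g"]) (auto simp: \<psi>\<phi>)
    qed
    ultimately show "finite {g \<in> carrier G. g [^]\<^bsub>G\<^esub> n = \<one>\<^bsub>G\<^esub>}" by (meson finite_imageI finite_subset)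
  next
    from H.root_or_circle_nat show "(\<forall>n::nat. 0 < n \<longrightarrow> (\<exists>\<rho>. continuous_map \<tau> \<tau> \<rho> \<and>
        (\<forall>g\<in>carrier G. \<rho> g [^]\<^bsub>G\<^esub> n \<otimes>\<^bsub>G\<^esub> g = \<one>\<^bsub>G\<^esub>))) \<or>
       (\<exists>e. one_param G \<tau> e \<and> (\<forall>x. e x = \<one>\<^bsub>G\<^esub> \<longleftrightarrow> x \<in> \<int>))"
    proof (elim disjE exE conjE)
      assume r: "\<forall>n::nat. 0 < n \<longrightarrow> (\<exists>\<rho>. continuous_map \<sigma> \<sigma> \<rho> \<and> (\<forall>g\<in>carrier H. \<rho> g [^]\<^bsub>H\<^esub> n \<otimes>\<^bsub>H\<^esub> g = \<one>\<^bsub>H\<^esub>))"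
      have "\<exists>\<rho>. continuous_map \<tau> \<tau> \<rho> \<and> (\<forall>g\<in>carrier G. \<rho> g [^]\<^bsub>G\<^esub> n \<otimes>\<^bsub>G\<^esub> g = \<one>\<^bsub>G\<^esub>)"
        if n: "0 < n" for n :: nat
      proof -
        obtain \<rho> where \<rho>: "continuous_map \<sigma> \<sigma> \<rho>" "\<And>g. g \<in> carrier H \<Longrightarrow> \<rho> g [^]\<^bsub>H\<^esub> n \<otimes>\<^bsub>H\<^esub> g = \<one>\<^bsub>H\<^esub>"
          using r n by blast
        have \<rho>c: "\<rho> y \<in> carrier H" if "y \<in> carrier H" for y
          using \<rho>(1) that by (auto simp: continuous_map_def H.topspace_eq)
        have "\<psi> (\<rho> (\<phi> g)) [^]\<^bsub>G\<^esub> n \<otimes>\<^bsub>G\<^esub> g = \<one>\<^bsub>G\<^esub>" if g: "g \<in> carrier G" for g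
        proof -
          have "\<psi> (\<rho> (\<phi> g) [^]\<^bsub>H\<^esub> n \<otimes>\<^bsub>H\<^esub> \<phi> g) = \<psi> \<one>\<^bsub>H\<^esub>" using \<rho>(2)[of "\<phi> g"] g by simp
          then show ?thesis using g by (simp add: \<rho>c \<psi>\<phi> \<psi>.hom_nat_pow)
        qed
        moreover have "continuous_map \<tau> \<tau> (\<psi> \<circ> (\<rho> \<circ> \<phi>))"
          by (intro continuous_map_compose[OF _ c\<psi>] continuous_map_compose[OF c\<phi> \<rho>(1)])
        ultimately show ?thesis by (intro exI[of _ "\<psi> \<circ> (\<rho> \<circ> \<phi>)"]) auto
      qed
      then show ?thesis by blast
    next
      fix e assume e: "one_param H \<sigma> e" and ez: "\<forall>x. e x = \<one>\<^bsub>H\<^esub> \<longleftrightarrow> x \<in> \<int>"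
      have "e x \<in> carrier H" for x
        using e by (auto simp: one_param_def continuous_map_def H.topspace_eq)
      then have "\<psi> (e x) = \<one>\<^bsub>G\<^esub> \<longleftrightarrow> e x = \<one>\<^bsub>H\<^esub>" for x
        using \<phi>\<psi>[of "e x"] \<phi>.hom_one \<psi>.hom_one by fastforce
      with \<psi>par[OF e] ez show ?thesis by (intro disjI2 exI[of _ "\<psi> \<circ> e"]) auto
    qed
  qed
qed

section \<open>The model group: a product of circles and real lines\<close>

lemma pow_product_group:
  assumes "x \<in> carrier (product_group I G)" "\<And>i. i \<in> I \<Longrightarrow> group (G i)"
  shows "x [^]\<^bsub>product_group I G\<^esub> (n::nat) = (\<lambda>i\<in>I. x i [^]\<^bsub>G i\<^esub> n)"
  by (induction n) (auto simp: nat_pow_def)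

lemma pow_DirProd: "(x, y) [^]\<^bsub>G \<times>\<times> H\<^esub> (n::nat) = (x [^]\<^bsub>G\<^esub> n, y [^]\<^bsub>H\<^esub> n)"
  by (induction n) (auto simp: nat_pow_def one_DirProd mult_DirProd)

lemma circle_group_simps [simp]:
  "carrier circle_group = sphere 0 1" "x \<otimes>\<^bsub>circle_group\<^esub> y = x * y" "\<one>\<^bsub>circle_group\<^esub> = 1"
  by (auto simp: circle_group_def)

lemma real_group_simps [simp]:
  "carrier real_group = UNIV" "x \<otimes>\<^bsub>real_group\<^esub> y = x + y" "\<one>\<^bsub>real_group\<^esub> = 0"
  by (auto simp: real_group_def)

lemma comm_group_circle: "comm_group circle_group"
proof (rule comm_groupI)
  show "\<exists>y\<in>carrier circle_group. y \<otimes>\<^bsub>circle_group\<^esub> x = \<one>\<^bsub>circle_group\<^esub>"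
    if "x \<in> carrier circle_group" for x
    using that by (intro bexI[of _ "inverse x"]) (auto simp: norm_inverse intro!: left_inverse)
qed (auto simp: norm_mult)

lemma comm_group_real: "comm_group real_group"
proof (rule comm_groupI)
  show "\<exists>y\<in>carrier real_group. y \<otimes>\<^bsub>real_group\<^esub> x = \<one>\<^bsub>real_group\<^esub>" for x
    by (intro bexI[of _ "-x"]) auto
qed auto

lemma cnj_mult_unit: "norm x = 1 \<Longrightarrow> cnj x * x = 1"
  using complex_norm_square[of x] by (simp add: mult.commute)

lemma continuous_map_complex_mult:
  fixes f g :: "'z \<Rightarrow> complex"
  assumes "continuous_map X euclidean f" "continuous_map X euclidean g"
  shows "continuous_map X euclidean (\<lambda>x. f x * g x)"
proof -
  have 1: "continuous_map X (prod_topology euclidean euclidean) (\<lambda>x. (f x, g x))"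
    unfolding continuous_map_pairwise using assms by (simp add: o_def)
  have 2: "continuous_map (prod_topology euclidean euclidean) euclidean (\<lambda>p. fst p * snd p :: complex)"
    by (simp add: continuous_on_mult continuous_on_fst continuous_on_snd)
  show ?thesis
    using continuous_map_compose[OF 1 2] by (simp add: o_def)
qed

lemma pow_circle: "x [^]\<^bsub>circle_group\<^esub> (n::nat) = x ^ n"
  by (induction n) (auto simp: nat_pow_def)

lemma pow_real: "x [^]\<^bsub>real_group\<^esub> (n::nat) = real n * x"
  by (induction n) (auto simp: nat_pow_def algebra_simps)

lemma comm_group_product:
  assumes "\<And>i. i \<in> I \<Longrightarrow> comm_group (G i)"
  shows "comm_group (product_group I G)"
proof -
  interpret group "product_group I G"
    by (rule product_group) (use assms comm_group.axioms in auto)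
  show ?thesis
  proof (rule group_comm_groupI)
    fix x y assume "x \<in> carrier (product_group I G)" "y \<in> carrier (product_group I G)"
    then show "x \<otimes>\<^bsub>product_group I G\<^esub> y = y \<otimes>\<^bsub>product_group I G\<^esub> x"
      using assms by (auto simp: PiE_iff intro!: restrict_ext comm_groupE(4))
  qed
qed

lemma comm_group_DirProd:
  assumes "comm_group G" "comm_group H" shows "comm_group (G \<times>\<times> H)"
proof -
  interpret G: comm_group G by fact
  interpret H: comm_group H by fact
  interpret group "G \<times>\<times> H" by (rule DirProd_group) (unfold_locales)
  show ?thesis
    by (rule group_comm_groupI) (auto simp: G.m_comm H.m_comm)
qed

lemma lie_target_torus_vector:
  "lie_target (torus_vector_group d v) (torus_vector_topology d v)"
proof -
  let ?M = "torus_vector_group d v" and ?N = "torus_vector_topology d v"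
  have grp: "group circle_group" "group real_group"
    using comm_group_circle comm_group_real comm_group.axioms by auto
  have cg: "comm_group ?M" unfolding torus_vector_group_def
    by (intro comm_group_DirProd comm_group_product comm_group_circle comm_group_real)
  interpret comm_group ?M by fact
  have car: "carrier ?M = (\<Pi>\<^sub>E i\<in>{..<d}. sphere 0 1) \<times> (\<Pi>\<^sub>E i\<in>{..<v}. UNIV)"
    by (simp add: torus_vector_group_def)
  have mul: "x \<otimes>\<^bsub>?M\<^esub> y = ((\<lambda>i\<in>{..<d}. fst x i * fst y i), (\<lambda>i\<in>{..<v}. snd x i + snd y i))" for x y
    by (cases x; cases y) (simp add: torus_vector_group_def mult_DirProd)
  have one: "\<one>\<^bsub>?M\<^esub> = ((\<lambda>i\<in>{..<d}. 1), (\<lambda>i\<in>{..<v}. 0))"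
    by (simp add: torus_vector_group_def)
  have inv: "inv\<^bsub>?M\<^esub> x = ((\<lambda>i\<in>{..<d}. cnj (fst x i)), (\<lambda>i\<in>{..<v}. - snd x i))" if "x \<in> carrier ?M" for x
    using that car by (intro inv_equality) (auto simp: mul one cnj_mult_unit PiE_iff intro!: restrict_ext)
  have pow: "x [^]\<^bsub>?M\<^esub> (n::nat) = ((\<lambda>i\<in>{..<d}. fst x i ^ n), (\<lambda>i\<in>{..<v}. real n * snd x i))"
    if "x \<in> carrier ?M" for x n
    using that by (cases x) (auto simp: torus_vector_group_def pow_DirProd pow_product_group grp pow_circle pow_real)
  have top: "topspace ?N = carrier ?M"
    by (simp add: torus_vector_topology_def car)
  have contN: "continuous_map X ?N (\<lambda>x. (\<lambda>i\<in>{..<d}. f x i, \<lambda>i\<in>{..<v}. g x i))"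
    if "\<And>k. k < d \<Longrightarrow> continuous_map X euclidean (\<lambda>x. f x k)"
      "\<And>k x. k < d \<Longrightarrow> x \<in> topspace X \<Longrightarrow> norm (f x k) = 1"
      "\<And>k. k < v \<Longrightarrow> continuous_map X euclideanreal (\<lambda>x. g x k)"
    for X :: "'z topology" and f g
    unfolding torus_vector_topology_def continuous_map_pairwise using that
    by (auto simp: continuous_map_componentwise o_def continuous_map_in_subtopology)
  have cN1: "continuous_map ?N euclidean (\<lambda>x. fst x k)" if "k < d" for k
  proof -
    have "continuous_map ?N (top_of_set (sphere 0 1)) (\<lambda>x. fst x k)"
      unfolding torus_vector_topology_def using that by (intro continuous_map_prod_fst) auto
    then show ?thesis by (simp add: continuous_map_in_subtopology)
  qed
  have cN2: "continuous_map ?N euclideanreal (\<lambda>x. snd x k)" if "k < v" for k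
    unfolding torus_vector_topology_def using that by (intro continuous_map_prod_snd) auto
  have comp1: "continuous_map (prod_topology ?N ?N) euclidean (\<lambda>z. fst (fst z) k)"
    "continuous_map (prod_topology ?N ?N) euclidean (\<lambda>z. fst (snd z) k)" if "k < d" for k
    using continuous_map_compose[OF continuous_map_fst cN1[OF that]]
      continuous_map_compose[OF continuous_map_snd cN1[OF that]] by (auto simp: o_def)
  have comp2: "continuous_map (prod_topology ?N ?N) euclideanreal (\<lambda>z. snd (fst z) k)"
    "continuous_map (prod_topology ?N ?N) euclideanreal (\<lambda>z. snd (snd z) k)" if "k < v" for k
    using continuous_map_compose[OF continuous_map_fst cN2[OF that]]
      continuous_map_compose[OF continuous_map_snd cN2[OF that]] by (auto simp: o_def)
  have norm1: "norm (fst x k) = 1" if "x \<in> carrier ?M" "k < d" for x k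
    using that car by (auto simp: PiE_iff)
  then have norm2: "norm (a k) = 1" if "(a, b) \<in> carrier ?M" "k < d" for a b k
    using that by fastforce
  show ?thesis
  proof (unfold_locales, fact top)
    show "Hausdorff_space ?N"
      by (simp add: torus_vector_topology_def Hausdorff_space_prod_topology Hausdorff_space_product_topology Hausdorff_space_subtopology)
    have "continuous_map (prod_topology ?N ?N) ?N
       (\<lambda>z. (\<lambda>i\<in>{..<d}. fst (fst z) i * fst (snd z) i, \<lambda>i\<in>{..<v}. snd (fst z) i + snd (snd z) i))"
      by (intro contN continuous_map_complex_mult comp1 continuous_map_add comp2)
        (auto simp: norm_mult top norm1 norm2)
    then show "continuous_map (prod_topology ?N ?N) ?N (\<lambda>(x, y). x \<otimes>\<^bsub>?M\<^esub> y)"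
      by (rule continuous_map_eq) (auto simp: mul)
    have "continuous_map ?N ?N (\<lambda>z. (\<lambda>i\<in>{..<d}. cnj (fst z i), \<lambda>i\<in>{..<v}. - snd z i))"
    proof (intro contN continuous_map_minus cN2)
      show "continuous_map ?N euclidean (\<lambda>z. cnj (fst z k))" if "k < d" for k
        using continuous_map_compose[OF cN1[OF that], of euclidean cnj]
        by (simp add: o_def continuous_on_cnj)
    qed (auto simp: top norm1 norm2)
    then show "continuous_map ?N ?N (\<lambda>x. inv\<^bsub>?M\<^esub> x)"
      by (rule continuous_map_eq) (auto simp: inv top)
  next
    fix g assume g: "g \<in> carrier ?M"
    \<comment> \<open>A logarithm of g in each coordinate: angles and real coordinates are scaled by
      x, so x = 1 returns g.\<close>
    let ?e = "\<lambda>x. (\<lambda>i\<in>{..<d}. cis (Arg (fst g i) * x), \<lambda>i\<in>{..<v}. snd g i * x)"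
    have "continuous_map euclideanreal ?N ?e"
      by (intro contN) (auto intro!: continuous_intros)
    then have "one_param ?M ?N ?e"
      by (auto simp: one_param_def mul cis_mult distrib_left intro!: restrict_ext)
    moreover have "?e 1 = g"
    proof -
      have "cis (Arg (fst g i)) = fst g i" if "i < d" for i
        using norm1[OF g that] by (subst cis_Arg) (auto simp: sgn_div_norm)
      then show ?thesis using g car
        by (cases g) (auto simp: fun_eq_iff PiE_iff extensional_def)
    qed
    ultimately show "\<exists>e. one_param ?M ?N e \<and> e 1 = g" by blast
  next
    fix n :: nat assume n: "0 < n"
    have "{g \<in> carrier ?M. g [^]\<^bsub>?M\<^esub> n = \<one>\<^bsub>?M\<^esub>}
        \<subseteq> (\<Pi>\<^sub>E i\<in>{..<d}. {z. z ^ n = 1}) \<times> (\<Pi>\<^sub>E i\<in>{..<v}. {0})"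
    proof
      fix g assume g: "g \<in> {g \<in> carrier ?M. g [^]\<^bsub>?M\<^esub> n = \<one>\<^bsub>?M\<^esub>}"
      then have eq: "(\<lambda>i\<in>{..<d}. fst g i ^ n) = (\<lambda>i\<in>{..<d}. 1)" "(\<lambda>i\<in>{..<v}. real n * snd g i) = (\<lambda>i\<in>{..<v}. 0)"
        by (auto simp: pow one)
      have "fst g i ^ n = 1" if "i < d" for i
        using fun_cong[OF eq(1), of i] that by simp
      moreover have "snd g i = 0" if "i < v" for i
        using fun_cong[OF eq(2), of i] that n by simp
      ultimately show "g \<in> (\<Pi>\<^sub>E i\<in>{..<d}. {z. z ^ n = 1}) \<times> (\<Pi>\<^sub>E i\<in>{..<v}. {0})"
        using g car by (cases g) (auto simp: PiE_iff extensional_def fun_eq_iff)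
    qed
    moreover have "finite {z::complex. z ^ n = 1}" using n by (intro finite_nth_roots)
    ultimately show "finite {g \<in> carrier ?M. g [^]\<^bsub>?M\<^esub> n = \<one>\<^bsub>?M\<^esub>}"
      by (elim finite_subset) (intro finite_cartesian_product finite_PiE, auto)
  next
    show "(\<forall>n::nat. 0 < n \<longrightarrow> (\<exists>\<rho>. continuous_map ?N ?N \<rho> \<and> (\<forall>g\<in>carrier ?M. \<rho> g [^]\<^bsub>?M\<^esub> n \<otimes>\<^bsub>?M\<^esub> g = \<one>\<^bsub>?M\<^esub>))) \<or>
       (\<exists>e. one_param ?M ?N e \<and> (\<forall>x. e x = \<one>\<^bsub>?M\<^esub> \<longleftrightarrow> x \<in> \<int>))"
    proof (cases "d = 0")
      case True
      have "\<exists>\<rho>. continuous_map ?N ?N \<rho> \<and> (\<forall>g\<in>carrier ?M. \<rho> g [^]\<^bsub>?M\<^esub> n \<otimes>\<^bsub>?M\<^esub> g = \<one>\<^bsub>?M\<^esub>)"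
        if "0 < n" for n :: nat
      proof (intro exI conjI ballI)
        \<comment> \<open>The sign is negative because the root solves n x + g = 0, the form in
          which a hypersurface cuts a fibre. For d = 0 the circle part is the empty family.\<close>
        let ?\<rho> = "\<lambda>z. (\<lambda>i\<in>{..<d}. fst z i, \<lambda>i\<in>{..<v}. snd z i * (- 1 / real n))"
        show c: "continuous_map ?N ?N ?\<rho>"
          by (intro contN continuous_map_real_mult cN2 cN1) (auto simp: top norm1 norm2)
        fix g assume g: "g \<in> carrier ?M"
        then have "?\<rho> g \<in> carrier ?M" using c by (auto simp: continuous_map_def top)
        then show "?\<rho> g [^]\<^bsub>?M\<^esub> n \<otimes>\<^bsub>?M\<^esub> g = \<one>\<^bsub>?M\<^esub>"
          unfolding pow[OF \<open>?\<rho> g \<in> carrier ?M\<close>] mul one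
          using that True by (auto intro!: restrict_ext)
      qed
      then show ?thesis by blast
    next
      case False
      \<comment> \<open>The diagonal circle, parametrized with period 1; since d > 0, coordinate 0
        detects its kernel.\<close>
      let ?e = "\<lambda>x. (\<lambda>i\<in>{..<d}. cis (2 * pi * x), \<lambda>i\<in>{..<v}. 0::real)"
      have "continuous_map euclideanreal ?N ?e"
        by (intro contN) (auto intro!: continuous_intros)
      then have "one_param ?M ?N ?e"
        by (auto simp: one_param_def mul cis_mult distrib_left intro!: restrict_ext)
      moreover have "?e x = \<one>\<^bsub>?M\<^esub> \<longleftrightarrow> x \<in> \<int>" for x
      proof -
        have "?e x = \<one>\<^bsub>?M\<^esub> \<longleftrightarrow> cis (2 * pi * x) = 1"
        proof
          assume "?e x = \<one>\<^bsub>?M\<^esub>"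
          then have "(\<lambda>i\<in>{..<d}. cis (2 * pi * x)) 0 = (\<lambda>i\<in>{..<d}. 1) 0" by (simp add: one)
          then show "cis (2 * pi * x) = 1" using False by simp
        qed (simp add: one)
        also have "\<dots> \<longleftrightarrow> cos (2 * pi * x) = 1"
          by (auto simp: complex_eq_iff sin_eq_0_pi cos_one_sin_zero)
        also have "\<dots> \<longleftrightarrow> x \<in> \<int>"
          by (auto simp: cos_one_2pi_int Ints_def)
        finally show ?thesis .
      qed
      ultimately show ?thesis by blast
    qed
  qed
qed

corollary lie_target_of_connected_abelian_Lie_group:
  assumes "connected_abelian_Lie_group G \<tau> d v" shows "lie_target G \<tau>"
proof -
  obtain \<phi> where "comm_group G" "topspace \<tau> = carrier G" "\<phi> \<in> iso G (torus_vector_group d v)"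
    "homeomorphic_map \<tau> (torus_vector_topology d v) \<phi>"
    using assms unfolding connected_abelian_Lie_group_def by blast
  then show ?thesis by (rule lie_target_transport[OF lie_target_torus_vector])
qed

subsection \<open>Free abelian groups\<close>

text \<open>\<open>X\<close> is an isomorphism onto Z^r. Coordinates are functions on all naturals
  that vanish from r on, so that elements are compared by equality of functions and the passage to
  rational coefficients is a mere change of codomain.\<close>

locale free_abelian_coords = comm_group \<Gamma> for \<Gamma> :: "('a, 'm) monoid_scheme" (structure) +
  fixes X :: "'a \<Rightarrow> nat \<Rightarrow> int" and r :: nat
  assumes X_mult: "\<lbrakk>a \<in> carrier \<Gamma>; b \<in> carrier \<Gamma>\<rbrakk> \<Longrightarrow> X (a \<otimes> b) i = X a i + X b i"
    and X_supp: "\<lbrakk>a \<in> carrier \<Gamma>; r \<le> i\<rbrakk> \<Longrightarrow> X a i = 0"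
    and X_inj: "\<lbrakk>a \<in> carrier \<Gamma>; b \<in> carrier \<Gamma>; X a = X b\<rbrakk> \<Longrightarrow> a = b"
    and X_surj: "(\<And>i. r \<le> i \<Longrightarrow> c i = 0) \<Longrightarrow> \<exists>a\<in>carrier \<Gamma>. X a = c"

lemma free_abelian_of_rank_coords:
  assumes "free_abelian_of_rank \<Gamma> r"
  shows "\<exists>X. free_abelian_coords \<Gamma> X r"
proof -
  from assms obtain \<kappa> where \<kappa>: "\<kappa> \<in> iso \<Gamma> (free_Abelian_group {..<r})" and cg: "comm_group \<Gamma>"
    by (auto simp: free_abelian_of_rank_def is_iso_def)
  interpret comm_group \<Gamma> by fact
  have hom: "\<kappa> (a \<otimes>\<^bsub>\<Gamma>\<^esub> b) = \<kappa> a + \<kappa> b" if "a \<in> carrier \<Gamma>" "b \<in> carrier \<Gamma>" for a b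
    using \<kappa> that by (auto simp: iso_def hom_def)
  have bij: "bij_betw \<kappa> (carrier \<Gamma>) (carrier (free_Abelian_group {..<r}))"
    using \<kappa> by (auto simp: iso_def)
  have keys: "Poly_Mapping.keys (\<kappa> a) \<subseteq> {..<r}" if "a \<in> carrier \<Gamma>" for a
    using bij_betwE[OF bij] that by simp
  show ?thesis
  proof (intro exI, unfold_locales)
    let ?X = "\<lambda>a. Poly_Mapping.lookup (\<kappa> a)"
    show "?X (a \<otimes>\<^bsub>\<Gamma>\<^esub> b) i = ?X a i + ?X b i" if "a \<in> carrier \<Gamma>" "b \<in> carrier \<Gamma>" for a b i
      using that by (simp add: hom lookup_add)
    show "?X a i = 0" if "a \<in> carrier \<Gamma>" "r \<le> i" for a i
      using keys[OF that(1)] that(2) by (meson in_keys_iff lessThan_iff linorder_not_less subsetD)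
    show "a = b" if "a \<in> carrier \<Gamma>" "b \<in> carrier \<Gamma>" "?X a = ?X b" for a b
      using bij that by (auto simp: bij_betw_def inj_on_def poly_mapping_eqI)
    fix c :: "nat \<Rightarrow> int" assume c: "\<And>i. r \<le> i \<Longrightarrow> c i = 0"
    have fin: "finite {i. c i \<noteq> 0}"
      by (rule finite_subset[of _ "{..<r}"]) (use c in \<open>auto simp: not_le[symmetric]\<close>)
    then have l: "Poly_Mapping.lookup (Abs_poly_mapping c) = c" by simp
    then have "Poly_Mapping.keys (Abs_poly_mapping c) \<subseteq> {..<r}"
      using c by (auto simp: in_keys_iff not_le[symmetric])
    then obtain a where "a \<in> carrier \<Gamma>" "\<kappa> a = Abs_poly_mapping c"
      using bij by (metis bij_betw_def carrier_free_Abelian_group_iff imageE)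
    with l show "\<exists>a\<in>carrier \<Gamma>. ?X a = c" by metis
  qed
qed

text \<open>These are the directions in which one can move in \<open>Hom \<Gamma> G\<close>:
  composed with one-parameter subgroups of G they give one-parameter subgroups of the group of
  homomorphisms.\<close>

definition real_hom :: "('a, 'm) monoid_scheme \<Rightarrow> ('a \<Rightarrow> real) \<Rightarrow> bool" where
  "real_hom \<Gamma> \<xi> \<longleftrightarrow> (\<forall>a\<in>carrier \<Gamma>. \<forall>b\<in>carrier \<Gamma>. \<xi> (a \<otimes>\<^bsub>\<Gamma>\<^esub> b) = \<xi> a + \<xi> b)"

context free_abelian_coords
begin

lemma X_one: "X \<one> i = 0"
  using X_mult[of \<one> \<one> i] by simp

lemma X_inv: "a \<in> carrier \<Gamma> \<Longrightarrow> X (inv a) i = - X a i"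
  using X_mult[of a "inv a" i] by (simp add: X_one)

lemma X_pow: "a \<in> carrier \<Gamma> \<Longrightarrow> X (a [^] (n::nat)) i = int n * X a i"
  by (induction n) (auto simp: X_one X_mult algebra_simps)

lemma X_int_pow: "a \<in> carrier \<Gamma> \<Longrightarrow> X (a [^] (k::int)) i = k * X a i"
proof (cases k)
  case (nonneg n)
  assume "a \<in> carrier \<Gamma>"
  with nonneg X_pow[of a n i] show ?thesis by (simp add: int_pow_int)
next
  case (neg n)
  assume a: "a \<in> carrier \<Gamma>"
  have "X (a [^] k) i = X (inv (a [^] Suc n)) i"
    unfolding neg(1) using a by (subst int_pow_neg_int) auto
  also have "\<dots> = - X (a [^] Suc n) i" by (rule X_inv) (use a in auto)
  also have "\<dots> = k * X a i" unfolding X_pow[OF a] neg(1) by (simp add: algebra_simps)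
  finally show ?thesis .
qed

lemma X_finprod: "f \<in> I \<rightarrow> carrier \<Gamma> \<Longrightarrow> X (finprod \<Gamma> f I) i = (\<Sum>j\<in>I. X (f j) i)"
  by (induction I rule: infinite_finite_induct) (auto simp: X_one X_mult)

text \<open>Either \<beta> lies outside the rational span of S, and a functional kills S but not
  \<beta>, or clearing denominators puts a positive multiple of \<beta> into
  \<open>generate \<Gamma> S\<close>. In the first case one can move along the flat of S and change
  the value at \<beta>; in the second the value at \<beta> is torsion on that flat.\<close>

lemma real_hom_separates:
  assumes S: "S \<subseteq> carrier \<Gamma>" and \<beta>: "\<beta> \<in> carrier \<Gamma>"
  shows "(\<exists>\<xi>. real_hom \<Gamma> \<xi> \<and> (\<forall>s\<in>S. \<xi> s = 0) \<and> \<xi> \<beta> = 1) \<or>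
         (\<exists>m::nat. 0 < m \<and> \<beta> [^] m \<in> generate \<Gamma> S)"
proof -
  define sc :: "rat \<Rightarrow> (nat \<Rightarrow> rat) \<Rightarrow> nat \<Rightarrow> rat" where "sc c f = (\<lambda>i. c * f i)" for c f
  have sc: "sc c f i = c * f i" for c f i by (simp add: sc_def)
  interpret V: vector_space sc
    by unfold_locales (simp_all add: fun_eq_iff sc distrib_left distrib_right)
  interpret P: vector_space_pair sc "(*) :: rat \<Rightarrow> rat \<Rightarrow> rat"
    by unfold_locales (simp_all add: algebra_simps)
  define \<iota> :: "'a \<Rightarrow> nat \<Rightarrow> rat" where "\<iota> a = (\<lambda>i. of_int (X a i))" for a
  show ?thesis
  proof (cases "\<iota> \<beta> \<in> V.span (\<iota> ` S)")
    case True
    \<comment> \<open>The vectors with a positive integer multiple coming from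
      \<open>generate \<Gamma> S\<close>. A subspace that contains the image of S contains its span,
      hence \<open>\<iota> \<beta>\<close>.\<close>
    define W where "W = {w. \<exists>m>0. \<exists>\<gamma>\<in>generate \<Gamma> S. sc (of_nat m) w = \<iota> \<gamma>}"
    have gen: "x \<in> carrier \<Gamma>" if "x \<in> generate \<Gamma> S" for x
      using generate_in_carrier[OF S that] .
    interpret gs: subgroup "generate \<Gamma> S" \<Gamma> by (rule generate_is_subgroup[OF S])
    have pw: "x [^] k \<in> generate \<Gamma> S" if "x \<in> generate \<Gamma> S" for x and k :: int
      using subgroup_int_pow_closed[OF generate_is_subgroup[OF S] that] .
    have "V.subspace W"
    proof (rule V.subspaceI)
      show "0 \<in> W" unfolding W_def
        by (auto simp: \<iota>_def X_one sc fun_eq_iff intro!: exI[of _ "1::nat"] bexI[of _ "\<one>"])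
    next
      fix u w assume "u \<in> W" "w \<in> W"
      then obtain m n :: nat and \<gamma> \<delta> where mn: "m > 0" "n > 0" "\<gamma> \<in> generate \<Gamma> S" "\<delta> \<in> generate \<Gamma> S"
        "sc (of_nat m) u = \<iota> \<gamma>" "sc (of_nat n) w = \<iota> \<delta>"
        unfolding W_def by blast
      have "sc (of_nat (m * n)) (u + w) = \<iota> (\<gamma> [^] int n \<otimes> \<delta> [^] int m)"
      proof
        fix i
        have "rat_of_nat m * u i = of_int (X \<gamma> i)" "rat_of_nat n * w i = of_int (X \<delta> i)"
          using mn(5,6) by (auto simp: \<iota>_def fun_eq_iff sc)
        then show "sc (of_nat (m * n)) (u + w) i = \<iota> (\<gamma> [^] int n \<otimes> \<delta> [^] int m) i"
          using mn gen by (simp add: \<iota>_def sc X_mult X_int_pow algebra_simps) 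
      qed
      with mn show "u + w \<in> W" unfolding W_def
        by (intro CollectI exI[of _ "m * n"] conjI bexI[of _ "\<gamma> [^] int n \<otimes> \<delta> [^] int m"]) (auto intro!: pw)
    next
      fix c u assume "u \<in> W"
      then obtain m :: nat and \<gamma> where mn: "m > 0" "\<gamma> \<in> generate \<Gamma> S" "sc (of_nat m) u = \<iota> \<gamma>"
        unfolding W_def by blast
      obtain p q where pq: "quotient_of c = (p, q)" by fastforce
      then have c: "c = of_int p / of_int q" and q: "q > 0"
        using quotient_of_div quotient_of_denom_pos by auto
      have "sc (of_nat (m * nat q)) (sc c u) = \<iota> (\<gamma> [^] p)"
      proof
        fix i
        have "rat_of_nat m * u i = of_int (X \<gamma> i)"
          using mn(3) by (auto simp: \<iota>_def fun_eq_iff sc)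
        then show "sc (of_nat (m * nat q)) (sc c u) i = \<iota> (\<gamma> [^] p) i"
          using mn gen q by (simp add: \<iota>_def sc X_int_pow c field_simps)
      qed
      with mn q show "sc c u \<in> W" unfolding W_def
        by (intro CollectI exI[of _ "m * nat q"] conjI bexI[of _ "\<gamma> [^] p"]) (auto intro!: pw)
    qed
    moreover have "\<iota> ` S \<subseteq> W" unfolding W_def
      by (auto simp: sc fun_eq_iff intro!: exI[of _ "1::nat"] intro: generate.incl)
    ultimately have "\<iota> \<beta> \<in> W" using True V.span_minimal by blast
    then obtain m :: nat and \<gamma> where mn: "m > 0" "\<gamma> \<in> generate \<Gamma> S" "sc (of_nat m) (\<iota> \<beta>) = \<iota> \<gamma>"
        unfolding W_def by blast
    have "X (\<beta> [^] m) i = X \<gamma> i" for i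
    proof -
      have "rat_of_int (int m * X \<beta> i) = rat_of_int (X \<gamma> i)"
        using fun_cong[OF mn(3), of i] by (simp add: \<iota>_def sc)
      then show ?thesis using \<beta> by (simp only: of_int_eq_iff X_pow)
    qed
    then have "\<beta> [^] m = \<gamma>" using \<beta> mn gen by (intro X_inj) auto
    with mn show ?thesis by blast
  next
    case False
    \<comment> \<open>B together with \<open>\<iota> \<beta>\<close> is independent, so a functional
      can be prescribed as 1 at \<open>\<iota> \<beta>\<close> and 0 on B.\<close>
    obtain B where B: "B \<subseteq> \<iota> ` S" "V.independent B" "\<iota> ` S \<subseteq> V.span B"
      using V.maximal_independent_subset by metis
    with False have nB: "\<iota> \<beta> \<notin> V.span B" using V.span_mono by blast
    then have "V.independent (insert (\<iota> \<beta>) B)" using B(2) by (rule V.independent_insertI)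
    then obtain g where g: "Vector_Spaces.linear sc (*) g"
      "\<forall>x\<in>insert (\<iota> \<beta>) B. g x = (if x = \<iota> \<beta> then 1 else 0)"
      using P.linear_independent_extend[of "insert (\<iota> \<beta>) B" "\<lambda>x. if x = \<iota> \<beta> then 1 else 0"] by blast
    have "\<And>b. b \<in> B \<Longrightarrow> g b = 0" using g(2) nB V.span_base by auto
    then have 0: "g x = 0" if "x \<in> V.span B" for x
      using P.linear_eq_0_on_span[OF g(1) _ that] by blast
    let ?\<xi> = "\<lambda>a. of_rat (g (\<iota> a)) :: real"
    have "\<iota> (a \<otimes> b) = \<iota> a + \<iota> b" if "a \<in> carrier \<Gamma>" "b \<in> carrier \<Gamma>" for a b
      using that by (auto simp: \<iota>_def X_mult fun_eq_iff)
    then have "real_hom \<Gamma> ?\<xi>"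
      by (auto simp: real_hom_def P.linear_add[OF g(1)] of_rat_add)
    moreover have "\<forall>s\<in>S. ?\<xi> s = 0" using 0 B(3) by auto
    moreover have "?\<xi> \<beta> = 1" using g(2) by simp
    ultimately show ?thesis by blast
  qed
qed

lemma int_pow_root:
  assumes \<gamma>: "\<gamma> \<in> carrier \<Gamma>" and dvd: "\<And>i. k dvd X \<gamma> i"
  shows "\<exists>\<delta>\<in>carrier \<Gamma>. \<delta> [^] (k::int) = \<gamma>"
proof -
  obtain \<delta> where \<delta>: "\<delta> \<in> carrier \<Gamma>" "X \<delta> = (\<lambda>i. X \<gamma> i div k)"
    using X_surj[of "\<lambda>i. X \<gamma> i div k"] X_supp[OF \<gamma>] by fastforce
  with dvd have "X (\<delta> [^] k) = X \<gamma>" by (auto simp: X_int_pow fun_eq_iff)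
  with \<delta> \<gamma> X_inj show ?thesis by blast
qed

lemma ex_basis:
  "\<exists>b. b \<in> {..<r} \<rightarrow> carrier \<Gamma> \<and> (\<forall>a\<in>carrier \<Gamma>. a = finprod \<Gamma> (\<lambda>i. b i [^] X a i) {..<r})"
proof -
  have "\<forall>i. \<exists>b. i < r \<longrightarrow> b \<in> carrier \<Gamma> \<and> X b = (\<lambda>j. if j = i then 1 else 0)"
    using X_surj[of "\<lambda>j. if j = _ then 1 else 0"] by (metis leD)
  then obtain b where b: "\<And>i. i < r \<Longrightarrow> b i \<in> carrier \<Gamma>" "\<And>i j. i < r \<Longrightarrow> X (b i) j = (if j = i then 1 else 0)"
    by metis
  have "a = finprod \<Gamma> (\<lambda>i. b i [^] X a i) {..<r}" if a: "a \<in> carrier \<Gamma>" for a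
  proof (rule X_inj[OF a])
    show "X a = X (finprod \<Gamma> (\<lambda>i. b i [^] X a i) {..<r})"
    proof
      fix j
      have "X (finprod \<Gamma> (\<lambda>i. b i [^] X a i) {..<r}) j = (\<Sum>i<r. X a i * (if j = i then 1 else 0))"
        using b by (subst X_finprod) (auto simp: X_int_pow intro!: sum.cong)
      also have "\<dots> = X a j" using X_supp[OF a, of j] by (cases "j < r") (auto simp: if_distrib cong: if_cong)
      finally show "X a j = X (finprod \<Gamma> (\<lambda>i. b i [^] X a i) {..<r}) j" ..
    qed
  qed (use b in auto)
  with b(1) show ?thesis by (intro exI[of _ b]) auto
qed

end

subsection \<open>The group of homomorphisms and components of its subgroups\<close>

locale hom_space = G: lie_target G \<tau> + \<Gamma>: free_abelian_coords \<Gamma> X r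
  for G :: "('b, 'n) monoid_scheme" and \<tau> :: "'b topology"
    and \<Gamma> :: "('a, 'm) monoid_scheme" and X :: "'a \<Rightarrow> nat \<Rightarrow> int" and r :: nat

section \<open>Continuity, torsion and one-parameter subgroups in the target group\<close>

context lie_target
begin

lemma int_pow_neg_eq: "(k::int) < 0 \<Longrightarrow> a [^] k = inv (a [^] nat (- k))"
  unfolding int_pow_def2 by simp

lemma int_pow_nonneg_eq: "\<not> (k::int) < 0 \<Longrightarrow> a [^] k = a [^] nat k"
  unfolding int_pow_def2 by simp

lemma continuous_map_mult:
  assumes "continuous_map Z \<tau> f" "continuous_map Z \<tau> g"
  shows "continuous_map Z \<tau> (\<lambda>x. f x \<otimes> g x)"
proof -
  have 1: "continuous_map Z (prod_topology \<tau> \<tau>) (\<lambda>x. (f x, g x))"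
    unfolding continuous_map_pairwise using assms by (simp add: o_def)
  show ?thesis using continuous_map_compose[OF 1 mult_cont] by (simp add: o_def)
qed

lemma continuous_map_closed: "continuous_map Z \<tau> f \<Longrightarrow> x \<in> topspace Z \<Longrightarrow> f x \<in> carrier G"
  by (auto simp: continuous_map_def topspace_eq)

lemma continuous_map_inv:
  assumes "continuous_map Z \<tau> f"
  shows "continuous_map Z \<tau> (\<lambda>x. inv (f x))"
  using continuous_map_compose[OF assms inv_cont] by (simp add: o_def)

lemma continuous_map_nat_pow:
  assumes "continuous_map Z \<tau> f"
  shows "continuous_map Z \<tau> (\<lambda>x. f x [^] (n::nat))"
  by (induction n) (auto intro!: continuous_map_mult assms simp: topspace_eq)

lemma continuous_map_int_pow:
  assumes "continuous_map Z \<tau> f"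
  shows "continuous_map Z \<tau> (\<lambda>x. f x [^] (k::int))"
proof (cases "k < 0")
  case True
  show ?thesis unfolding int_pow_neg_eq[OF True]
    by (rule continuous_map_inv[OF continuous_map_nat_pow[OF assms]])
next
  case False
  show ?thesis unfolding int_pow_nonneg_eq[OF False]
    by (rule continuous_map_nat_pow[OF assms])
qed

lemma continuous_map_finprod:
  assumes "finite I" "\<And>i. i \<in> I \<Longrightarrow> continuous_map Z \<tau> (f i)"
  shows "continuous_map Z \<tau> (\<lambda>x. finprod G (\<lambda>i. f i x) I)"
  using assms
proof (induction I)
  case empty
  then show ?case by (simp add: topspace_eq)
next
  case (insert i I)
  have "continuous_map Z \<tau> (\<lambda>x. f i x \<otimes> finprod G (\<lambda>i. f i x) I)"
    by (intro continuous_map_mult insert) auto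
  moreover have "f j x \<in> carrier G" if "x \<in> topspace Z" "j \<in> insert i I" for x j
    using continuous_map_closed[OF insert.prems] that by blast
  ultimately show ?case
    by (elim continuous_map_eq) (use insert.hyps in \<open>auto intro!: finprod_insert[symmetric]\<close>)
qed

lemma finite_torsion:
  assumes "k \<noteq> 0" shows "finite {g \<in> carrier G. g [^] (k::int) = \<one>}"
proof -
  have "{g \<in> carrier G. g [^] k = \<one>} \<subseteq> {g \<in> carrier G. g [^] nat \<bar>k\<bar> = \<one>}"
  proof -
    have "g [^] nat \<bar>k\<bar> = \<one>" if g: "g \<in> carrier G" "g [^] k = \<one>" for g
    proof (cases "k < 0")
      case True
      then have "nat \<bar>k\<bar> = nat (- k)" by simp
      then show ?thesis using g(2) unfolding int_pow_neg_eq[OF True]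
        by (metis g(1) inv_eq_1_iff nat_pow_closed)
    next
      case False
      then have "nat \<bar>k\<bar> = nat k" by simp
      then show ?thesis using g(2) unfolding int_pow_nonneg_eq[OF False] by metis
    qed
    then show ?thesis by blast
  qed
  moreover have "finite {g \<in> carrier G. g [^] nat \<bar>k\<bar> = \<one>}"
    using assms by (intro finite_torsion_nat) auto
  ultimately show ?thesis by (rule finite_subset)
qed

text \<open>The coefficient of \<beta>0 in an element of \<Gamma> has a sign, so integer exponents
  are needed. For k < 0 the root belonging to -k is inverted.\<close>

lemma root_or_circle:
  "(\<forall>k::int. k \<noteq> 0 \<longrightarrow> (\<exists>\<rho>. continuous_map \<tau> \<tau> \<rho> \<and> (\<forall>g\<in>carrier G. \<rho> g [^] k \<otimes> g = \<one>))) \<or>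
   (\<exists>e. one_param G \<tau> e \<and> (\<forall>x. e x = \<one> \<longleftrightarrow> x \<in> \<int>))"
  using root_or_circle_nat
proof (elim disjE)
  assume r: "\<forall>n::nat. 0 < n \<longrightarrow> (\<exists>\<rho>. continuous_map \<tau> \<tau> \<rho> \<and> (\<forall>g\<in>carrier G. \<rho> g [^] n \<otimes> g = \<one>))"
  have "\<exists>\<rho>. continuous_map \<tau> \<tau> \<rho> \<and> (\<forall>g\<in>carrier G. \<rho> g [^] k \<otimes> g = \<one>)" if k: "k \<noteq> 0" for k :: int
  proof -
    obtain \<rho> where \<rho>: "continuous_map \<tau> \<tau> \<rho>" "\<And>g. g \<in> carrier G \<Longrightarrow> \<rho> g [^] nat \<bar>k\<bar> \<otimes> g = \<one>"
      using r k by (metis nat_0_iff zero_less_nat_eq zero_less_abs_iff)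
    have \<rho>c: "\<rho> g \<in> carrier G" if "g \<in> carrier G" for g
      using continuous_map_closed[OF \<rho>(1)] that by (simp add: topspace_eq)
    show ?thesis
    proof (cases "k < 0")
      case True
      have "inv (\<rho> g) [^] k \<otimes> g = \<one>" if g: "g \<in> carrier G" for g
      proof -
        have "inv (\<rho> g) [^] k = \<rho> g [^] nat \<bar>k\<bar>"
          unfolding int_pow_neg_eq[OF True] nat_pow_inv[OF \<rho>c[OF g]] using \<rho>c[OF g] True by simp
        then show ?thesis using \<rho>(2)[OF g] by simp
      qed
      then show ?thesis using continuous_map_inv[OF \<rho>(1)] by (intro exI[of _ "\<lambda>g. inv (\<rho> g)"]) auto
    next
      case False
      then have "nat \<bar>k\<bar> = nat k" by simp
      then show ?thesis using \<rho> unfolding int_pow_nonneg_eq[OF False] by metis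
    qed
  qed
  then show ?thesis by blast
qed blast

text \<open>A finite subspace of a Hausdorff space is discrete, so a connected image inside it is a
  point. The finite sets will be the torsion sets of \<open>finite_torsion\<close>.\<close>

lemma constant_of_finite_range:
  assumes C: "connectedin Z C" and f: "continuous_map Z \<tau> f"
    and F: "finite F" "f ` C \<subseteq> F" and x: "x \<in> C" "y \<in> C"
  shows "f x = f y"
proof -
  have con: "connectedin \<tau> (f ` C)" by (rule connectedin_continuous_map_image[OF f C])
  have top: "topspace (subtopology \<tau> (f ` C)) = f ` C"
    using con by (meson connectedin_subset_topspace topspace_subtopology_subset)
  have "finite (f ` C)" using F finite_subset by blast
  then have "subtopology \<tau> (f ` C) = discrete_topology (f ` C)"
    using finite_t1_space_imp_discrete_topology[OF top]
    by (simp add: Hausdorff Hausdorff_imp_t1_space Hausdorff_space_subtopology)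
  then have "connected_space (discrete_topology (f ` C))"
    using con by (simp add: connectedin_def)
  then show ?thesis using x by (auto simp: connected_space_discrete_topology)
qed

lemma one_param_closed: "one_param G \<tau> e \<Longrightarrow> e x \<in> carrier G"
  by (auto simp: one_param_def continuous_map_def topspace_eq)

lemma one_param_0:
  assumes "one_param G \<tau> e" shows "e 0 = \<one>"
  using assms one_param_closed[OF assms, of 0] unfolding one_param_def
  by (metis add.right_neutral r_cancel_one)

lemma one_param_mult: "one_param G \<tau> e \<Longrightarrow> e (x + y) = e x \<otimes> e y"
  by (simp add: one_param_def)

lemma one_param_nat_pow: "one_param G \<tau> e \<Longrightarrow> e (real n * x) = e x [^] n"
  by (induction n) (auto simp: one_param_0 one_param_mult distrib_right m_comm one_param_closed)

lemma one_param_int_pow: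
  assumes e: "one_param G \<tau> e" shows "e (of_int k * x) = e x [^] k"
proof (cases k)
  case (nonneg n)
  then show ?thesis using one_param_nat_pow[OF e, of n x] by (simp add: int_pow_int)
next
  case (neg n)
  have "e (of_int k * x) \<otimes> e (real (Suc n) * x) = e (of_int k * x + real (Suc n) * x)"
    by (simp only: one_param_mult[OF e])
  also have "\<dots> = \<one>" unfolding neg by (simp add: one_param_0[OF e] algebra_simps)
  finally have "e (of_int k * x) = inv (e (real (Suc n) * x))"
    by (rule inv_equality[symmetric]) (auto intro: one_param_closed[OF e])
  then show ?thesis unfolding neg one_param_nat_pow[OF e]
    by (subst int_pow_neg_int) (auto intro: one_param_closed[OF e])
qed

lemma topspace_Hom_topology: "topspace (Hom_topology \<Delta> G \<tau>) = Hom \<Delta> G"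
  by (auto simp: Hom_topology_def topspace_eq PiE_def Hom_def hom_def)

lemma continuous_map_Hom_topology:
  "continuous_map Z (Hom_topology \<Delta> G \<tau>) f \<longleftrightarrow>
     (\<forall>x\<in>topspace Z. f x \<in> Hom \<Delta> G) \<and> (\<forall>a\<in>carrier \<Delta>. continuous_map Z \<tau> (\<lambda>x. f x a))"
  unfolding Hom_topology_def continuous_map_in_subtopology continuous_map_componentwise
  by (auto simp: Hom_def image_subset_iff)

lemma continuous_map_eval: "a \<in> carrier \<Delta> \<Longrightarrow> continuous_map (Hom_topology \<Delta> G \<tau>) \<tau> (\<lambda>t. t a)"
  using continuous_map_Hom_topology[of "Hom_topology \<Delta> G \<tau>" \<Delta> "\<lambda>x. x"]
  by (simp add: continuous_map_id[unfolded id_def])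

end

context hom_space
begin

abbreviation "T \<equiv> Hom \<Gamma> G"
abbreviation "TT \<equiv> Hom_topology \<Gamma> G \<tau>"

lemma T_group_hom: "t \<in> T \<Longrightarrow> group_hom \<Gamma> G t"
  by unfold_locales (auto simp: Hom_def)

lemma T_closed: "t \<in> T \<Longrightarrow> a \<in> carrier \<Gamma> \<Longrightarrow> t a \<in> carrier G"
  by (auto simp: Hom_def hom_def)

lemma T_mult: "t \<in> T \<Longrightarrow> a \<in> carrier \<Gamma> \<Longrightarrow> b \<in> carrier \<Gamma> \<Longrightarrow> t (a \<otimes>\<^bsub>\<Gamma>\<^esub> b) = t a \<otimes>\<^bsub>G\<^esub> t b"
  by (auto simp: Hom_def hom_def)

lemma T_one: "t \<in> T \<Longrightarrow> t \<one>\<^bsub>\<Gamma>\<^esub> = \<one>\<^bsub>G\<^esub>"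
  using group_hom.hom_one[OF T_group_hom] .

lemma T_nat_pow: "t \<in> T \<Longrightarrow> a \<in> carrier \<Gamma> \<Longrightarrow> t (a [^]\<^bsub>\<Gamma>\<^esub> (n::nat)) = t a [^]\<^bsub>G\<^esub> n"
  using group_hom.hom_nat_pow[OF T_group_hom] by blast

lemma T_int_pow: "t \<in> T \<Longrightarrow> a \<in> carrier \<Gamma> \<Longrightarrow> t (a [^]\<^bsub>\<Gamma>\<^esub> (k::int)) = t a [^]\<^bsub>G\<^esub> k"
  using group_hom.hom_int_pow[OF T_group_hom] by blast

lemma T_generate:
  assumes t: "t \<in> T" and S: "S \<subseteq> carrier \<Gamma>" "\<And>s. s \<in> S \<Longrightarrow> t s = \<one>\<^bsub>G\<^esub>" and g: "g \<in> generate \<Gamma> S"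
  shows "t g = \<one>\<^bsub>G\<^esub>"
  using g
proof induction
  case (inv h)
  then show ?case using S group_hom.hom_inv[OF T_group_hom[OF t], of h] by auto
next
  case (eng a b)
  then show ?case using T_mult[OF t, of a b] S(1) \<Gamma>.generate_in_carrier by auto
qed (auto simp: S T_one t)

lemma real_hom_one: "real_hom \<Gamma> \<xi> \<Longrightarrow> \<xi> \<one>\<^bsub>\<Gamma>\<^esub> = 0"
  unfolding real_hom_def by (metis \<Gamma>.one_closed \<Gamma>.r_one add_cancel_right_right)

lemma real_hom_nat_pow: "real_hom \<Gamma> \<xi> \<Longrightarrow> a \<in> carrier \<Gamma> \<Longrightarrow> \<xi> (a [^]\<^bsub>\<Gamma>\<^esub> (n::nat)) = real n * \<xi> a"
  by (induction n) (auto simp: real_hom_one real_hom_def algebra_simps)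

lemma real_hom_generate:
  assumes \<xi>: "real_hom \<Gamma> \<xi>" and S: "S \<subseteq> carrier \<Gamma>" "\<And>s. s \<in> S \<Longrightarrow> \<xi> s = 0" and g: "g \<in> generate \<Gamma> S"
  shows "\<xi> g = 0"
  using g
proof induction
  case (inv h)
  then have h: "h \<in> carrier \<Gamma>" "\<xi> h = 0" "inv\<^bsub>\<Gamma>\<^esub> h \<in> carrier \<Gamma>" using S by auto
  then have "\<xi> (h \<otimes>\<^bsub>\<Gamma>\<^esub> inv\<^bsub>\<Gamma>\<^esub> h) = \<xi> h + \<xi> (inv\<^bsub>\<Gamma>\<^esub> h)" using \<xi> unfolding real_hom_def by blast
  with h show ?case by (simp add: real_hom_one[OF \<xi>])
next
  case (eng a b)
  then show ?case using \<xi> S(1) \<Gamma>.generate_in_carrier by (auto simp: real_hom_def)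
qed (auto simp: S real_hom_one \<xi>)

text \<open>The translate through t of the one-parameter subgroup in direction \<xi>. The value at a
  character a moves with speed \<open>\<xi> a\<close>: it rests where \<xi> vanishes, and at x = 1
  it has been multiplied by \<open>e 1\<close> where \<xi> is 1.\<close>

definition line :: "('a \<Rightarrow> 'b) \<Rightarrow> (real \<Rightarrow> 'b) \<Rightarrow> ('a \<Rightarrow> real) \<Rightarrow> real \<Rightarrow> 'a \<Rightarrow> 'b" where
  "line t e \<xi> x = (\<lambda>a\<in>carrier \<Gamma>. t a \<otimes>\<^bsub>G\<^esub> e (x * \<xi> a))"

lemma line_T:
  assumes t: "t \<in> T" and e: "one_param G \<tau> e" and \<xi>: "real_hom \<Gamma> \<xi>"
  shows "line t e \<xi> x \<in> T"
proof -
  have "t (a \<otimes>\<^bsub>\<Gamma>\<^esub> b) \<otimes>\<^bsub>G\<^esub> e (x * \<xi> (a \<otimes>\<^bsub>\<Gamma>\<^esub> b)) = t a \<otimes>\<^bsub>G\<^esub> e (x * \<xi> a) \<otimes>\<^bsub>G\<^esub> (t b \<otimes>\<^bsub>G\<^esub> e (x * \<xi> b))"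
    if "a \<in> carrier \<Gamma>" "b \<in> carrier \<Gamma>" for a b
    using that \<xi> by (simp add: T_mult[OF t] real_hom_def distrib_left G.one_param_mult[OF e]
        T_closed[OF t] G.one_param_closed[OF e] G.m_ac)
  then show ?thesis
    by (auto simp: Hom_def hom_def line_def T_closed[OF t] G.one_param_closed[OF e])
qed

lemma line_0:
  assumes t: "t \<in> T" and e: "one_param G \<tau> e" shows "line t e \<xi> 0 = t"
  using t by (auto simp: line_def G.one_param_0[OF e] T_closed[OF t] Hom_def extensional_def fun_eq_iff)

lemma connectedin_line:
  assumes t: "t \<in> T" and e: "one_param G \<tau> e" and \<xi>: "real_hom \<Gamma> \<xi>"
  shows "connectedin TT (range (line t e \<xi>))"
proof -
  have "continuous_map euclideanreal TT (line t e \<xi>)"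
    unfolding G.continuous_map_Hom_topology
  proof (intro conjI ballI line_T assms)
    fix a assume a: "a \<in> carrier \<Gamma>"
    have 1: "continuous_map euclideanreal euclideanreal (\<lambda>x. x * \<xi> a)" by (intro continuous_intros)
    have "continuous_map euclideanreal \<tau> (\<lambda>x. t a \<otimes>\<^bsub>G\<^esub> e (x * \<xi> a))"
      using e continuous_map_compose[OF 1, of \<tau> e] a
      by (intro G.continuous_map_mult) (auto simp: one_param_def o_def G.topspace_eq T_closed[OF t])
    then show "continuous_map euclideanreal \<tau> (\<lambda>x. line t e \<xi> x a)" using a by (simp add: line_def)
  qed
  then show ?thesis by (rule connectedin_continuous_map_image) (simp add: connectedin_iff_connected connected_UNIV)
qed

lemma T_one_map: "(\<lambda>a\<in>carrier \<Gamma>. \<one>\<^bsub>G\<^esub>) \<in> T"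
  by (auto simp: Hom_def hom_def)

text \<open>On a basis of \<Gamma> the values of a homomorphism are arbitrary. Each value of t there
  is reached from the identity along a one-parameter subgroup, and running through all of these
  simultaneously is a path \<open>p\<close> of homomorphisms from the trivial one to t.\<close>

lemma connected_TT: "connected_space TT"
proof -
  let ?o = "\<lambda>a\<in>carrier \<Gamma>. \<one>\<^bsub>G\<^esub>"
  have "connected_component_of TT ?o t" if t: "t \<in> T" for t
  proof -
    obtain b where b: "b \<in> {..<r} \<rightarrow> carrier \<Gamma>"
      "\<And>a. a \<in> carrier \<Gamma> \<Longrightarrow> a = finprod \<Gamma> (\<lambda>i. b i [^]\<^bsub>\<Gamma>\<^esub> X a i) {..<r}"
      using \<Gamma>.ex_basis by blast
    have "\<forall>i. \<exists>e. i < r \<longrightarrow> one_param G \<tau> e \<and> e 1 = t (b i)"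
      using G.ex_one_param T_closed[OF t] b(1) by (metis Pi_iff lessThan_iff)
    then obtain e where e: "\<And>i. i < r \<Longrightarrow> one_param G \<tau> (e i)" "\<And>i. i < r \<Longrightarrow> e i 1 = t (b i)"
      by metis
    define p where "p x = (\<lambda>a\<in>carrier \<Gamma>. finprod G (\<lambda>i. e i (x * of_int (X a i))) {..<r})" for x
    have ec: "(\<lambda>i. e i (y i)) \<in> {..<r} \<rightarrow> carrier G" for y
      using G.one_param_closed[OF e(1)] by auto
    have pT: "p x \<in> T" for x
    proof -
      have "finprod G (\<lambda>i. e i (x * of_int (X (a \<otimes>\<^bsub>\<Gamma>\<^esub> c) i))) {..<r} =
          finprod G (\<lambda>i. e i (x * of_int (X a i))) {..<r} \<otimes>\<^bsub>G\<^esub> finprod G (\<lambda>i. e i (x * of_int (X c i))) {..<r}"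
        if "a \<in> carrier \<Gamma>" "c \<in> carrier \<Gamma>" for a c
        unfolding G.finprod_multf[OF ec ec, symmetric]
        using that by (intro G.finprod_cong') (auto simp: \<Gamma>.X_mult distrib_left G.one_param_mult[OF e(1)] G.one_param_closed[OF e(1)])
      then show ?thesis
        by (auto simp: p_def Hom_def hom_def intro!: G.finprod_closed ec)
    qed
    have "continuous_map euclideanreal TT p"
      unfolding G.continuous_map_Hom_topology
    proof (intro conjI ballI pT)
      fix a assume a: "a \<in> carrier \<Gamma>"
      have "continuous_map euclideanreal \<tau> (\<lambda>x. finprod G (\<lambda>i. e i (x * of_int (X a i))) {..<r})"
      proof (intro G.continuous_map_finprod)
        fix i assume "i \<in> {..<r}"
        then have "continuous_map euclideanreal \<tau> (e i)" using e(1) by (simp add: one_param_def)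
        moreover have "continuous_map euclideanreal euclideanreal (\<lambda>x. x * of_int (X a i))" by (intro continuous_intros)
        ultimately show "continuous_map euclideanreal \<tau> (\<lambda>x. e i (x * of_int (X a i)))"
          using continuous_map_compose[of euclideanreal euclideanreal "\<lambda>x. x * of_int (X a i)" \<tau> "e i"] by (simp add: o_def)
      qed simp
      then show "continuous_map euclideanreal \<tau> (\<lambda>x. p x a)" using a by (simp add: p_def)
    qed
    then have con: "connectedin TT (range p)"
      by (rule connectedin_continuous_map_image) (simp add: connectedin_iff_connected connected_UNIV)
    have "p 0 = ?o"
      by (auto simp: p_def fun_eq_iff G.one_param_0[OF e(1)] intro!: G.finprod_one_eqI)
    moreover have "p 1 = t"
    proof
      fix a
      show "p 1 a = t a"
      proof (cases "a \<in> carrier \<Gamma>")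
        case a: True
        have bc: "(\<lambda>i. b i [^]\<^bsub>\<Gamma>\<^esub> X a i) \<in> {..<r} \<rightarrow> carrier \<Gamma>" using b(1) by auto
        have hom: "t (finprod \<Gamma> f I) = finprod G (t \<circ> f) I" if "f \<in> I \<rightarrow> carrier \<Gamma>" for f and I :: "nat set"
          using that
          by (induction I rule: infinite_finite_induct) (auto simp: T_one[OF t] T_mult[OF t] T_closed[OF t] Pi_iff)
        have "t a = finprod G (t \<circ> (\<lambda>i. b i [^]\<^bsub>\<Gamma>\<^esub> X a i)) {..<r}"
          by (subst b(2)[OF a]) (rule hom[OF bc])
        also have "\<dots> = finprod G (\<lambda>i. e i (1 * of_int (X a i))) {..<r}"
        proof (intro G.finprod_cong' refl ec)
          fix i assume i: "i \<in> {..<r}"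
          then have "(t \<circ> (\<lambda>i. b i [^]\<^bsub>\<Gamma>\<^esub> X a i)) i = e i 1 [^]\<^bsub>G\<^esub> X a i"
            using b(1) e(2) by (auto simp: T_int_pow[OF t] Pi_iff)
          then show "(t \<circ> (\<lambda>i. b i [^]\<^bsub>\<Gamma>\<^esub> X a i)) i = e i (1 * of_int (X a i))"
            using i G.one_param_int_pow[OF e(1), of i "X a i" 1] by simp
        qed
        finally show ?thesis using a by (simp add: p_def)
      next
        case False
        then show ?thesis using t by (simp add: p_def Hom_def extensional_def)
      qed
    qed
    ultimately have "?o \<in> range p" "t \<in> range p" by (metis rangeI)+
    with con show ?thesis unfolding connected_component_of_def by blast
  qed
  then show ?thesis
    unfolding connected_space_iff_connected_component G.topspace_Hom_topology
    by (meson connected_component_of_sym connected_component_of_trans)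
qed

section \<open>Flats and their connected components\<close>

definition flat :: "'a set \<Rightarrow> ('a \<Rightarrow> 'b) set" where
  "flat S = {t \<in> T. \<forall>a\<in>S. t a = \<one>\<^bsub>G\<^esub>}"

definition comps :: "'a set \<Rightarrow> ('a \<Rightarrow> 'b) set set" where
  "comps S = connected_components_of (subtopology TT (flat S))"

lemma layers_eq: "layers \<Gamma> G \<tau> A = (\<Union>S\<in>Pow A. comps S)"
proof -
  have "T \<inter> (\<Inter>a\<in>S. hypersurface \<Gamma> G a) = flat S" for S
    by (auto simp: flat_def hypersurface_def)
  then show ?thesis by (simp add: layers_def comps_def)
qed

lemma topspace_flat: "topspace (subtopology TT (flat S)) = flat S"
  by (auto simp: G.topspace_Hom_topology flat_def)

lemma comps_sub: "C \<in> comps S \<Longrightarrow> C \<subseteq> flat S"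
  unfolding comps_def using connected_components_of_subset topspace_flat by metis

lemma comps_T: "C \<in> comps S \<Longrightarrow> t \<in> C \<Longrightarrow> t \<in> T"
  using comps_sub by (auto simp: flat_def)

lemma comps_one: "C \<in> comps S \<Longrightarrow> t \<in> C \<Longrightarrow> a \<in> S \<Longrightarrow> t a = \<one>\<^bsub>G\<^esub>"
  using comps_sub by (auto simp: flat_def)

lemma comps_connected: "C \<in> comps S \<Longrightarrow> connectedin TT C"
  unfolding comps_def using connectedin_connected_components_of connectedin_subtopology by blast

lemma comps_nonempty: "C \<in> comps S \<Longrightarrow> C \<noteq> {}"
  unfolding comps_def by (rule nonempty_connected_components_of)

lemma comps_max: "\<lbrakk>C \<in> comps S; connectedin TT D; D \<subseteq> flat S; t \<in> C; t \<in> D\<rbrakk> \<Longrightarrow> D \<subseteq> C"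
  unfolding comps_def using connected_components_of_maximal
  by (metis connectedin_subtopology disjnt_iff)

lemma comps_ex: "t \<in> flat S \<Longrightarrow> \<exists>C\<in>comps S. t \<in> C"
  unfolding comps_def using Union_connected_components_of topspace_flat by (metis UnionE)

lemma comps_unique: "\<lbrakk>C \<in> comps S; D \<in> comps S; t \<in> C; t \<in> D\<rbrakk> \<Longrightarrow> C = D"
  by (meson comps_connected comps_max comps_sub subset_antisym)

lemma comps_T_eq: "flat S = T \<Longrightarrow> comps S = {T}"
proof -
  assume "flat S = T"
  then have "subtopology TT (flat S) = TT" using subtopology_topspace[of TT] by (simp add: G.topspace_Hom_topology)
  moreover have "TT \<noteq> trivial_topology" using G.topspace_Hom_topology[of \<Gamma>] T_one_map by fastforce
  ultimately show ?thesis
    using connected_TT by (simp add: comps_def connected_components_of_connected_space G.topspace_Hom_topology)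
qed

lemma T_comps: "T \<in> comps {}"
  using comps_T_eq[of "{}"] by (simp add: flat_def)

text \<open>A line whose direction kills S stays in the flat of S and is connected, so it cannot
  leave the component. Below, a contradiction often arises by moving inside a layer in this way and
  changing a value that is constant there.\<close>

lemma line_comps:
  assumes C: "C \<in> comps S" and t: "t \<in> C" and e: "one_param G \<tau> e" and \<xi>: "real_hom \<Gamma> \<xi>"
    and S: "S \<subseteq> carrier \<Gamma>" "\<And>s. s \<in> S \<Longrightarrow> \<xi> s = 0"
  shows "line t e \<xi> x \<in> C"
proof -
  have tT: "t \<in> T" using C t by (rule comps_T)
  have "range (line t e \<xi>) \<subseteq> flat S"
    using line_T[OF tT e \<xi>] S comps_one[OF C t] by (auto simp: flat_def line_def G.one_param_0[OF e])
  moreover have "t \<in> range (line t e \<xi>)" using line_0[OF tT e] by (metis rangeI)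
  ultimately show ?thesis using comps_max[OF C connectedin_line[OF tT e \<xi>] _ t] by blast
qed

end

subsection \<open>Layers of an arrangement with an admissible subgroup\<close>

text \<open>The direct sum of the infinite cyclic group of \<beta>0 and \<open>\<Gamma>''\<close>,
  in the form that yields coordinates: they exist by \<open>ex_decomp\<close> and are unique by
  \<open>\<beta>0_indep\<close>.\<close>

locale split_arrangement = hom_space G \<tau> \<Gamma> X r
  for G :: "('b, 'n) monoid_scheme" and \<tau> :: "'b topology"
    and \<Gamma> :: "('a, 'm) monoid_scheme" and X :: "'a \<Rightarrow> nat \<Rightarrow> int" and r :: nat +
  fixes A :: "'a set" and \<beta>0 :: 'a and \<Gamma>'' :: "'a set"
  assumes finite_A: "finite A" and A_carrier: "A \<subseteq> carrier \<Gamma>"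
    and \<beta>0_carrier: "\<beta>0 \<in> carrier \<Gamma>" and subgroup_\<Gamma>'': "subgroup \<Gamma>'' \<Gamma>"
    and ex_decomp: "a \<in> carrier \<Gamma> \<Longrightarrow> \<exists>k::int. \<exists>\<gamma>\<in>\<Gamma>''. a = \<beta>0 [^]\<^bsub>\<Gamma>\<^esub> k \<otimes>\<^bsub>\<Gamma>\<^esub> \<gamma>"
    and \<beta>0_indep: "\<beta>0 [^]\<^bsub>\<Gamma>\<^esub> (k::int) \<in> \<Gamma>'' \<Longrightarrow> k = 0"
begin

text \<open>\<open>adm_coeff\<close> is the absolute value of this coefficient. Keeping the sign
  makes it a homomorphism to the integers, and so a direction of motion: the one along the
  fibres.\<close>

definition kc :: "'a \<Rightarrow> int" where
  "kc a = (THE k. \<exists>\<gamma>\<in>\<Gamma>''. a = \<beta>0 [^]\<^bsub>\<Gamma>\<^esub> k \<otimes>\<^bsub>\<Gamma>\<^esub> \<gamma>)"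

definition pr :: "'a \<Rightarrow> 'a" where
  "pr a = inv\<^bsub>\<Gamma>\<^esub> (\<beta>0 [^]\<^bsub>\<Gamma>\<^esub> kc a) \<otimes>\<^bsub>\<Gamma>\<^esub> a"

definition AY :: "'a set" where
  "AY = {a \<in> A. kc a = 0}"

abbreviation "L \<equiv> layer_poset \<Gamma> G \<tau> A"
abbreviation "Q \<equiv> layers \<Gamma> G \<tau> AY"

lemma \<Gamma>''_carrier: "\<gamma> \<in> \<Gamma>'' \<Longrightarrow> \<gamma> \<in> carrier \<Gamma>"
  using subgroup.mem_carrier[OF subgroup_\<Gamma>''] .

lemma pow_\<beta>0_carrier: "\<beta>0 [^]\<^bsub>\<Gamma>\<^esub> (k::int) \<in> carrier \<Gamma>"
  using \<beta>0_carrier by simp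

lemma kc_eq:
  assumes "\<gamma> \<in> \<Gamma>''" shows "kc (\<beta>0 [^]\<^bsub>\<Gamma>\<^esub> k \<otimes>\<^bsub>\<Gamma>\<^esub> \<gamma>) = k"
  unfolding kc_def
proof (rule the_equality)
  show "\<exists>\<gamma>'\<in>\<Gamma>''. \<beta>0 [^]\<^bsub>\<Gamma>\<^esub> k \<otimes>\<^bsub>\<Gamma>\<^esub> \<gamma> = \<beta>0 [^]\<^bsub>\<Gamma>\<^esub> k \<otimes>\<^bsub>\<Gamma>\<^esub> \<gamma>'" using assms by blast
  fix j :: int assume "\<exists>\<gamma>'\<in>\<Gamma>''. \<beta>0 [^]\<^bsub>\<Gamma>\<^esub> k \<otimes>\<^bsub>\<Gamma>\<^esub> \<gamma> = \<beta>0 [^]\<^bsub>\<Gamma>\<^esub> j \<otimes>\<^bsub>\<Gamma>\<^esub> \<gamma>'"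
  then obtain \<gamma>' where \<gamma>': "\<gamma>' \<in> \<Gamma>''" and eq: "\<beta>0 [^]\<^bsub>\<Gamma>\<^esub> k \<otimes>\<^bsub>\<Gamma>\<^esub> \<gamma> = \<beta>0 [^]\<^bsub>\<Gamma>\<^esub> j \<otimes>\<^bsub>\<Gamma>\<^esub> \<gamma>'" by blast
  have c: "\<gamma> \<in> carrier \<Gamma>" "\<gamma>' \<in> carrier \<Gamma>" using assms \<gamma>' \<Gamma>''_carrier by auto
  let ?b = "\<lambda>i::int. \<beta>0 [^]\<^bsub>\<Gamma>\<^esub> i"
  have "?b (k - j) = ?b k \<otimes>\<^bsub>\<Gamma>\<^esub> inv\<^bsub>\<Gamma>\<^esub> (?b j)" using \<beta>0_carrier by (rule \<Gamma>.int_pow_diff)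
  also have "?b k = ?b j \<otimes>\<^bsub>\<Gamma>\<^esub> \<gamma>' \<otimes>\<^bsub>\<Gamma>\<^esub> inv\<^bsub>\<Gamma>\<^esub> \<gamma>"
    using eq c pow_\<beta>0_carrier by (metis \<Gamma>.inv_solve_right \<Gamma>.m_closed)
  also have "\<dots> \<otimes>\<^bsub>\<Gamma>\<^esub> inv\<^bsub>\<Gamma>\<^esub> (?b j) = \<gamma>' \<otimes>\<^bsub>\<Gamma>\<^esub> inv\<^bsub>\<Gamma>\<^esub> \<gamma> \<otimes>\<^bsub>\<Gamma>\<^esub> (?b j \<otimes>\<^bsub>\<Gamma>\<^esub> inv\<^bsub>\<Gamma>\<^esub> (?b j))"
    using c pow_\<beta>0_carrier by (simp add: \<Gamma>.m_ac del: \<Gamma>.r_inv)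
  also have "\<dots> = \<gamma>' \<otimes>\<^bsub>\<Gamma>\<^esub> inv\<^bsub>\<Gamma>\<^esub> \<gamma>" using c pow_\<beta>0_carrier by simp
  also have "\<dots> \<in> \<Gamma>''"
    using subgroup_\<Gamma>'' \<gamma>' assms by (simp add: subgroup.m_closed subgroup.m_inv_closed)
  finally have "?b (k - j) \<in> \<Gamma>''" .
  then show "j = k" using \<beta>0_indep by fastforce
qed

lemma pr_eq:
  assumes "\<gamma> \<in> \<Gamma>''" shows "pr (\<beta>0 [^]\<^bsub>\<Gamma>\<^esub> (k::int) \<otimes>\<^bsub>\<Gamma>\<^esub> \<gamma>) = \<gamma>"
  unfolding pr_def kc_eq[OF assms] using \<Gamma>''_carrier[OF assms] pow_\<beta>0_carrier
  by (metis \<Gamma>.inv_solve_left \<Gamma>.m_closed)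

lemma pr_in:
  assumes "a \<in> carrier \<Gamma>" shows "pr a \<in> \<Gamma>''"
proof -
  obtain k \<gamma> where "\<gamma> \<in> \<Gamma>''" "a = \<beta>0 [^]\<^bsub>\<Gamma>\<^esub> (k::int) \<otimes>\<^bsub>\<Gamma>\<^esub> \<gamma>" using ex_decomp[OF assms] by blast
  with pr_eq show ?thesis by simp
qed

lemma pr_carrier: "a \<in> carrier \<Gamma> \<Longrightarrow> pr a \<in> carrier \<Gamma>"
  using pr_in \<Gamma>''_carrier by blast

lemma decomp:
  assumes "a \<in> carrier \<Gamma>" shows "\<beta>0 [^]\<^bsub>\<Gamma>\<^esub> kc a \<otimes>\<^bsub>\<Gamma>\<^esub> pr a = a"
proof -
  obtain k \<gamma> where "\<gamma> \<in> \<Gamma>''" "a = \<beta>0 [^]\<^bsub>\<Gamma>\<^esub> (k::int) \<otimes>\<^bsub>\<Gamma>\<^esub> \<gamma>" using ex_decomp[OF assms] by blast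
  with pr_eq kc_eq show ?thesis by simp
qed

lemma mult_decomp:
  assumes "a \<in> carrier \<Gamma>" "b \<in> carrier \<Gamma>"
  shows "a \<otimes>\<^bsub>\<Gamma>\<^esub> b = \<beta>0 [^]\<^bsub>\<Gamma>\<^esub> (kc a + kc b) \<otimes>\<^bsub>\<Gamma>\<^esub> (pr a \<otimes>\<^bsub>\<Gamma>\<^esub> pr b)"
proof -
  have "a \<otimes>\<^bsub>\<Gamma>\<^esub> b = (\<beta>0 [^]\<^bsub>\<Gamma>\<^esub> kc a \<otimes>\<^bsub>\<Gamma>\<^esub> pr a) \<otimes>\<^bsub>\<Gamma>\<^esub> (\<beta>0 [^]\<^bsub>\<Gamma>\<^esub> kc b \<otimes>\<^bsub>\<Gamma>\<^esub> pr b)"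
    by (simp only: decomp assms)
  also have "\<dots> = (\<beta>0 [^]\<^bsub>\<Gamma>\<^esub> kc a \<otimes>\<^bsub>\<Gamma>\<^esub> \<beta>0 [^]\<^bsub>\<Gamma>\<^esub> kc b) \<otimes>\<^bsub>\<Gamma>\<^esub> (pr a \<otimes>\<^bsub>\<Gamma>\<^esub> pr b)"
    using assms pr_carrier pow_\<beta>0_carrier by (simp add: \<Gamma>.m_ac)
  finally show ?thesis using \<beta>0_carrier by (simp add: \<Gamma>.int_pow_mult)
qed

lemma pr_mult_in: "a \<in> carrier \<Gamma> \<Longrightarrow> b \<in> carrier \<Gamma> \<Longrightarrow> pr a \<otimes>\<^bsub>\<Gamma>\<^esub> pr b \<in> \<Gamma>''"
  using pr_in subgroup_\<Gamma>'' by (simp add: subgroup.m_closed)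

lemma kc_mult: "a \<in> carrier \<Gamma> \<Longrightarrow> b \<in> carrier \<Gamma> \<Longrightarrow> kc (a \<otimes>\<^bsub>\<Gamma>\<^esub> b) = kc a + kc b"
  using mult_decomp kc_eq[OF pr_mult_in] by simp

lemma pr_mult: "a \<in> carrier \<Gamma> \<Longrightarrow> b \<in> carrier \<Gamma> \<Longrightarrow> pr (a \<otimes>\<^bsub>\<Gamma>\<^esub> b) = pr a \<otimes>\<^bsub>\<Gamma>\<^esub> pr b"
  using mult_decomp pr_eq[OF pr_mult_in] by simp

lemma one_in_\<Gamma>'': "\<one>\<^bsub>\<Gamma>\<^esub> \<in> \<Gamma>''"
  using subgroup_\<Gamma>'' by (rule subgroup.one_closed)

lemma kc_\<beta>0: "kc \<beta>0 = 1" and pr_\<beta>0: "pr \<beta>0 = \<one>\<^bsub>\<Gamma>\<^esub>"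
  using kc_eq[OF one_in_\<Gamma>'', of 1] pr_eq[OF one_in_\<Gamma>'', of 1] \<beta>0_carrier by auto

lemma kc_\<Gamma>'': "\<gamma> \<in> \<Gamma>'' \<Longrightarrow> kc \<gamma> = 0" and pr_\<Gamma>'': "\<gamma> \<in> \<Gamma>'' \<Longrightarrow> pr \<gamma> = \<gamma>"
  using kc_eq[of \<gamma> 0] pr_eq[of \<gamma> 0] \<Gamma>''_carrier by auto

lemma kc_0_iff: "a \<in> carrier \<Gamma> \<Longrightarrow> kc a = 0 \<longleftrightarrow> a \<in> \<Gamma>''"
  using kc_\<Gamma>'' decomp[of a] pr_in[of a] \<Gamma>''_carrier by force

lemma kc_one: "kc \<one>\<^bsub>\<Gamma>\<^esub> = 0"
  using kc_\<Gamma>'' one_in_\<Gamma>'' by blast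

lemma kc_nat_pow: "a \<in> carrier \<Gamma> \<Longrightarrow> kc (a [^]\<^bsub>\<Gamma>\<^esub> (n::nat)) = int n * kc a"
  by (induction n) (auto simp: kc_one kc_mult algebra_simps)

lemma kc_inv: "a \<in> carrier \<Gamma> \<Longrightarrow> kc (inv\<^bsub>\<Gamma>\<^esub> a) = - kc a"
  using kc_mult[of a "inv\<^bsub>\<Gamma>\<^esub> a"] by (simp add: kc_one)

lemma kc_int_pow: "a \<in> carrier \<Gamma> \<Longrightarrow> kc (a [^]\<^bsub>\<Gamma>\<^esub> (k::int)) = k * kc a"
proof -
  assume a: "a \<in> carrier \<Gamma>"
  show ?thesis
  proof (cases "k < 0")
    case True
    then have "kc (a [^]\<^bsub>\<Gamma>\<^esub> k) = kc (inv\<^bsub>\<Gamma>\<^esub> (a [^]\<^bsub>\<Gamma>\<^esub> nat (- k)))" unfolding int_pow_def2 by simp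
    also have "\<dots> = - (int (nat (- k)) * kc a)" unfolding kc_inv[OF \<Gamma>.nat_pow_closed[OF a]] kc_nat_pow[OF a] ..
    finally show ?thesis using True by simp
  next
    case False
    then have "kc (a [^]\<^bsub>\<Gamma>\<^esub> k) = kc (a [^]\<^bsub>\<Gamma>\<^esub> nat k)" unfolding int_pow_def2 by simp
    also have "\<dots> = int (nat k) * kc a" by (rule kc_nat_pow[OF a])
    finally show ?thesis using False by simp
  qed
qed

lemma real_hom_kc: "real_hom \<Gamma> (\<lambda>a. of_int (kc a))"
  by (auto simp: real_hom_def kc_mult)

lemma AY_sub: "AY \<subseteq> A" and AY_carrier: "AY \<subseteq> carrier \<Gamma>" and AY_\<Gamma>'': "AY \<subseteq> \<Gamma>''"
  using A_carrier kc_0_iff by (auto simp: AY_def)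

lemma T_decomp: "t \<in> T \<Longrightarrow> a \<in> carrier \<Gamma> \<Longrightarrow> t a = t \<beta>0 [^]\<^bsub>G\<^esub> kc a \<otimes>\<^bsub>G\<^esub> t (pr a)"
  using T_mult[of t "\<beta>0 [^]\<^bsub>\<Gamma>\<^esub> kc a" "pr a"] T_int_pow[of t \<beta>0 "kc a"]
  by (simp add: decomp pow_\<beta>0_carrier pr_carrier \<beta>0_carrier)

lemma T_ext:
  assumes "t \<in> T" "u \<in> T" "t \<beta>0 = u \<beta>0" "\<And>\<gamma>. \<gamma> \<in> \<Gamma>'' \<Longrightarrow> t \<gamma> = u \<gamma>"
  shows "t = u"
proof
  fix a show "t a = u a"
  proof (cases "a \<in> carrier \<Gamma>")
    case True
    then show ?thesis using T_decomp[of t a] T_decomp[of u a] assms pr_in by simp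
  next
    case False
    then show ?thesis using assms(1,2) by (simp add: Hom_def extensional_def)
  qed
qed

section \<open>The poset of layers under reverse inclusion\<close>

lemma layersI: "C \<in> comps S \<Longrightarrow> S \<subseteq> A \<Longrightarrow> C \<in> layers \<Gamma> G \<tau> A"
  by (auto simp: layers_eq)

lemma layersE: "C \<in> layers \<Gamma> G \<tau> B \<Longrightarrow> (\<And>S. S \<subseteq> B \<Longrightarrow> C \<in> comps S \<Longrightarrow> thesis) \<Longrightarrow> thesis"
  by (auto simp: layers_eq)

lemma Q_layers: "Q \<subseteq> layers \<Gamma> G \<tau> A"
  using AY_sub by (auto simp: layers_eq)

lemma T_in_Q: "T \<in> Q"
  using T_comps by (auto simp: layers_eq)

lemma L_simps [simp]:
  "carrier L = layers \<Gamma> G \<tau> A" "C \<sqsubseteq>\<^bsub>L\<^esub> D \<longleftrightarrow> D \<subseteq> C"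
  "carrier (lower_interval L x) = {y \<in> layers \<Gamma> G \<tau> A. x \<subseteq> y}"
  "C \<sqsubseteq>\<^bsub>lower_interval L x\<^esub> D \<longleftrightarrow> D \<subseteq> C"
  by (auto simp: layer_poset_def lower_interval_def)

lemma layer_T: "C \<in> layers \<Gamma> G \<tau> A \<Longrightarrow> C \<subseteq> T"
  using comps_T by (auto elim!: layersE)

lemma bottom_L: "\<bottom>\<^bsub>L\<^esub> = T"
  unfolding bottom_def
  by (rule some_equality) (use T_in_Q Q_layers layer_T in \<open>auto simp: least_def\<close>)

lemma bottom_lower:
  assumes "x \<in> layers \<Gamma> G \<tau> A" shows "\<bottom>\<^bsub>lower_interval L x\<^esub> = T"
proof -
  have "x \<subseteq> T" "T \<in> layers \<Gamma> G \<tau> A" using assms T_in_Q Q_layers layer_T by auto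
  then show ?thesis unfolding bottom_def
    by (intro some_equality) (use layer_T in \<open>auto simp: least_def\<close>)
qed

lemma top_lower:
  assumes "x \<in> layers \<Gamma> G \<tau> A" shows "\<top>\<^bsub>lower_interval L x\<^esub> = x"
  unfolding top_def
  by (rule some_equality) (use assms in \<open>auto simp: greatest_def\<close>)

text \<open>Among the layers inside C, take one on which as many elements of A as possible are
  trivial. A layer w inside it lies on the same hypersurfaces, so x is a connected subset of the
  flat of which w is a component, whence w = x.\<close>

lemma ex_maximal_layer:
  assumes C: "C \<in> layers \<Gamma> G \<tau> A"
  shows "\<exists>x\<in>maximal_elements L (layers \<Gamma> G \<tau> A). x \<subseteq> C"
proof -
  define N where "N x = card {a \<in> A. \<forall>t\<in>x. t a = \<one>\<^bsub>G\<^esub>}" for x :: "('a \<Rightarrow> 'b) set"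
  have "\<exists>x. (x \<in> layers \<Gamma> G \<tau> A \<and> x \<subseteq> C) \<and> (\<forall>y. y \<in> layers \<Gamma> G \<tau> A \<and> y \<subseteq> C \<longrightarrow> N y \<le> N x)"
    by (rule ex_has_greatest_nat[of _ C _ "Suc (card A)"])
      (use C finite_A in \<open>auto simp: N_def less_Suc_eq_le intro!: card_mono\<close>)
  then obtain x where x: "x \<in> layers \<Gamma> G \<tau> A" "x \<subseteq> C"
    and mx: "\<And>y. y \<in> layers \<Gamma> G \<tau> A \<Longrightarrow> y \<subseteq> C \<Longrightarrow> N y \<le> N x" by blast
  have "w = x" if w: "w \<in> layers \<Gamma> G \<tau> A" "w \<subseteq> x" for w
  proof -
    have "{a \<in> A. \<forall>t\<in>x. t a = \<one>\<^bsub>G\<^esub>} = {a \<in> A. \<forall>t\<in>w. t a = \<one>\<^bsub>G\<^esub>}"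
      using w x mx[of w] finite_A by (intro card_seteq) (auto simp: N_def)
    moreover obtain S where S: "S \<subseteq> A" "w \<in> comps S" using w(1) by (auto elim: layersE)
    ultimately have "\<forall>a\<in>S. \<forall>t\<in>x. t a = \<one>\<^bsub>G\<^esub>" using comps_one by blast
    then have "x \<subseteq> flat S" using layer_T[OF x(1)] by (auto simp: flat_def)
    moreover have "connectedin TT x" using x(1) comps_connected by (auto elim: layersE)
    moreover obtain t where "t \<in> w" using comps_nonempty[OF S(2)] by blast
    ultimately show ?thesis using comps_max[OF S(2)] w(2) by blast
  qed
  with x show ?thesis by (intro bexI[of _ x]) (auto simp: maximal_elements_def)
qed

text \<open>This is why a component of a hypersurface can be an atom. A layer other than T that
  contains it lies on a hypersurface of some \<beta>. If \<beta> is not rationally a multiple of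
  \<alpha>, motion along a changes the value at \<beta>; if it is, \<alpha> is trivial on the whole
  layer.\<close>

lemma hypersurface_layer_cover:
  assumes nontriv: "carrier G \<noteq> {\<one>\<^bsub>G\<^esub>}" and \<alpha>: "\<alpha> \<in> A" and a: "a \<in> comps {\<alpha>}"
    and w: "w \<in> layers \<Gamma> G \<tau> A" "a \<subseteq> w"
  shows "w = T \<or> w = a"
proof (cases "w = T")
  case False
  obtain S where S: "S \<subseteq> A" "w \<in> comps S" using w(1) by (auto elim: layersE)
  have "flat S \<noteq> T" using comps_T_eq[of S] S False by auto
  then obtain \<beta> u where \<beta>: "\<beta> \<in> S" and u: "u \<in> T" "u \<beta> \<noteq> \<one>\<^bsub>G\<^esub>" by (auto simp: flat_def)
  have \<beta>c: "\<beta> \<in> carrier \<Gamma>" and \<alpha>c: "\<alpha> \<in> carrier \<Gamma>" using \<beta> S \<alpha> A_carrier by auto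
  obtain t where t: "t \<in> a" using comps_nonempty[OF a] by blast
  consider \<xi> where "real_hom \<Gamma> \<xi>" "\<xi> \<alpha> = 0" "\<xi> \<beta> = 1"
    | m where "0 < m" "\<beta> [^]\<^bsub>\<Gamma>\<^esub> (m::nat) \<in> generate \<Gamma> {\<alpha>}"
    using \<Gamma>.real_hom_separates[of "{\<alpha>}" \<beta>] \<alpha>c \<beta>c by blast
  then show ?thesis
  proof cases
    case 1
    obtain g where g: "g \<in> carrier G" "g \<noteq> \<one>\<^bsub>G\<^esub>" using nontriv G.one_closed by blast
    obtain e where e: "one_param G \<tau> e" "e 1 = g" using G.ex_one_param[OF g(1)] by blast
    have "line t e \<xi> 1 \<in> a" using line_comps[OF a t e(1) 1(1)] 1 \<alpha>c by auto
    then have "line t e \<xi> 1 \<beta> = \<one>\<^bsub>G\<^esub>" "t \<beta> = \<one>\<^bsub>G\<^esub>" using w(2) t comps_one[OF S(2) _ \<beta>] by auto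
    then show ?thesis using 1 e g \<beta>c by (simp add: line_def)
  next
    case 2
    then obtain n :: int where n: "\<beta> [^]\<^bsub>\<Gamma>\<^esub> m = \<alpha> [^]\<^bsub>\<Gamma>\<^esub> n" using \<Gamma>.generate_pow[OF \<alpha>c] by auto
    \<comment> \<open>For n = 0 the value at \<beta> would be m-torsion on the connected space T,
      hence trivial throughout, against the choice of u.\<close>
    have "n \<noteq> 0"
    proof
      assume "n = 0"
      then have "v \<beta> [^]\<^bsub>G\<^esub> m = \<one>\<^bsub>G\<^esub>" if "v \<in> T" for v
        using T_nat_pow[OF that \<beta>c, of m] n T_one[OF that] by simp
      then have "(\<lambda>v. v \<beta>) ` T \<subseteq> {g \<in> carrier G. g [^]\<^bsub>G\<^esub> m = \<one>\<^bsub>G\<^esub>}" using T_closed \<beta>c by auto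
      then have "u \<beta> = (\<lambda>a\<in>carrier \<Gamma>. \<one>\<^bsub>G\<^esub>) \<beta>"
        by (intro G.constant_of_finite_range[OF _ G.continuous_map_eval[OF \<beta>c] G.finite_torsion_nat[OF 2(1)]])
          (use comps_connected[OF T_comps] u T_one_map in blast)+
      with u \<beta>c show False by simp
    qed
    \<comment> \<open>Since \<beta> is trivial on w, \<alpha> is n-torsion there, hence constant,
      and its value is known at the point t of a.\<close>
    have "v \<alpha> [^]\<^bsub>G\<^esub> n = \<one>\<^bsub>G\<^esub>" if "v \<in> w" for v
    proof -
      have vT: "v \<in> T" using comps_T[OF S(2) that] .
      have "v \<alpha> [^]\<^bsub>G\<^esub> n = v (\<beta> [^]\<^bsub>\<Gamma>\<^esub> m)" using n T_int_pow[OF vT \<alpha>c] by simp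
      also have "\<dots> = \<one>\<^bsub>G\<^esub>" using T_nat_pow[OF vT \<beta>c] comps_one[OF S(2) that \<beta>] by simp
      finally show ?thesis .
    qed
    then have "(\<lambda>v. v \<alpha>) ` w \<subseteq> {g \<in> carrier G. g [^]\<^bsub>G\<^esub> n = \<one>\<^bsub>G\<^esub>}"
      using T_closed \<alpha>c comps_T[OF S(2)] by auto
    then have "v \<alpha> = t \<alpha>" if "v \<in> w" for v
      by (intro G.constant_of_finite_range[OF comps_connected[OF S(2)] G.continuous_map_eval[OF \<alpha>c]
            G.finite_torsion[OF \<open>n \<noteq> 0\<close>]]) (use that t w in auto)
    then have "w \<subseteq> flat {\<alpha>}" using comps_one[OF a t] comps_T[OF S(2)] by (auto simp: flat_def)
    then show ?thesis using comps_max[OF a comps_connected[OF S(2)] _ t] t w(2) by blast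
  qed
qed simp

text \<open>Layers of the subarrangement are stable under motion along the fibres, in direction
  \<open>kc\<close>; a component of a hypersurface with a nonzero coefficient of \<beta>0 is
  not.\<close>

lemma hypersurface_layer_not_in_Q:
  assumes nontriv: "carrier G \<noteq> {\<one>\<^bsub>G\<^esub>}" and \<alpha>: "\<alpha> \<in> A" "kc \<alpha> \<noteq> 0" and a: "a \<in> comps {\<alpha>}"
  shows "a \<notin> Q"
proof
  assume "a \<in> Q"
  then obtain S where S: "S \<subseteq> AY" "a \<in> comps S" by (auto elim: layersE)
  obtain t where t: "t \<in> a" using comps_nonempty[OF a] by blast
  obtain g where g: "g \<in> carrier G" "g \<noteq> \<one>\<^bsub>G\<^esub>" using nontriv G.one_closed by blast
  obtain e where e: "one_param G \<tau> e" "e 1 = g" using G.ex_one_param[OF g(1)] by blast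
  \<comment> \<open>The parameter is the inverse of the speed at \<alpha>, so that the value at
    \<alpha> is multiplied by exactly \<open>e 1\<close>, that is g.\<close>
  have "line t e (\<lambda>a. of_int (kc a)) (1 / of_int (kc \<alpha>)) \<in> a"
    using S AY_carrier by (intro line_comps[OF S(2) t e(1) real_hom_kc]) (auto simp: AY_def)
  then have "line t e (\<lambda>a. of_int (kc a)) (1 / of_int (kc \<alpha>)) \<alpha> = \<one>\<^bsub>G\<^esub>" "t \<alpha> = \<one>\<^bsub>G\<^esub>"
    using comps_one[OF a _ singletonI] t by blast+
  then show False using e g \<alpha> A_carrier by (auto simp: line_def)
qed

lemma torsion_constant:
  assumes "0 < m" "\<gamma> [^]\<^bsub>\<Gamma>\<^esub> (m::nat) \<in> generate \<Gamma> S" "\<gamma> \<in> carrier \<Gamma>" "S \<subseteq> carrier \<Gamma>"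
    and y: "y \<in> comps S" "t \<in> y" "u \<in> y"
  shows "t \<gamma> = u \<gamma>"
proof -
  have "v \<gamma> [^]\<^bsub>G\<^esub> m = \<one>\<^bsub>G\<^esub>" if "v \<in> y" for v
    using T_generate[OF comps_T[OF y(1) that] assms(4) comps_one[OF y(1) that] assms(2)]
      T_nat_pow[OF comps_T[OF y(1) that] assms(3)] by simp
  then have "(\<lambda>v. v \<gamma>) ` y \<subseteq> {g \<in> carrier G. g [^]\<^bsub>G\<^esub> m = \<one>\<^bsub>G\<^esub>}"
    using T_closed assms(3) comps_T[OF y(1)] by auto
  then show ?thesis
    by (intro G.constant_of_finite_range[OF comps_connected[OF y(1)] G.continuous_map_eval[OF assms(3)]
          G.finite_torsion_nat[OF assms(1)]]) (use y in auto)
qed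

text \<open>A maximal layer of the subarrangement lies in a single fibre of the projection.
  Otherwise it can be moved so that the value at some \<beta> in \<open>AY\<close> changes, and
  cutting with the hypersurface of \<beta> gives a strictly smaller layer. That such a \<beta>
  exists is the use of \<open>ess\<close>, the essentiality of the quotient arrangement.\<close>

lemma maximal_Q_constant:
  assumes nontriv: "carrier G \<noteq> {\<one>\<^bsub>G\<^esub>}"
    and ess: "\<And>\<gamma>. \<gamma> \<in> \<Gamma>'' \<Longrightarrow> \<exists>m::nat. 0 < m \<and> \<gamma> [^]\<^bsub>\<Gamma>\<^esub> m \<in> generate \<Gamma> AY"
    and y: "y \<in> maximal_elements L Q" and tu: "t \<in> y" "u \<in> y" and \<gamma>: "\<gamma> \<in> \<Gamma>''"
  shows "t \<gamma> = u \<gamma>"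
proof -
  obtain S where S: "S \<subseteq> AY" "y \<in> comps S" using y by (auto simp: maximal_elements_def elim: layersE)
  have Sc: "S \<subseteq> carrier \<Gamma>" and \<gamma>c: "\<gamma> \<in> carrier \<Gamma>" using S AY_carrier \<gamma> \<Gamma>''_carrier by auto
  consider \<xi> where "real_hom \<Gamma> \<xi>" "\<forall>s\<in>S. \<xi> s = 0" "\<xi> \<gamma> = 1"
    | m where "0 < m" "\<gamma> [^]\<^bsub>\<Gamma>\<^esub> (m::nat) \<in> generate \<Gamma> S"
    using \<Gamma>.real_hom_separates[OF Sc \<gamma>c] by blast
  then show ?thesis
  proof cases
    case 1
    obtain m :: nat where m: "0 < m" "\<gamma> [^]\<^bsub>\<Gamma>\<^esub> m \<in> generate \<Gamma> AY" using ess[OF \<gamma>] by blast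
    have "\<exists>\<beta>\<in>AY. \<xi> \<beta> \<noteq> 0"
      using real_hom_generate[OF 1(1) AY_carrier _ m(2)] real_hom_nat_pow[OF 1(1) \<gamma>c, of m] m(1) 1(3) by auto
    then obtain \<beta> where \<beta>: "\<beta> \<in> AY" "\<xi> \<beta> \<noteq> 0" by blast
    have \<beta>c: "\<beta> \<in> carrier \<Gamma>" using \<beta> AY_carrier by blast
    \<comment> \<open>Rescaled to speed 1 at \<beta>, so that parameter 1 multiplies the value at
      \<beta> by any prescribed \<open>e 1\<close>.\<close>
    define \<eta> where "\<eta> a = \<xi> a / \<xi> \<beta>" for a
    have \<eta>: "real_hom \<Gamma> \<eta>" "\<And>s. s \<in> S \<Longrightarrow> \<eta> s = 0" "\<eta> \<beta> = 1"
      using 1 \<beta> by (auto simp: \<eta>_def real_hom_def add_divide_distrib)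
    have inc: "line t e \<eta> 1 \<in> y" if "one_param G \<tau> e" for e
      using line_comps[OF S(2) tu(1) that \<eta>(1) Sc \<eta>(2)] .
    have tT: "t \<in> T" and t\<beta>: "t \<beta> \<in> carrier G" using comps_T[OF S(2) tu(1)] T_closed \<beta>c by auto
    \<comment> \<open>This motion cancels the value at \<beta> and leads to a point of y on the
      hypersurface of \<beta>.\<close>
    obtain e where e: "one_param G \<tau> e" "e 1 = inv\<^bsub>G\<^esub> (t \<beta>)" using G.ex_one_param[OF G.inv_closed[OF t\<beta>]] by blast
    define t1 where "t1 = line t e \<eta> 1"
    have t1: "t1 \<in> y" "t1 \<beta> = \<one>\<^bsub>G\<^esub>" using inc[OF e(1)] e(2) t\<beta> \<beta>c \<eta>(3) by (auto simp: t1_def line_def)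
    then have "t1 \<in> flat (insert \<beta> S)" using comps_sub[OF S(2)] by (auto simp: flat_def)
    then obtain C where C: "C \<in> comps (insert \<beta> S)" "t1 \<in> C" using comps_ex by blast
    have "C \<subseteq> y"
      using comps_max[OF S(2) comps_connected[OF C(1)] _ t1(1) C(2)] comps_sub[OF C(1)] by (auto simp: flat_def)
    moreover have "C \<in> Q" using C(1) S(1) \<beta>(1) by (auto simp: layers_eq)
    ultimately have "C = y" using y by (auto simp: maximal_elements_def)
    then have \<beta>1: "v \<beta> = \<one>\<^bsub>G\<^esub>" if "v \<in> y" for v using comps_one[OF C(1)] that by blast
    obtain g where g: "g \<in> carrier G" "g \<noteq> \<one>\<^bsub>G\<^esub>" using nontriv G.one_closed by blast
    obtain e' where e': "one_param G \<tau> e'" "e' 1 = g" using G.ex_one_param[OF g(1)] by blast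
    \<comment> \<open>By now \<beta> is trivial on all of y, but the motion by e' stays in y and
      multiplies the value at \<beta> by the nontrivial g.\<close>
    have "line t e' \<eta> 1 \<beta> = \<one>\<^bsub>G\<^esub>" "t \<beta> = \<one>\<^bsub>G\<^esub>" using \<beta>1 inc[OF e'(1)] tu(1) by blast+
    then show ?thesis using e' g \<beta>c \<eta>(3) by (simp add: line_def)
  next
    case 2
    then show ?thesis using torsion_constant[OF 2 \<gamma>c Sc S(2) tu] by blast
  qed
qed

text \<open>Here t is a point of a over M(A/Y) that also lies on the second hypersurface. The
  hypothesis \<open>graph\<close>, that a meets each fibre at most once, is all that is needed of
  the section whose graph a will be.\<close>

lemma graph_layers_meet:
  assumes nontriv: "carrier G \<noteq> {\<one>\<^bsub>G\<^esub>}"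
    and ess: "\<And>\<gamma>. \<gamma> \<in> \<Gamma>'' \<Longrightarrow> \<exists>m::nat. 0 < m \<and> \<gamma> [^]\<^bsub>\<Gamma>\<^esub> m \<in> generate \<Gamma> AY"
    and TM: "TM_ideal L Q"
    and \<alpha>: "\<alpha> \<in> A" "kc \<alpha> \<noteq> 0" and \<alpha>': "\<alpha>' \<in> A"
    and a: "a \<in> comps {\<alpha>}" and t: "t \<in> a" "t \<alpha>' = \<one>\<^bsub>G\<^esub>" "\<And>\<beta>. \<beta> \<in> AY \<Longrightarrow> t \<beta> \<noteq> \<one>\<^bsub>G\<^esub>"
    and graph: "\<And>u v. u \<in> a \<Longrightarrow> v \<in> a \<Longrightarrow> (\<And>\<gamma>. \<gamma> \<in> \<Gamma>'' \<Longrightarrow> u \<gamma> = v \<gamma>) \<Longrightarrow> u = v"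
  shows "a \<in> comps {\<alpha>, \<alpha>'}"
proof -
  have aA: "a \<in> layers \<Gamma> G \<tau> A" using a \<alpha> by (intro layersI) auto
  have "t \<in> flat {\<alpha>, \<alpha>'}" using comps_sub[OF a] t by (auto simp: flat_def)
  then obtain C where C: "C \<in> comps {\<alpha>, \<alpha>'}" "t \<in> C" using comps_ex by blast
  have CA: "C \<in> layers \<Gamma> G \<tau> A" using C \<alpha> \<alpha>' by (intro layersI) auto
  have Ca: "C \<subseteq> a"
    using comps_max[OF a comps_connected[OF C(1)] _ t(1) C(2)] comps_sub[OF C(1)] by (auto simp: flat_def)
  obtain x where x: "x \<in> maximal_elements L (layers \<Gamma> G \<tau> A)" "x \<subseteq> C"
    using ex_maximal_layer[OF CA] by blast
  have xA: "x \<in> layers \<Gamma> G \<tau> A" using x by (simp add: maximal_elements_def)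
  obtain y where y: "y \<in> maximal_elements L Q" "modular_element (lower_interval L x) y"
    using TM x(1) by (auto simp: TM_ideal_def)
  have yQ: "y \<in> Q" using y by (simp add: maximal_elements_def)
  have yA: "y \<in> layers \<Gamma> G \<tau> A" "x \<subseteq> y" using y(2) by (auto simp: modular_element_def)
  let ?P = "lower_interval L x"
  have xne: "x \<noteq> {}" using xA comps_nonempty by (auto elim: layersE)
  \<comment> \<open>Join: y lies in one fibre and a meets this fibre at most once, so a layer inside
    both y and w that contains x is a point, hence equal to x.\<close>
  have lub: "is_lub ?P \<top>\<^bsub>?P\<^esub> {y, w}" if w: "w \<in> layers \<Gamma> G \<tau> A" "x \<subseteq> w" "w \<subseteq> a" for w
  proof -
    have uq: "u = x" if u: "x \<subseteq> u" "u \<subseteq> y" "u \<subseteq> w" for u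
    proof -
      have "p = q" if "p \<in> u" "q \<in> u" for p q
        using graph[of p q] maximal_Q_constant[OF nontriv ess y(1), of p q] that u w by blast
      then show ?thesis using xne u(1) by blast
    qed
    have "u \<subseteq> x" if "u \<in> Upper ?P {y, w}" for u
    proof -
      have "x \<subseteq> u" "u \<subseteq> y" "u \<subseteq> w" using that yA w by (simp_all add: Upper_def)
      then show ?thesis using uq by blast
    qed
    moreover have "x \<in> Upper ?P {y, w}" using xA yA w by (simp add: Upper_def)
    moreover have "Upper ?P {y, w} \<subseteq> carrier ?P" unfolding Upper_def by blast
    ultimately show ?thesis unfolding top_lower[OF xA] least_def by simp
  qed
  have order_ideal: "v \<in> Q" if "v \<in> layers \<Gamma> G \<tau> A" "y \<subseteq> v" for v
    using TM that yQ by (auto simp: TM_ideal_def order_ideal_def)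
  \<comment> \<open>Meet: every layer containing y is in the ideal, so it suffices that T is the
    only element of Q containing w.\<close>
  have glb: "is_glb ?P \<bottom>\<^bsub>?P\<^esub> {y, w}" if w: "w \<in> layers \<Gamma> G \<tau> A" "x \<subseteq> w"
    and *: "\<And>v. v \<in> Q \<Longrightarrow> w \<subseteq> v \<Longrightarrow> v = T" for w
  proof -
    have "T \<subseteq> u" if "u \<in> Lower ?P {y, w}" for u
    proof -
      have "u \<in> layers \<Gamma> G \<tau> A" "y \<subseteq> u" "w \<subseteq> u" using that yA w by (simp_all add: Lower_def)
      then show ?thesis using order_ideal * by blast
    qed
    moreover have "T \<in> Lower ?P {y, w}"
      using xA yA w T_in_Q Q_layers layer_T[OF yA(1)] layer_T[OF w(1)] layer_T[OF xA]
      by (simp add: Lower_def subsetD)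
    moreover have "Lower ?P {y, w} \<subseteq> carrier ?P" unfolding Lower_def by blast
    ultimately show ?thesis unfolding bottom_lower[OF xA] greatest_def by simp
  qed
  have "a \<in> lattice_complements ?P y"
  proof -
    have *: "v = T" if "v \<in> Q" "a \<subseteq> v" for v
      using hypersurface_layer_cover[OF nontriv \<alpha>(1) a] hypersurface_layer_not_in_Q[OF nontriv \<alpha> a]
        that Q_layers by blast
    have "x \<subseteq> a" using x(2) Ca by blast
    then show ?thesis unfolding lattice_complements_def
      using lub[OF aA _ order_refl] glb[OF aA _ *] aA by simp
  qed
  moreover have "C \<in> lattice_complements ?P y"
  proof -
    \<comment> \<open>A layer of the subarrangement through t is T, because t is on none of its
      hypersurfaces.\<close>
    have *: "v = T" if v: "v \<in> Q" "C \<subseteq> v" for v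
    proof -
      obtain S where S: "S \<subseteq> AY" "v \<in> comps S" using v(1) by (auto elim: layersE)
      have "S = {}" using comps_one[OF S(2), of t] t(3) S(1) C(2) v(2) by blast
      then show ?thesis using S(2) comps_T_eq[of "{}"] by (auto simp: flat_def)
    qed
    show ?thesis unfolding lattice_complements_def
      using lub[OF CA x(2) Ca] glb[OF CA x(2) *] CA x(2) by simp
  qed
  \<comment> \<open>Complements of a modular element form an antichain, and C and a are
    comparable.\<close>
  ultimately have "a = C" using y(2) Ca by (auto simp: modular_element_def)
  with C show ?thesis by simp
qed

text \<open>By \<open>graph_layers_meet\<close> in both directions, a and a' are components of the
  same flat and share the point t.\<close>

lemma graph_layers_meet_eq:
  assumes nontriv: "carrier G \<noteq> {\<one>\<^bsub>G\<^esub>}"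
    and ess: "\<And>\<gamma>. \<gamma> \<in> \<Gamma>'' \<Longrightarrow> \<exists>m::nat. 0 < m \<and> \<gamma> [^]\<^bsub>\<Gamma>\<^esub> m \<in> generate \<Gamma> AY"
    and TM: "TM_ideal L Q"
    and \<alpha>: "\<alpha> \<in> A" "kc \<alpha> \<noteq> 0" and \<alpha>': "\<alpha>' \<in> A" "kc \<alpha>' \<noteq> 0"
    and a: "a \<in> comps {\<alpha>}" "a' \<in> comps {\<alpha>'}" and t: "t \<in> a" "t \<in> a'" "\<And>\<beta>. \<beta> \<in> AY \<Longrightarrow> t \<beta> \<noteq> \<one>\<^bsub>G\<^esub>"
    and graph: "\<And>u v. u \<in> a \<Longrightarrow> v \<in> a \<Longrightarrow> (\<And>\<gamma>. \<gamma> \<in> \<Gamma>'' \<Longrightarrow> u \<gamma> = v \<gamma>) \<Longrightarrow> u = v"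
      "\<And>u v. u \<in> a' \<Longrightarrow> v \<in> a' \<Longrightarrow> (\<And>\<gamma>. \<gamma> \<in> \<Gamma>'' \<Longrightarrow> u \<gamma> = v \<gamma>) \<Longrightarrow> u = v"
  shows "a = a'"
proof -
  have "t \<alpha> = \<one>\<^bsub>G\<^esub>" "t \<alpha>' = \<one>\<^bsub>G\<^esub>" using comps_one[OF a(1) t(1)] comps_one[OF a(2) t(2)] by auto
  then have "a \<in> comps {\<alpha>, \<alpha>'}" "a' \<in> comps {\<alpha>', \<alpha>}"
    using graph_layers_meet[OF nontriv ess TM \<alpha> \<alpha>'(1) a(1) t(1) _ t(3) graph(1)]
      graph_layers_meet[OF nontriv ess TM \<alpha>' \<alpha>(1) a(2) t(2) _ t(3) graph(2)] by blast+
  then show ?thesis using comps_unique t by (metis insert_commute)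
qed

end

subsection \<open>Sections\<close>

context split_arrangement
begin

text \<open>Let a and y be the components through the trivial homomorphism; y lies in the fibre over
  the trivial homomorphism of the base. The points of their intersection are minimal upper bounds of
  a and y, so (TM1) leaves only one. A coordinate of \<open>pr \<alpha>\<close> not divisible by
  \<open>kc \<alpha>\<close> would produce a second one by motion along a circle.\<close>

lemma TM1_divisible:
  assumes ess: "\<And>\<gamma>. \<gamma> \<in> \<Gamma>'' \<Longrightarrow> \<exists>m::nat. 0 < m \<and> \<gamma> [^]\<^bsub>\<Gamma>\<^esub> m \<in> generate \<Gamma> AY"
    and TM: "TM_ideal L Q"
    and e: "one_param G \<tau> e" "\<And>x. e x = \<one>\<^bsub>G\<^esub> \<longleftrightarrow> x \<in> \<int>"
    and \<alpha>: "\<alpha> \<in> A" "kc \<alpha> \<noteq> 0"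
  shows "\<exists>\<delta>\<in>\<Gamma>''. \<delta> [^]\<^bsub>\<Gamma>\<^esub> kc \<alpha> = pr \<alpha>"
proof -
  have "(1/2 :: real) \<notin> \<int>"
  proof
    assume "(1/2 :: real) \<in> \<int>"
    then obtain j where "(1/2 :: real) = of_int j" by (rule Ints_cases)
    then have "real_of_int (2 * j) = of_int 1" by simp
    then have "2 * j = 1" by (simp only: of_int_eq_iff)
    then show False by presburger
  qed
  then have "e (1/2) \<noteq> \<one>\<^bsub>G\<^esub>" using e(2) by blast
  then have nontriv: "carrier G \<noteq> {\<one>\<^bsub>G\<^esub>}" using G.one_param_closed[OF e(1), of "1/2"] by auto
  have \<alpha>c: "\<alpha> \<in> carrier \<Gamma>" using \<alpha> A_carrier by blast
  define triv where "triv = (\<lambda>a\<in>carrier \<Gamma>. \<one>\<^bsub>G\<^esub>)"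
  have trivT: "triv \<in> T" using T_one_map by (simp add: triv_def)
  have triv1: "triv a = \<one>\<^bsub>G\<^esub>" if "a \<in> carrier \<Gamma>" for a using that by (simp add: triv_def)
  have trivflat: "triv \<in> flat S" if "S \<subseteq> carrier \<Gamma>" for S using trivT triv1 that by (auto simp: flat_def)
  obtain a where a: "a \<in> comps {\<alpha>}" "triv \<in> a" using comps_ex[OF trivflat] \<alpha>c by blast
  obtain y where y: "y \<in> comps AY" "triv \<in> y" using comps_ex[OF trivflat[OF AY_carrier]] by blast
  have aA: "a \<in> layers \<Gamma> G \<tau> A" using a \<alpha> by (intro layersI) auto
  have yQ: "y \<in> Q" using y(1) by (auto simp: layers_eq)
  have yA: "y \<in> layers \<Gamma> G \<tau> A" using yQ Q_layers by blast
  have aQ: "a \<notin> Q" by (rule hypersurface_layer_not_in_Q[OF nontriv \<alpha> a(1)])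
  have "a \<in> atoms L"
    using hypersurface_layer_cover[OF nontriv \<alpha>(1) a(1)] aA aQ T_in_Q
    unfolding atoms_def bottom_L by auto
  then have card1: "card (minimal_upper_bounds L {a, y}) = 1"
    using TM yQ aQ unfolding TM_ideal_def by blast
  have y\<gamma>: "u \<gamma> = \<one>\<^bsub>G\<^esub>" if uy: "u \<in> y" "\<gamma> \<in> \<Gamma>''" for u \<gamma>
  proof -
    obtain m :: nat where m: "0 < m" "\<gamma> [^]\<^bsub>\<Gamma>\<^esub> m \<in> generate \<Gamma> AY" using ess[OF uy(2)] by blast
    then show ?thesis
      using torsion_constant[OF m \<Gamma>''_carrier[OF uy(2)] AY_carrier y(1) uy(1) y(2)] triv1 \<Gamma>''_carrier[OF uy(2)] by simp
  qed
  \<comment> \<open>On y the equation of \<alpha> says that the fibre coordinate is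
    \<open>kc \<alpha>\<close>-torsion. As y lies in one fibre, connected subsets of the
    intersection are points.\<close>
  have single: "u = v" if D: "connectedin TT D" "D \<subseteq> a" "D \<subseteq> y" "u \<in> D" "v \<in> D" for D u v
  proof -
    have "(\<lambda>t. t \<beta>0) ` D \<subseteq> {g \<in> carrier G. g [^]\<^bsub>G\<^esub> kc \<alpha> = \<one>\<^bsub>G\<^esub>}"
    proof clarify
      fix t assume "t \<in> D"
      then have t: "t \<in> a" "t \<in> y" "t \<in> T" using D comps_T[OF a(1)] by auto
      have "t \<alpha> = \<one>\<^bsub>G\<^esub>" using comps_one[OF a(1) t(1)] by simp
      then show "t \<beta>0 \<in> carrier G \<and> t \<beta>0 [^]\<^bsub>G\<^esub> kc \<alpha> = \<one>\<^bsub>G\<^esub>"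
        using T_decomp[OF t(3) \<alpha>c] y\<gamma>[OF t(2) pr_in[OF \<alpha>c]] T_closed[OF t(3) \<beta>0_carrier] by simp
    qed
    then have "u \<beta>0 = v \<beta>0"
      by (rule G.constant_of_finite_range[OF D(1) G.continuous_map_eval[OF \<beta>0_carrier]
            G.finite_torsion[OF \<alpha>(2)] _ D(4,5)])
    moreover have "u \<in> T" "v \<in> T" using D comps_T[OF a(1)] by auto
    ultimately show ?thesis using T_ext y\<gamma> D by (metis subsetD)
  qed
  \<comment> \<open>Hence the component of the intersection flat at z is the point z itself, and
    nothing larger lies below both a and y in the sense of inclusion.\<close>
  have mub: "{z} \<in> minimal_upper_bounds L {a, y}" if z: "z \<in> a" "z \<in> y" for z
  proof -
    have "z \<in> flat (insert \<alpha> AY)" using comps_sub[OF a(1)] comps_sub[OF y(1)] z by (auto simp: flat_def)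
    then obtain C where C: "C \<in> comps (insert \<alpha> AY)" "z \<in> C" using comps_ex by blast
    have "C \<subseteq> a"
      using comps_max[OF a(1) comps_connected[OF C(1)] _ z(1) C(2)] comps_sub[OF C(1)] by (auto simp: flat_def)
    moreover have "C \<subseteq> y"
      using comps_max[OF y(1) comps_connected[OF C(1)] _ z(2) C(2)] comps_sub[OF C(1)] by (auto simp: flat_def)
    ultimately have "C = {z}" using single[OF comps_connected[OF C(1)]] C(2) by blast
    then have zA: "{z} \<in> layers \<Gamma> G \<tau> A" using C(1) \<alpha>(1) AY_sub by (auto intro: layersI)
    have "w = {z}" if w: "w \<in> Upper L {a, y}" "w \<sqsubseteq>\<^bsub>L\<^esub> {z}" for w
    proof -
      have "w \<subseteq> a" "w \<subseteq> y" "w \<in> layers \<Gamma> G \<tau> A" "z \<in> w" using w aA yA by (auto simp: Upper_def)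
      moreover have "connectedin TT w" using \<open>w \<in> layers \<Gamma> G \<tau> A\<close> comps_connected by (auto elim: layersE)
      ultimately show ?thesis using single by blast
    qed
    moreover have "{z} \<in> Upper L {a, y}" using zA z by (auto simp: Upper_def)
    ultimately show ?thesis unfolding minimal_upper_bounds_def by blast
  qed
  have uniq: "z = triv" if "z \<in> a" "z \<in> y" for z
    using mub[OF that] mub[OF a(2) y(2)] card1 by (metis card_1_singletonE singletonD singleton_inject)
  have "kc \<alpha> dvd X (pr \<alpha>) i" for i
  proof -
    \<comment> \<open>The i-th coordinate of \<open>pr\<close>, corrected by a multiple of
      \<open>kc\<close> so as to kill \<alpha>. On \<open>\<Gamma>''\<close> it is integral, so e
      sends it to the identity; at \<beta>0 it is minus the quotient of
      \<open>X (pr \<alpha>) i\<close> by \<open>kc \<alpha>\<close>, which has to be shown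
      integral.\<close>
    define \<xi> where "\<xi> b = real_of_int (X (pr b) i) - of_int (kc b) * of_int (X (pr \<alpha>) i) / of_int (kc \<alpha>)" for b
    have \<xi>: "real_hom \<Gamma> \<xi>"
      unfolding real_hom_def \<xi>_def by (auto simp: pr_mult kc_mult \<Gamma>.X_mult pr_carrier algebra_simps add_divide_distrib)
    define z where "z = line triv e \<xi> 1"
    have "\<xi> \<alpha> = 0" using \<alpha>(2) by (simp add: \<xi>_def)
    then have za: "z \<in> a" unfolding z_def using \<alpha>c by (intro line_comps[OF a e(1) \<xi>]) auto
    have zT: "z \<in> T" unfolding z_def by (rule line_T[OF trivT e(1) \<xi>])
    have z\<gamma>: "z \<gamma> = \<one>\<^bsub>G\<^esub>" if "\<gamma> \<in> \<Gamma>''" for \<gamma>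
      using that \<Gamma>''_carrier[OF that] e(2)[of "of_int (X \<gamma> i)"]
      by (simp add: z_def line_def triv1 \<xi>_def kc_\<Gamma>'' pr_\<Gamma>'')
    \<comment> \<open>Since z is trivial on \<open>\<Gamma>''\<close>, a motion purely along the
      fibre leads from the trivial homomorphism to z, and this motion stays in y.\<close>
    obtain f where f: "one_param G \<tau> f" "f 1 = z \<beta>0" using G.ex_one_param[OF T_closed[OF zT \<beta>0_carrier]] by blast
    have "line triv f (\<lambda>b. of_int (kc b)) 1 = z"
    proof (rule T_ext[OF line_T[OF trivT f(1) real_hom_kc] zT])
      show "line triv f (\<lambda>b. of_int (kc b)) 1 \<beta>0 = z \<beta>0"
        using \<beta>0_carrier f T_closed[OF zT \<beta>0_carrier] by (simp add: line_def triv1 kc_\<beta>0)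
      show "line triv f (\<lambda>b. of_int (kc b)) 1 \<gamma> = z \<gamma>" if "\<gamma> \<in> \<Gamma>''" for \<gamma>
        using \<Gamma>''_carrier[OF that] that by (simp add: line_def triv1 kc_\<Gamma>'' z\<gamma> G.one_param_0[OF f(1)])
    qed
    moreover have "line triv f (\<lambda>b. of_int (kc b)) 1 \<in> y"
      using AY_carrier by (intro line_comps[OF y f(1) real_hom_kc]) (auto simp: AY_def)
    ultimately have "z = triv" using uniq za by simp
    moreover have "z \<beta>0 = e (\<xi> \<beta>0)"
      unfolding z_def line_def using triv1[OF \<beta>0_carrier] \<beta>0_carrier G.one_param_closed[OF e(1)] by simp
    ultimately have "e (\<xi> \<beta>0) = \<one>\<^bsub>G\<^esub>" using triv1[OF \<beta>0_carrier] by simp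
    then have "\<xi> \<beta>0 \<in> \<int>" using e(2) by blast
    then obtain j where "\<xi> \<beta>0 = of_int j" by (auto elim: Ints_cases)
    then have "of_int (X (pr \<alpha>) i) = real_of_int (kc \<alpha> * - j)"
      using \<alpha>(2) by (simp add: \<xi>_def pr_\<beta>0 kc_\<beta>0 \<Gamma>.X_one field_simps)
    then have "X (pr \<alpha>) i = kc \<alpha> * - j" by (simp only: of_int_eq_iff)
    then show ?thesis by simp
  qed
  then obtain \<delta> where \<delta>: "\<delta> \<in> carrier \<Gamma>" "\<delta> [^]\<^bsub>\<Gamma>\<^esub> kc \<alpha> = pr \<alpha>"
    using \<Gamma>.int_pow_root[OF pr_carrier[OF \<alpha>c]] by blast
  then have "kc \<alpha> * kc \<delta> = 0"
    using kc_int_pow[OF \<delta>(1), of "kc \<alpha>"] kc_\<Gamma>''[OF pr_in[OF \<alpha>c]] by simp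
  then have "\<delta> \<in> \<Gamma>''" using \<alpha>(2) kc_0_iff[OF \<delta>(1)] by simp
  with \<delta> show ?thesis by blast
qed

text \<open>The two cases of \<open>root_or_circle\<close> get one form. Without circles \<rho> is a
  root and \<delta> is \<open>pr \<alpha>\<close>; with a circle \<rho> is inversion and \<delta> is
  the root of \<open>pr \<alpha>\<close> from \<open>TM1_divisible\<close>. Continuity in t then
  follows from that of \<rho>.\<close>

lemma ex_section:
  assumes ess: "\<And>\<gamma>. \<gamma> \<in> \<Gamma>'' \<Longrightarrow> \<exists>m::nat. 0 < m \<and> \<gamma> [^]\<^bsub>\<Gamma>\<^esub> m \<in> generate \<Gamma> AY"
    and TM: "TM_ideal L Q" and \<alpha>: "\<alpha> \<in> A" "kc \<alpha> \<noteq> 0"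
  shows "\<exists>\<rho> \<delta>. continuous_map \<tau> \<tau> \<rho> \<and> \<delta> \<in> \<Gamma>'' \<and>
           (\<forall>t\<in>T. \<rho> (t \<delta>) [^]\<^bsub>G\<^esub> kc \<alpha> \<otimes>\<^bsub>G\<^esub> t (pr \<alpha>) = \<one>\<^bsub>G\<^esub>)"
proof -
  have \<alpha>c: "\<alpha> \<in> carrier \<Gamma>" using \<alpha> A_carrier by blast
  from G.root_or_circle show ?thesis
  proof (elim disjE exE conjE)
    assume "\<forall>k::int. k \<noteq> 0 \<longrightarrow> (\<exists>\<rho>. continuous_map \<tau> \<tau> \<rho> \<and> (\<forall>g\<in>carrier G. \<rho> g [^]\<^bsub>G\<^esub> k \<otimes>\<^bsub>G\<^esub> g = \<one>\<^bsub>G\<^esub>))"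
    then obtain \<rho> where "continuous_map \<tau> \<tau> \<rho>" "\<forall>g\<in>carrier G. \<rho> g [^]\<^bsub>G\<^esub> kc \<alpha> \<otimes>\<^bsub>G\<^esub> g = \<one>\<^bsub>G\<^esub>"
      using \<alpha>(2) by blast
    then show ?thesis using pr_in[OF \<alpha>c] T_closed pr_carrier[OF \<alpha>c] by blast
  next
    fix e assume e: "one_param G \<tau> e" "\<forall>x. e x = \<one>\<^bsub>G\<^esub> \<longleftrightarrow> x \<in> \<int>"
    obtain \<delta> where \<delta>: "\<delta> \<in> \<Gamma>''" "\<delta> [^]\<^bsub>\<Gamma>\<^esub> kc \<alpha> = pr \<alpha>"
      using TM1_divisible[OF ess TM e(1) _ \<alpha>] e(2) by blast
    have "inv\<^bsub>G\<^esub> (t \<delta>) [^]\<^bsub>G\<^esub> kc \<alpha> \<otimes>\<^bsub>G\<^esub> t (pr \<alpha>) = \<one>\<^bsub>G\<^esub>" if t: "t \<in> T" for t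
    proof -
      have td: "t \<delta> \<in> carrier G" using T_closed[OF t] \<Gamma>''_carrier[OF \<delta>(1)] .
      have "t (pr \<alpha>) = t \<delta> [^]\<^bsub>G\<^esub> kc \<alpha>"
        using T_int_pow[OF t \<Gamma>''_carrier[OF \<delta>(1)], of "kc \<alpha>"] \<delta>(2) by simp
      then show ?thesis using td by (simp add: G.int_pow_inv)
    qed
    then show ?thesis using G.inv_cont \<delta>(1) by (intro exI[of _ "\<lambda>x. inv\<^bsub>G\<^esub> x"] exI[of _ \<delta>]) auto
  qed
qed

text \<open>The inverse of taking the value at \<beta>0 and the restriction to
  \<open>\<Gamma>''\<close>. Only the values of s on \<open>\<Gamma>''\<close> are read, so s may be
  an element of T whose fibre coordinate is to be replaced.\<close>

definition glue :: "'b \<Rightarrow> ('a \<Rightarrow> 'b) \<Rightarrow> 'a \<Rightarrow> 'b" where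
  "glue g s = (\<lambda>a\<in>carrier \<Gamma>. g [^]\<^bsub>G\<^esub> kc a \<otimes>\<^bsub>G\<^esub> s (pr a))"

lemma glue_T:
  assumes g: "g \<in> carrier G" and s: "\<And>\<gamma>. \<gamma> \<in> \<Gamma>'' \<Longrightarrow> s \<gamma> \<in> carrier G"
    "\<And>\<gamma> \<gamma>'. \<gamma> \<in> \<Gamma>'' \<Longrightarrow> \<gamma>' \<in> \<Gamma>'' \<Longrightarrow> s (\<gamma> \<otimes>\<^bsub>\<Gamma>\<^esub> \<gamma>') = s \<gamma> \<otimes>\<^bsub>G\<^esub> s \<gamma>'"
  shows "glue g s \<in> T"
proof -
  have "g [^]\<^bsub>G\<^esub> kc (a \<otimes>\<^bsub>\<Gamma>\<^esub> b) \<otimes>\<^bsub>G\<^esub> s (pr (a \<otimes>\<^bsub>\<Gamma>\<^esub> b)) =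
      g [^]\<^bsub>G\<^esub> kc a \<otimes>\<^bsub>G\<^esub> s (pr a) \<otimes>\<^bsub>G\<^esub> (g [^]\<^bsub>G\<^esub> kc b \<otimes>\<^bsub>G\<^esub> s (pr b))"
    if "a \<in> carrier \<Gamma>" "b \<in> carrier \<Gamma>" for a b
    using that g by (simp add: kc_mult pr_mult s pr_in G.int_pow_mult G.m_ac)
  then show ?thesis using g s pr_in by (auto simp: Hom_def hom_def glue_def)
qed

lemma glue_\<beta>0: "g \<in> carrier G \<Longrightarrow> s \<one>\<^bsub>\<Gamma>\<^esub> = \<one>\<^bsub>G\<^esub> \<Longrightarrow> glue g s \<beta>0 = g"
  by (simp add: glue_def \<beta>0_carrier kc_\<beta>0 pr_\<beta>0)

lemma glue_\<Gamma>'': "s \<gamma> \<in> carrier G \<Longrightarrow> \<gamma> \<in> \<Gamma>'' \<Longrightarrow> glue g s \<gamma> = s \<gamma>"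
  by (simp add: glue_def \<Gamma>''_carrier kc_\<Gamma>'' pr_\<Gamma>'')

text \<open>Two solutions over the same base point differ by a torsion element, so the hypersurface
  is the union of the graphs of the translates of one section by torsion.\<close>

lemma hypersurface_iff:
  assumes \<alpha>: "\<alpha> \<in> carrier \<Gamma>" and \<rho>: "continuous_map \<tau> \<tau> \<rho>" and \<delta>: "\<delta> \<in> \<Gamma>''"
    and sec: "\<And>t. t \<in> T \<Longrightarrow> \<rho> (t \<delta>) [^]\<^bsub>G\<^esub> kc \<alpha> \<otimes>\<^bsub>G\<^esub> t (pr \<alpha>) = \<one>\<^bsub>G\<^esub>"
    and t: "t \<in> T"
  shows "t \<alpha> = \<one>\<^bsub>G\<^esub> \<longleftrightarrow>
    (\<exists>\<zeta>\<in>carrier G. \<zeta> [^]\<^bsub>G\<^esub> kc \<alpha> = \<one>\<^bsub>G\<^esub> \<and> t \<beta>0 = \<zeta> \<otimes>\<^bsub>G\<^esub> \<rho> (t \<delta>))"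
proof -
  have \<rho>c: "\<rho> (t \<delta>) \<in> carrier G"
    using G.continuous_map_closed[OF \<rho>] T_closed[OF t \<Gamma>''_carrier[OF \<delta>]] by (simp add: G.topspace_eq)
  have c: "t \<beta>0 \<in> carrier G" "t (pr \<alpha>) \<in> carrier G"
    using T_closed[OF t] \<beta>0_carrier pr_carrier[OF \<alpha>] by auto
  show ?thesis
  proof
    assume "t \<alpha> = \<one>\<^bsub>G\<^esub>"
    then have eq: "t \<beta>0 [^]\<^bsub>G\<^esub> kc \<alpha> = \<rho> (t \<delta>) [^]\<^bsub>G\<^esub> kc \<alpha>"
      using T_decomp[OF t \<alpha>] sec[OF t] c \<rho>c by (metis G.int_pow_closed G.right_cancel)
    show "\<exists>\<zeta>\<in>carrier G. \<zeta> [^]\<^bsub>G\<^esub> kc \<alpha> = \<one>\<^bsub>G\<^esub> \<and> t \<beta>0 = \<zeta> \<otimes>\<^bsub>G\<^esub> \<rho> (t \<delta>)"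
      by (rule bexI[of _ "t \<beta>0 \<otimes>\<^bsub>G\<^esub> inv\<^bsub>G\<^esub> (\<rho> (t \<delta>))"])
        (use c \<rho>c eq in \<open>simp_all add: G.int_pow_distrib G.int_pow_inv G.m_assoc\<close>)
  next
    assume "\<exists>\<zeta>\<in>carrier G. \<zeta> [^]\<^bsub>G\<^esub> kc \<alpha> = \<one>\<^bsub>G\<^esub> \<and> t \<beta>0 = \<zeta> \<otimes>\<^bsub>G\<^esub> \<rho> (t \<delta>)"
    then obtain \<zeta> where \<zeta>: "\<zeta> \<in> carrier G" "\<zeta> [^]\<^bsub>G\<^esub> kc \<alpha> = \<one>\<^bsub>G\<^esub>" "t \<beta>0 = \<zeta> \<otimes>\<^bsub>G\<^esub> \<rho> (t \<delta>)" by blast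
    then have "t \<beta>0 [^]\<^bsub>G\<^esub> kc \<alpha> = \<rho> (t \<delta>) [^]\<^bsub>G\<^esub> kc \<alpha>"
      using \<rho>c by (simp add: G.int_pow_distrib)
    then show "t \<alpha> = \<one>\<^bsub>G\<^esub>" using T_decomp[OF t \<alpha>] sec[OF t] by simp
  qed
qed

text \<open>The graph is connected, being the image of T under replacing the fibre coordinate by the
  section. It is a full component because on the hypersurface the fibre coordinate divided by the
  section is torsion, hence constant on components.\<close>

lemma graph_comps:
  assumes \<alpha>: "\<alpha> \<in> carrier \<Gamma>" "kc \<alpha> \<noteq> 0" and \<rho>: "continuous_map \<tau> \<tau> \<rho>" and \<delta>: "\<delta> \<in> \<Gamma>''"
    and sec: "\<And>t. t \<in> T \<Longrightarrow> \<rho> (t \<delta>) [^]\<^bsub>G\<^esub> kc \<alpha> \<otimes>\<^bsub>G\<^esub> t (pr \<alpha>) = \<one>\<^bsub>G\<^esub>"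
    and \<zeta>: "\<zeta> \<in> carrier G" "\<zeta> [^]\<^bsub>G\<^esub> kc \<alpha> = \<one>\<^bsub>G\<^esub>"
  shows "{t \<in> T. t \<beta>0 = \<zeta> \<otimes>\<^bsub>G\<^esub> \<rho> (t \<delta>)} \<in> comps {\<alpha>}"
proof -
  let ?W = "{t \<in> T. t \<beta>0 = \<zeta> \<otimes>\<^bsub>G\<^esub> \<rho> (t \<delta>)}"
  let ?h = "\<lambda>t. \<zeta> \<otimes>\<^bsub>G\<^esub> \<rho> (t \<delta>)"
  have \<delta>c: "\<delta> \<in> carrier \<Gamma>" using \<delta> \<Gamma>''_carrier by blast
  have \<rho>T: "continuous_map TT \<tau> (\<lambda>t. \<rho> (t \<delta>))"
    using continuous_map_compose[OF G.continuous_map_eval[OF \<delta>c] \<rho>] by (simp add: o_def)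
  have \<rho>c: "\<rho> (t \<delta>) \<in> carrier G" if "t \<in> T" for t
    using G.continuous_map_closed[OF \<rho>T] that by (simp add: G.topspace_Hom_topology)
  have h: "continuous_map TT \<tau> ?h"
    using \<zeta>(1) by (intro G.continuous_map_mult \<rho>T) (simp add: G.topspace_eq)
  have gT: "glue (?h t) t \<in> T" if t: "t \<in> T" for t
    using t \<zeta> \<rho>c T_closed[OF t] T_mult[OF t] \<Gamma>''_carrier by (intro glue_T) auto
  have "continuous_map TT TT (\<lambda>t. glue (?h t) t)"
    unfolding G.continuous_map_Hom_topology
  proof (intro conjI ballI)
    fix a assume a: "a \<in> carrier \<Gamma>"
    have "continuous_map TT \<tau> (\<lambda>t. ?h t [^]\<^bsub>G\<^esub> kc a \<otimes>\<^bsub>G\<^esub> t (pr a))"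
      by (intro G.continuous_map_mult G.continuous_map_int_pow h G.continuous_map_eval pr_carrier a)
    then show "continuous_map TT \<tau> (\<lambda>t. glue (?h t) t a)" using a by (simp add: glue_def)
  qed (use gT in \<open>simp add: G.topspace_Hom_topology\<close>)
  then have "connectedin TT ((\<lambda>t. glue (?h t) t) ` T)"
    by (rule connectedin_continuous_map_image) (rule comps_connected[OF T_comps])
  moreover have "(\<lambda>t. glue (?h t) t) ` T = ?W"
  proof (intro subset_antisym subsetI)
    fix u assume "u \<in> (\<lambda>t. glue (?h t) t) ` T"
    then obtain t where t: "t \<in> T" "u = glue (?h t) t" by blast
    then show "u \<in> ?W"
      using gT \<zeta>(1) \<rho>c T_one T_closed[OF t(1) \<delta>c] by (simp add: glue_\<beta>0 glue_\<Gamma>'' \<delta>)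
  next
    fix u assume u: "u \<in> ?W"
    have "glue (?h u) u = u"
      using u \<zeta>(1) \<rho>c T_one T_closed \<Gamma>''_carrier
      by (intro T_ext) (auto simp: gT glue_\<beta>0 glue_\<Gamma>'')
    with u show "u \<in> (\<lambda>t. glue (?h t) t) ` T" by (metis (no_types, lifting) imageI mem_Collect_eq)
  qed
  ultimately have con: "connectedin TT ?W" by simp
  have W_flat: "?W \<subseteq> flat {\<alpha>}"
    using hypersurface_iff[OF \<alpha>(1) \<rho> \<delta> sec] \<zeta> by (auto simp: flat_def)
  obtain w where w: "w \<in> ?W" using gT[OF T_one_map] \<open>(\<lambda>t. glue (?h t) t) ` T = ?W\<close> T_one_map by blast
  then obtain C where C: "C \<in> comps {\<alpha>}" "w \<in> C" using comps_ex W_flat by blast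
  have "?W \<subseteq> C" using comps_max[OF C(1) con W_flat C(2) w] .
  moreover have "C \<subseteq> ?W"
  proof
    fix t assume t: "t \<in> C"
    let ?f = "\<lambda>t. t \<beta>0 \<otimes>\<^bsub>G\<^esub> inv\<^bsub>G\<^esub> (\<rho> (t \<delta>))"
    have f: "continuous_map TT \<tau> ?f"
      by (intro G.continuous_map_mult G.continuous_map_inv \<rho>T G.continuous_map_eval \<beta>0_carrier)
    have "?f ` C \<subseteq> {g \<in> carrier G. g [^]\<^bsub>G\<^esub> kc \<alpha> = \<one>\<^bsub>G\<^esub>}"
    proof clarify
      fix u assume u: "u \<in> C"
      then have uT: "u \<in> T" and u1: "u \<alpha> = \<one>\<^bsub>G\<^esub>" using comps_T[OF C(1)] comps_one[OF C(1)] by auto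
      then obtain \<eta> where "\<eta> \<in> carrier G" "\<eta> [^]\<^bsub>G\<^esub> kc \<alpha> = \<one>\<^bsub>G\<^esub>" "u \<beta>0 = \<eta> \<otimes>\<^bsub>G\<^esub> \<rho> (u \<delta>)"
        using hypersurface_iff[OF \<alpha>(1) \<rho> \<delta> sec uT] by blast
      then show "?f u \<in> carrier G \<and> ?f u [^]\<^bsub>G\<^esub> kc \<alpha> = \<one>\<^bsub>G\<^esub>"
        using \<rho>c[OF uT] by (simp add: G.m_assoc)
    qed
    then have "?f t = ?f w"
      by (rule G.constant_of_finite_range[OF comps_connected[OF C(1)] f G.finite_torsion[OF \<alpha>(2)] _ t C(2)])
    also have "\<dots> = \<zeta>" using w \<rho>c \<zeta>(1) by (simp add: G.m_assoc)
    finally have "t \<beta>0 = \<zeta> \<otimes>\<^bsub>G\<^esub> \<rho> (t \<delta>)"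
      using comps_T[OF C(1) t] \<rho>c T_closed[OF _ \<beta>0_carrier] \<zeta>(1) by (metis G.inv_closed G.inv_inv G.inv_solve_right)
    then show "t \<in> ?W" using comps_T[OF C(1) t] by simp
  qed
  ultimately show ?thesis using C(1) by simp
qed

text \<open>Here t and u stand for base points; \<open>glue\<close> replaces their fibre coordinate
  by the value of the section. The lift of t lies on both graphs, so these are equal as layers, and
  the lift of u to the first lies on the second.\<close>

lemma sections_agree:
  assumes nontriv: "carrier G \<noteq> {\<one>\<^bsub>G\<^esub>}"
    and ess: "\<And>\<gamma>. \<gamma> \<in> \<Gamma>'' \<Longrightarrow> \<exists>m::nat. 0 < m \<and> \<gamma> [^]\<^bsub>\<Gamma>\<^esub> m \<in> generate \<Gamma> AY"
    and TM: "TM_ideal L Q"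
    and \<alpha>: "\<alpha> \<in> A" "kc \<alpha> \<noteq> 0" and \<rho>: "continuous_map \<tau> \<tau> \<rho>" and \<delta>: "\<delta> \<in> \<Gamma>''"
    and sec: "\<And>t. t \<in> T \<Longrightarrow> \<rho> (t \<delta>) [^]\<^bsub>G\<^esub> kc \<alpha> \<otimes>\<^bsub>G\<^esub> t (pr \<alpha>) = \<one>\<^bsub>G\<^esub>"
    and \<zeta>: "\<zeta> \<in> carrier G" "\<zeta> [^]\<^bsub>G\<^esub> kc \<alpha> = \<one>\<^bsub>G\<^esub>"
    and \<alpha>': "\<alpha>' \<in> A" "kc \<alpha>' \<noteq> 0" and \<rho>': "continuous_map \<tau> \<tau> \<rho>'" and \<delta>': "\<delta>' \<in> \<Gamma>''"
    and sec': "\<And>t. t \<in> T \<Longrightarrow> \<rho>' (t \<delta>') [^]\<^bsub>G\<^esub> kc \<alpha>' \<otimes>\<^bsub>G\<^esub> t (pr \<alpha>') = \<one>\<^bsub>G\<^esub>"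
    and \<zeta>': "\<zeta>' \<in> carrier G" "\<zeta>' [^]\<^bsub>G\<^esub> kc \<alpha>' = \<one>\<^bsub>G\<^esub>"
    and t: "t \<in> T" "\<And>\<beta>. \<beta> \<in> AY \<Longrightarrow> t \<beta> \<noteq> \<one>\<^bsub>G\<^esub>" "\<zeta> \<otimes>\<^bsub>G\<^esub> \<rho> (t \<delta>) = \<zeta>' \<otimes>\<^bsub>G\<^esub> \<rho>' (t \<delta>')"
    and u: "u \<in> T"
  shows "\<zeta> \<otimes>\<^bsub>G\<^esub> \<rho> (u \<delta>) = \<zeta>' \<otimes>\<^bsub>G\<^esub> \<rho>' (u \<delta>')"
proof -
  let ?W = "{t \<in> T. t \<beta>0 = \<zeta> \<otimes>\<^bsub>G\<^esub> \<rho> (t \<delta>)}" and ?W' = "{t \<in> T. t \<beta>0 = \<zeta>' \<otimes>\<^bsub>G\<^esub> \<rho>' (t \<delta>')}"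
  have W: "?W \<in> comps {\<alpha>}" "?W' \<in> comps {\<alpha>'}"
    using \<alpha> \<alpha>' A_carrier by (auto intro!: graph_comps assms)
  have \<rho>c: "\<rho> (v \<delta>) \<in> carrier G" if "v \<in> T" for v
    using G.continuous_map_closed[OF \<rho>] T_closed[OF that \<Gamma>''_carrier[OF \<delta>]] by (simp add: G.topspace_eq)
  have gl: "glue (\<zeta> \<otimes>\<^bsub>G\<^esub> \<rho> (v \<delta>)) v \<in> ?W"
    "\<And>\<gamma>. \<gamma> \<in> \<Gamma>'' \<Longrightarrow> glue (\<zeta> \<otimes>\<^bsub>G\<^esub> \<rho> (v \<delta>)) v \<gamma> = v \<gamma>"
    "glue (\<zeta> \<otimes>\<^bsub>G\<^esub> \<rho> (v \<delta>)) v \<beta>0 = \<zeta> \<otimes>\<^bsub>G\<^esub> \<rho> (v \<delta>)" if v: "v \<in> T" for v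
  proof -
    have c: "\<zeta> \<otimes>\<^bsub>G\<^esub> \<rho> (v \<delta>) \<in> carrier G" using \<rho>c[OF v] \<zeta> by simp
    have "glue (\<zeta> \<otimes>\<^bsub>G\<^esub> \<rho> (v \<delta>)) v \<in> T"
      using c T_closed[OF v] T_mult[OF v] \<Gamma>''_carrier by (intro glue_T) auto
    moreover show **: "glue (\<zeta> \<otimes>\<^bsub>G\<^esub> \<rho> (v \<delta>)) v \<gamma> = v \<gamma>" if "\<gamma> \<in> \<Gamma>''" for \<gamma>
      using that T_closed[OF v \<Gamma>''_carrier[OF that]] by (simp add: glue_\<Gamma>'')
    moreover show "glue (\<zeta> \<otimes>\<^bsub>G\<^esub> \<rho> (v \<delta>)) v \<beta>0 = \<zeta> \<otimes>\<^bsub>G\<^esub> \<rho> (v \<delta>)"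
      using c T_one[OF v] by (simp add: glue_\<beta>0)
    ultimately show "glue (\<zeta> \<otimes>\<^bsub>G\<^esub> \<rho> (v \<delta>)) v \<in> ?W" using \<delta> by simp
  qed
  let ?t = "glue (\<zeta> \<otimes>\<^bsub>G\<^esub> \<rho> (t \<delta>)) t" and ?u = "glue (\<zeta> \<otimes>\<^bsub>G\<^esub> \<rho> (u \<delta>)) u"
  have "?t \<in> ?W'" using gl[OF t(1)] t(3) \<delta>' by simp
  moreover have "?t \<beta> \<noteq> \<one>\<^bsub>G\<^esub>" if "\<beta> \<in> AY" for \<beta>
    using t(2)[OF that] gl(2)[OF t(1)] that AY_\<Gamma>'' by auto
  moreover have "v = w" if "v \<in> ?W" "w \<in> ?W" "\<And>\<gamma>. \<gamma> \<in> \<Gamma>'' \<Longrightarrow> v \<gamma> = w \<gamma>" for v w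
    using that \<delta> by (intro T_ext) auto
  moreover have "v = w" if "v \<in> ?W'" "w \<in> ?W'" "\<And>\<gamma>. \<gamma> \<in> \<Gamma>'' \<Longrightarrow> v \<gamma> = w \<gamma>" for v w
    using that \<delta>' by (intro T_ext) auto
  ultimately have "?W = ?W'"
    by (intro graph_layers_meet_eq[OF nontriv ess TM \<alpha> \<alpha>' W gl(1)[OF t(1)]]) blast+
  then have "?u \<in> ?W'" using gl(1)[OF u] by blast
  then show ?thesis using gl(2,3)[OF u] \<delta>' by simp
qed

end

text \<open>By the pigeonhole principle two powers of x lie in the same coset, and their quotient is
  in H.\<close>

lemma (in group) finite_index_pow:
  assumes H: "subgroup H G" and fin: "finite (rcosets H)" and x: "x \<in> carrier G"
  shows "\<exists>m::nat. 0 < m \<and> x [^] m \<in> H"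
proof -
  have "range (\<lambda>n::nat. H #> x [^] n) \<subseteq> rcosets H" using x by (auto simp: RCOSETS_def)
  then have "finite (range (\<lambda>n::nat. H #> x [^] n))" using fin finite_subset by blast
  then have "\<not> inj (\<lambda>n::nat. H #> x [^] n)" using finite_imageD infinite_UNIV_nat by blast
  then obtain i j :: nat where ij: "i < j" "H #> x [^] i = H #> x [^] j"
    unfolding inj_def by (metis linorder_neqE_nat)
  have "x [^] j \<in> H #> x [^] i" using ij(2) rcos_self[OF nat_pow_closed[OF x] H, of j] by simp
  then obtain h where h: "h \<in> H" "x [^] j = h \<otimes> x [^] i" by (auto simp: r_coset_def)
  have "x [^] j = x [^] (j - i) \<otimes> x [^] i" using ij(1) x by (simp add: nat_pow_mult)
  then have "x [^] (j - i) = h" using h x subgroup.mem_carrier[OF H h(1)] by (metis nat_pow_closed right_cancel)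
  then show ?thesis using h(1) ij(1) by (intro exI[of _ "j - i"]) auto
qed

subsection \<open>The projection to the quotient arrangement\<close>

locale split_quotient = split_arrangement G \<tau> \<Gamma> X r A \<beta>0 \<Gamma>''
  for G :: "('b, 'n) monoid_scheme" and \<tau> :: "'b topology"
    and \<Gamma> :: "('a, 'm) monoid_scheme" and X :: "'a \<Rightarrow> nat \<Rightarrow> int" and r :: nat
    and A :: "'a set" and \<beta>0 :: 'a and \<Gamma>'' :: "'a set" +
  fixes \<Gamma>' :: "'a set"
  assumes subgroup_\<Gamma>': "subgroup \<Gamma>' \<Gamma>" and \<Gamma>'_eq: "\<Gamma>' = range (\<lambda>k::int. \<beta>0 [^]\<^bsub>\<Gamma>\<^esub> k)"
begin

abbreviation coset :: "'a \<Rightarrow> 'a set" where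
  "coset a \<equiv> \<Gamma>' #>\<^bsub>\<Gamma>\<^esub> a"

abbreviation "B \<equiv> Hom (\<Gamma> Mod \<Gamma>') G"

lemma normal_\<Gamma>': "\<Gamma>' \<lhd> \<Gamma>"
  using subgroup_\<Gamma>' by (rule \<Gamma>.subgroup_imp_normal)

text \<open>Cosets are the fibres of \<open>pr\<close>, which therefore induces the section \<sigma>
  of the quotient and allows computing with representatives in \<open>\<Gamma>''\<close>.\<close>

lemma coset_eq: "a \<in> carrier \<Gamma> \<Longrightarrow> coset a = {b \<in> carrier \<Gamma>. pr b = pr a}"
proof (intro subset_antisym subsetI)
  fix b assume a: "a \<in> carrier \<Gamma>" and "b \<in> coset a"
  then obtain k :: int where b: "b = \<beta>0 [^]\<^bsub>\<Gamma>\<^esub> k \<otimes>\<^bsub>\<Gamma>\<^esub> a" by (auto simp: r_coset_def \<Gamma>'_eq)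
  have "pr (\<beta>0 [^]\<^bsub>\<Gamma>\<^esub> k) = \<one>\<^bsub>\<Gamma>\<^esub>" using pr_eq[OF one_in_\<Gamma>'', of k] pow_\<beta>0_carrier by simp
  then show "b \<in> {b \<in> carrier \<Gamma>. pr b = pr a}"
    using b a pow_\<beta>0_carrier[of k] by (simp add: pr_mult pr_carrier)
next
  fix b assume a: "a \<in> carrier \<Gamma>" and "b \<in> {b \<in> carrier \<Gamma>. pr b = pr a}"
  then have b: "b \<in> carrier \<Gamma>" "pr b = pr a" by auto
  have "\<beta>0 [^]\<^bsub>\<Gamma>\<^esub> (kc b - kc a) \<otimes>\<^bsub>\<Gamma>\<^esub> a
      = \<beta>0 [^]\<^bsub>\<Gamma>\<^esub> (kc b - kc a) \<otimes>\<^bsub>\<Gamma>\<^esub> (\<beta>0 [^]\<^bsub>\<Gamma>\<^esub> kc a \<otimes>\<^bsub>\<Gamma>\<^esub> pr a)"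
    by (simp add: decomp[OF a])
  also have "\<dots> = \<beta>0 [^]\<^bsub>\<Gamma>\<^esub> (kc b - kc a) \<otimes>\<^bsub>\<Gamma>\<^esub> \<beta>0 [^]\<^bsub>\<Gamma>\<^esub> kc a \<otimes>\<^bsub>\<Gamma>\<^esub> pr a"
    using a by (simp add: \<Gamma>.m_assoc pow_\<beta>0_carrier pr_carrier)
  also have "\<dots> = \<beta>0 [^]\<^bsub>\<Gamma>\<^esub> kc b \<otimes>\<^bsub>\<Gamma>\<^esub> pr b"
    using \<beta>0_carrier by (simp add: \<Gamma>.int_pow_mult[symmetric] b(2))
  finally have "b = \<beta>0 [^]\<^bsub>\<Gamma>\<^esub> (kc b - kc a) \<otimes>\<^bsub>\<Gamma>\<^esub> a" using decomp[OF b(1)] by simp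
  then show "b \<in> coset a" unfolding r_coset_def \<Gamma>'_eq by blast
qed

lemma coset_eq_iff: "a \<in> carrier \<Gamma> \<Longrightarrow> b \<in> carrier \<Gamma> \<Longrightarrow> coset a = coset b \<longleftrightarrow> pr a = pr b"
  by (auto simp: coset_eq)

lemma pr_pr: "a \<in> carrier \<Gamma> \<Longrightarrow> pr (pr a) = pr a"
  using pr_\<Gamma>'' pr_in by blast

lemma coset_pr: "a \<in> carrier \<Gamma> \<Longrightarrow> coset (pr a) = coset a"
  using coset_eq_iff pr_carrier pr_pr by blast

lemma quotient_section_coset:
  assumes "a \<in> carrier \<Gamma>" shows "quotient_section \<Gamma> \<Gamma>' \<Gamma>'' (coset a) = pr a"
proof -
  have "inj_on coset \<Gamma>''"
    by (rule inj_onI) (metis coset_eq_iff \<Gamma>''_carrier pr_\<Gamma>'')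
  then have "inv_into \<Gamma>'' coset (coset (pr a)) = pr a"
    using pr_in[OF assms] by (rule inv_into_f_f)
  then show ?thesis unfolding quotient_section_def coset_pr[OF assms] .
qed

lemma coset_Mod: "a \<in> carrier \<Gamma> \<Longrightarrow> coset a \<in> carrier (\<Gamma> Mod \<Gamma>')"
  by (auto simp: carrier_FactGroup)

lemma mult_coset: "a \<in> carrier \<Gamma> \<Longrightarrow> b \<in> carrier \<Gamma> \<Longrightarrow>
    coset a \<otimes>\<^bsub>\<Gamma> Mod \<Gamma>'\<^esub> coset b = coset (a \<otimes>\<^bsub>\<Gamma>\<^esub> b)"
  using normal.rcos_sum[OF normal_\<Gamma>'] by simp

text \<open>Composition with the quotient map identifies the base with the homomorphisms trivial on
  \<open>\<Gamma>'\<close>, so that the results about elements of T apply to base points.\<close>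

definition pull :: "('a set \<Rightarrow> 'b) \<Rightarrow> 'a \<Rightarrow> 'b" where
  "pull s = (\<lambda>a\<in>carrier \<Gamma>. s (coset a))"

lemma pull_T: "s \<in> B \<Longrightarrow> pull s \<in> T"
  using coset_Mod by (auto simp: pull_def Hom_def hom_def mult_coset[symmetric])

abbreviation "proj \<equiv> Hom_projection \<Gamma> \<Gamma>' \<Gamma>''"

lemma proj_coset: "a \<in> carrier \<Gamma> \<Longrightarrow> proj t (coset a) = t (pr a)"
  by (simp add: Hom_projection_def coset_Mod quotient_section_coset)

lemma proj_B:
  assumes t: "t \<in> T" shows "proj t \<in> B"
proof -
  have "proj t (U \<otimes>\<^bsub>\<Gamma> Mod \<Gamma>'\<^esub> V) = proj t U \<otimes>\<^bsub>G\<^esub> proj t V"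
    if UV: "U \<in> carrier (\<Gamma> Mod \<Gamma>')" "V \<in> carrier (\<Gamma> Mod \<Gamma>')" for U V
  proof -
    obtain a b where "a \<in> carrier \<Gamma>" "b \<in> carrier \<Gamma>" "U = coset a" "V = coset b"
      using UV by (auto simp: carrier_FactGroup)
    then show ?thesis
      using mult_coset[of a b] by (simp add: proj_coset pr_mult T_mult[OF t] pr_carrier del: mult_FactGroup)
  qed
  moreover have "proj t U \<in> carrier G" if "U \<in> carrier (\<Gamma> Mod \<Gamma>')" for U
    using that T_closed[OF t] pr_carrier by (auto simp: carrier_FactGroup proj_coset)
  moreover have "proj t \<in> extensional (carrier (\<Gamma> Mod \<Gamma>'))" by (simp add: Hom_projection_def)
  ultimately show ?thesis by (simp add: Hom_def hom_def)
qed

lemma pull_proj: "\<gamma> \<in> \<Gamma>'' \<Longrightarrow> pull (proj t) \<gamma> = t \<gamma>"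
  by (simp add: pull_def \<Gamma>''_carrier proj_coset pr_\<Gamma>'')

lemma glue_pull:
  assumes s: "s \<in> B" and g: "g \<in> carrier G"
  shows "glue g (pull s) \<in> T" "glue g (pull s) \<beta>0 = g" "proj (glue g (pull s)) = s"
    "\<And>\<gamma>. \<gamma> \<in> \<Gamma>'' \<Longrightarrow> glue g (pull s) \<gamma> = pull s \<gamma>"
proof -
  note sT = pull_T[OF s]
  show 1: "glue g (pull s) \<in> T"
    using g T_closed[OF sT] T_mult[OF sT] \<Gamma>''_carrier by (intro glue_T) auto
  show "glue g (pull s) \<beta>0 = g" using g T_one[OF sT] by (rule glue_\<beta>0)
  show 2: "glue g (pull s) \<gamma> = pull s \<gamma>" if "\<gamma> \<in> \<Gamma>''" for \<gamma>
    using T_closed[OF sT \<Gamma>''_carrier[OF that]] that by (rule glue_\<Gamma>'')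
  show "proj (glue g (pull s)) = s"
  proof
    fix U show "proj (glue g (pull s)) U = s U"
    proof (cases "U \<in> carrier (\<Gamma> Mod \<Gamma>')")
      case True
      then obtain a where a: "a \<in> carrier \<Gamma>" "U = coset a" by (auto simp: carrier_FactGroup)
      then show ?thesis using 2[OF pr_in[OF a(1)]]
        by (simp add: proj_coset pull_def pr_carrier coset_pr)
    next
      case False
      then show ?thesis using s by (simp add: Hom_projection_def Hom_def extensional_def)
    qed
  qed
qed

section \<open>The quotient arrangement and the two complements\<close>

lemma adm_coeff_eq: "a \<in> carrier \<Gamma> \<Longrightarrow> adm_coeff \<Gamma> \<beta>0 \<Gamma>'' a = nat \<bar>kc a\<bar>"
  unfolding adm_coeff_def
proof (rule the_equality)
  assume a: "a \<in> carrier \<Gamma>"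
  show "\<exists>k::int. \<exists>\<gamma>\<in>\<Gamma>''. a = \<beta>0 [^]\<^bsub>\<Gamma>\<^esub> k \<otimes>\<^bsub>\<Gamma>\<^esub> \<gamma> \<and> (k = int (nat \<bar>kc a\<bar>) \<or> k = - int (nat \<bar>kc a\<bar>))"
    using decomp[OF a] pr_in[OF a] by (intro exI[of _ "kc a"] bexI[of _ "pr a"]) auto
  fix c assume "\<exists>k::int. \<exists>\<gamma>\<in>\<Gamma>''. a = \<beta>0 [^]\<^bsub>\<Gamma>\<^esub> k \<otimes>\<^bsub>\<Gamma>\<^esub> \<gamma> \<and> (k = int c \<or> k = - int c)"
  then show "c = nat \<bar>kc a\<bar>" using kc_eq by auto
qed

lemma sub_arrangement_eq: "sub_arrangement \<Gamma> \<beta>0 \<Gamma>'' A = AY"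
  using A_carrier by (auto simp: sub_arrangement_def AY_def adm_coeff_eq)

abbreviation "AQ \<equiv> quotient_arrangement \<Gamma> \<beta>0 \<Gamma>' \<Gamma>'' A"

lemma quotient_arrangement_eq: "AQ = coset ` AY"
  by (simp add: quotient_arrangement_def sub_arrangement_eq)

text \<open>Finite index gives a relation in the quotient. It lifts to \<Gamma> because the quotient
  map is injective on \<open>\<Gamma>''\<close>, which contains the powers of \<gamma> and
  \<open>generate \<Gamma> AY\<close>.\<close>

lemma essential_torsion:
  assumes "essential (\<Gamma> Mod \<Gamma>') AQ" and \<gamma>: "\<gamma> \<in> \<Gamma>''"
  shows "\<exists>m::nat. 0 < m \<and> \<gamma> [^]\<^bsub>\<Gamma>\<^esub> m \<in> generate \<Gamma> AY"
proof -
  interpret N: normal \<Gamma>' \<Gamma> by (rule normal_\<Gamma>')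
  interpret M: group "\<Gamma> Mod \<Gamma>'" by (rule N.factorgroup_is_group)
  interpret q: group_hom \<Gamma> "\<Gamma> Mod \<Gamma>'" coset
    using N.r_coset_hom_Mod by unfold_locales
  have \<gamma>c: "\<gamma> \<in> carrier \<Gamma>" using \<Gamma>''_carrier[OF \<gamma>] .
  have "subgroup (generate (\<Gamma> Mod \<Gamma>') AQ) (\<Gamma> Mod \<Gamma>')"
    using AY_carrier coset_Mod unfolding quotient_arrangement_eq by (intro M.generate_is_subgroup) auto
  then obtain m :: nat where m: "0 < m" "coset \<gamma> [^]\<^bsub>\<Gamma> Mod \<Gamma>'\<^esub> m \<in> generate (\<Gamma> Mod \<Gamma>') AQ"
    using M.finite_index_pow[OF _ _ coset_Mod[OF \<gamma>c]] assms(1) unfolding essential_def by blast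
  then have "coset (\<gamma> [^]\<^bsub>\<Gamma>\<^esub> m) \<in> coset ` generate \<Gamma> AY"
    unfolding quotient_arrangement_eq q.generate_img[OF AY_carrier] q.hom_nat_pow[OF \<gamma>c] by blast
  then obtain x where x: "x \<in> generate \<Gamma> AY" "coset (\<gamma> [^]\<^bsub>\<Gamma>\<^esub> m) = coset x" by blast
  have "x \<in> \<Gamma>''" using \<Gamma>.generate_subgroup_incl[OF AY_\<Gamma>'' subgroup_\<Gamma>''] x(1) by blast
  moreover have "\<gamma> [^]\<^bsub>\<Gamma>\<^esub> m \<in> \<Gamma>''"
    using kc_0_iff[of "\<gamma> [^]\<^bsub>\<Gamma>\<^esub> m"] kc_nat_pow[OF \<gamma>c] kc_\<Gamma>''[OF \<gamma>] \<gamma>c by simp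
  ultimately have "\<gamma> [^]\<^bsub>\<Gamma>\<^esub> m = x"
    using x(2) coset_eq_iff pr_\<Gamma>'' \<Gamma>''_carrier by metis
  with m x show ?thesis by blast
qed

lemma base_iff: "s \<in> arr_complement (\<Gamma> Mod \<Gamma>') G AQ \<longleftrightarrow> s \<in> B \<and> (\<forall>\<beta>\<in>AY. pull s \<beta> \<noteq> \<one>\<^bsub>G\<^esub>)"
  using AY_carrier by (auto simp: arr_complement_def hypersurface_def quotient_arrangement_eq pull_def)

lemma total_iff: "t \<in> arr_complement \<Gamma> G A \<longleftrightarrow> t \<in> T \<and> (\<forall>\<alpha>\<in>A. t \<alpha> \<noteq> \<one>\<^bsub>G\<^esub>)"
  by (auto simp: arr_complement_def hypersurface_def)

theorem pullback_of_configurations: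
  assumes ess: "essential (\<Gamma> Mod \<Gamma>') AQ" and TM: "TM_ideal L Q"
  shows "\<exists>(l::nat) g.
    continuous_map (arr_complement_topology (\<Gamma> Mod \<Gamma>') G \<tau> AQ) (Conf_topology l \<tau>) g \<and>
    is_pullback_along (arr_complement_topology \<Gamma> G \<tau> A) (arr_complement_topology (\<Gamma> Mod \<Gamma>') G \<tau> AQ)
      proj (Conf_topology (l + 1) \<tau>) (forget_last l) g"
proof -
  let ?MB = "arr_complement (\<Gamma> Mod \<Gamma>') G AQ" and ?BT = "arr_complement_topology (\<Gamma> Mod \<Gamma>') G \<tau> AQ"
  let ?M = "arr_complement \<Gamma> G A" and ?MT = "arr_complement_topology \<Gamma> G \<tau> A"
  note tors = essential_torsion[OF ess]
  define AN where "AN = {\<alpha> \<in> A. kc \<alpha> \<noteq> 0}"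
  have "\<forall>\<alpha>. \<exists>\<rho> \<delta>. \<alpha> \<in> AN \<longrightarrow> continuous_map \<tau> \<tau> \<rho> \<and> \<delta> \<in> \<Gamma>'' \<and>
           (\<forall>t\<in>T. \<rho> (t \<delta>) [^]\<^bsub>G\<^esub> kc \<alpha> \<otimes>\<^bsub>G\<^esub> t (pr \<alpha>) = \<one>\<^bsub>G\<^esub>)"
    using ex_section[OF tors TM] unfolding AN_def by blast
  then obtain R D where RD: "\<And>\<alpha>. \<alpha> \<in> AN \<Longrightarrow> continuous_map \<tau> \<tau> (R \<alpha>)" "\<And>\<alpha>. \<alpha> \<in> AN \<Longrightarrow> D \<alpha> \<in> \<Gamma>''"
    "\<And>\<alpha> t. \<alpha> \<in> AN \<Longrightarrow> t \<in> T \<Longrightarrow> R \<alpha> (t (D \<alpha>)) [^]\<^bsub>G\<^esub> kc \<alpha> \<otimes>\<^bsub>G\<^esub> t (pr \<alpha>) = \<one>\<^bsub>G\<^esub>"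
    by metis
  \<comment> \<open>One index for each torsion translate of each section. Different indices may
    still give the same function.\<close>
  define I where "I = Sigma AN (\<lambda>\<alpha>. {\<zeta> \<in> carrier G. \<zeta> [^]\<^bsub>G\<^esub> kc \<alpha> = \<one>\<^bsub>G\<^esub>})"
  have finI: "finite I"
    unfolding I_def using finite_A by (intro finite_SigmaI G.finite_torsion) (auto simp: AN_def)
  define F where "F i t = snd i \<otimes>\<^bsub>G\<^esub> R (fst i) (t (D (fst i)))" for i t
  have F_cong: "F i t = F i u" if "i \<in> I" "\<And>\<gamma>. \<gamma> \<in> \<Gamma>'' \<Longrightarrow> t \<gamma> = u \<gamma>" for i t u
    using that RD(2) by (auto simp: F_def I_def)
  have Fc: "F i t \<in> carrier G" if "i \<in> I" "t \<in> T" for i t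
  proof -
    have "t (D (fst i)) \<in> carrier G" using that RD(2) T_closed \<Gamma>''_carrier by (auto simp: I_def)
    then have "R (fst i) (t (D (fst i))) \<in> carrier G"
      using that RD(1) G.continuous_map_closed by (fastforce simp: I_def G.topspace_eq)
    then show ?thesis using that by (auto simp: F_def I_def)
  qed
  \<comment> \<open>Over a point of M(A/Y), the fibre of M(A) is G without the values of the
    sections there.\<close>
  have total: "t \<in> ?M \<longleftrightarrow> t \<in> T \<and> proj t \<in> ?MB \<and> (\<forall>i\<in>I. t \<beta>0 \<noteq> F i t)" for t
  proof (cases "t \<in> T")
    case t: True
    have "(\<forall>\<alpha>\<in>AN. t \<alpha> \<noteq> \<one>\<^bsub>G\<^esub>) \<longleftrightarrow> (\<forall>i\<in>I. t \<beta>0 \<noteq> F i t)"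
    proof -
      have "t \<alpha> = \<one>\<^bsub>G\<^esub> \<longleftrightarrow> (\<exists>\<zeta>\<in>carrier G. \<zeta> [^]\<^bsub>G\<^esub> kc \<alpha> = \<one>\<^bsub>G\<^esub> \<and> t \<beta>0 = \<zeta> \<otimes>\<^bsub>G\<^esub> R \<alpha> (t (D \<alpha>)))" if "\<alpha> \<in> AN" for \<alpha>
        using that A_carrier by (intro hypersurface_iff RD t) (auto simp: AN_def)
      then show ?thesis by (auto simp: I_def F_def)
    qed
    moreover have "proj t \<in> ?MB \<longleftrightarrow> (\<forall>\<alpha>\<in>AY. t \<alpha> \<noteq> \<one>\<^bsub>G\<^esub>)"
      using proj_B[OF t] AY_\<Gamma>'' pull_proj unfolding base_iff by (metis subsetD)
    moreover have "A = AY \<union> AN" by (auto simp: AY_def AN_def)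
    ultimately show ?thesis using t by (auto simp: total_iff)
  qed (simp add: total_iff)
  have agree: "F i (pull s') = F j (pull s')" if "i \<in> I" "j \<in> I" "s \<in> ?MB" "F i (pull s) = F j (pull s)" "s' \<in> ?MB" for i j s s'
  \<comment> \<open>In the trivial group all values agree; otherwise there is a nontrivial motion,
    as \<open>sections_agree\<close> requires.\<close>
  proof (cases "carrier G = {\<one>\<^bsub>G\<^esub>}")
    case True
    then show ?thesis using Fc[OF that(1) pull_T] Fc[OF that(2) pull_T] that(5) by (simp add: base_iff)
  next
    case False
    have i: "fst i \<in> AN" "snd i \<in> carrier G" "snd i [^]\<^bsub>G\<^esub> kc (fst i) = \<one>\<^bsub>G\<^esub>"
      and j: "fst j \<in> AN" "snd j \<in> carrier G" "snd j [^]\<^bsub>G\<^esub> kc (fst j) = \<one>\<^bsub>G\<^esub>"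
      using that(1,2) by (auto simp: I_def)
    then have a: "fst i \<in> A" "kc (fst i) \<noteq> 0" "fst j \<in> A" "kc (fst j) \<noteq> 0" by (auto simp: AN_def)
    have s: "pull s \<in> T" "\<And>\<beta>. \<beta> \<in> AY \<Longrightarrow> pull s \<beta> \<noteq> \<one>\<^bsub>G\<^esub>" "pull s' \<in> T"
      using that(3,5) pull_T by (auto simp: base_iff)
    show ?thesis unfolding F_def
      by (rule sections_agree[OF False tors TM a(1,2) RD(1,2,3)[OF i(1)] i(2,3) a(3,4) RD(1,2,3)[OF j(1)] j(2,3) s(1,2) _ s(3)])
        (use that(4) in \<open>simp_all add: F_def\<close>)
  qed
  \<comment> \<open>Passing to functions on M(A/Y) removes the repetitions, and l counts what
    remains. By \<open>agree\<close> distinct members differ at every point, which makes their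
    values a configuration.\<close>
  define \<Phi> where "\<Phi> = (\<lambda>i. restrict (\<lambda>s. F i (pull s)) ?MB) ` I"
  obtain h where h: "bij_betw h {0..<card \<Phi>} \<Phi>"
    using ex_bij_betw_nat_finite[of \<Phi>] finI by (auto simp: \<Phi>_def)
  define l where "l = card \<Phi>"
  have hj: "\<exists>i\<in>I. h j = restrict (\<lambda>s. F i (pull s)) ?MB" if "j < l" for j
    using bij_betwE[OF h] that by (auto simp: \<Phi>_def l_def)
  have hi: "\<exists>j<l. h j = restrict (\<lambda>s. F i (pull s)) ?MB" if "i \<in> I" for i
  proof -
    have "restrict (\<lambda>s. F i (pull s)) ?MB \<in> h ` {0..<card \<Phi>}"
      using h that unfolding bij_betw_def by (simp add: \<Phi>_def)
    then show ?thesis by (auto simp: l_def)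
  qed
  have h_inj: "j = j'" if jl: "j < l" "j' < l" "s \<in> ?MB" "h j s = h j' s" for j j' s
  proof -
    obtain i i' where i: "i \<in> I" "i' \<in> I" "h j = restrict (\<lambda>s. F i (pull s)) ?MB" "h j' = restrict (\<lambda>s. F i' (pull s)) ?MB"
      using hj[OF jl(1)] hj[OF jl(2)] by blast
    then have "F i (pull s) = F i' (pull s)" using that by simp
    then have "h j = h j'" unfolding i(3,4) using agree[OF i(1,2) that(3)] by (intro restrict_ext) blast
    then show ?thesis using h that unfolding bij_betw_def inj_on_def l_def by auto
  qed
  have topB: "topspace ?BT = ?MB"
    by (auto simp: arr_complement_topology_def G.topspace_Hom_topology arr_complement_def)
  have topM: "topspace ?MT = ?M"
    by (auto simp: arr_complement_topology_def G.topspace_Hom_topology arr_complement_def)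
  have evB: "continuous_map ?BT \<tau> (\<lambda>s. s (coset a))" if "a \<in> carrier \<Gamma>" for a
    unfolding arr_complement_topology_def
    by (intro continuous_map_from_subtopology G.continuous_map_eval coset_Mod that)
  have evM: "continuous_map ?MT \<tau> (\<lambda>t. t a)" if "a \<in> carrier \<Gamma>" for a
    unfolding arr_complement_topology_def
    by (intro continuous_map_from_subtopology G.continuous_map_eval that)
  have h_cont: "continuous_map ?BT \<tau> (h j)" if "j < l" for j
  proof -
    obtain i where i: "i \<in> I" "h j = restrict (\<lambda>s. F i (pull s)) ?MB" using hj[OF \<open>j < l\<close>] by blast
    then have i': "fst i \<in> AN" "snd i \<in> carrier G" by (auto simp: I_def)
    have Dc: "D (fst i) \<in> carrier \<Gamma>" using RD(2)[OF i'(1)] \<Gamma>''_carrier by blast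
    have "continuous_map ?BT \<tau> (\<lambda>s. R (fst i) (s (coset (D (fst i)))))"
      using continuous_map_compose[OF evB[OF Dc] RD(1)[OF i'(1)]] by (simp add: o_def)
    then have "continuous_map ?BT \<tau> (\<lambda>s. snd i \<otimes>\<^bsub>G\<^esub> R (fst i) (s (coset (D (fst i)))))"
      using i'(2) by (intro G.continuous_map_mult) (auto simp: G.topspace_eq)
    then show ?thesis
      by (rule continuous_map_eq) (simp add: topB i(2) F_def pull_def Dc)
  qed
  define g where "g s = (\<lambda>j\<in>{..<l}. h j s)" for s
  have g_cont: "continuous_map ?BT (Conf_topology l \<tau>) g"
    unfolding Conf_topology_def continuous_map_in_subtopology continuous_map_componentwise
    using h_cont h_inj by (auto simp: g_def topB inj_on_def)
  \<comment> \<open>The section values occupy the places below l; the fibre coordinate is the last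
    point, at place l.\<close>
  define H where "H t = (proj t, \<lambda>j\<in>{..<l + 1}. if j < l then h j (proj t) else t \<beta>0)" for t
  \<comment> \<open>In the pullback the first l points are determined by the base point, so the
    inverse reads only the last one.\<close>
  define K where "K z = glue (snd z l) (pull (fst z))" for z :: "('a set \<Rightarrow> 'b) \<times> (nat \<Rightarrow> 'b)"
  let ?PB = "pullback_topology_along ?BT (Conf_topology (l + 1) \<tau>) g (forget_last l)"
  have proj_cont: "continuous_map ?MT ?BT proj"
    unfolding arr_complement_topology_def[of "\<Gamma> Mod \<Gamma>'"] continuous_map_in_subtopology G.continuous_map_Hom_topology
  proof (intro conjI ballI)
    fix U assume "U \<in> carrier (\<Gamma> Mod \<Gamma>')"
    then obtain a where a: "a \<in> carrier \<Gamma>" "U = coset a" by (auto simp: carrier_FactGroup)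
    then show "continuous_map ?MT \<tau> (\<lambda>t. proj t U)"
      using evM[OF pr_carrier[OF a(1)]] by (simp add: proj_coset)
  qed (use total proj_B in \<open>auto simp: topM\<close>)
  have h_proj: "h j (proj t) \<noteq> t \<beta>0" if "t \<in> ?M" "j < l" for t j
  proof -
    obtain i where i: "i \<in> I" "h j = restrict (\<lambda>s. F i (pull s)) ?MB" using hj[OF \<open>j < l\<close>] by blast
    have "h j (proj t) = F i t" using i total that F_cong[of i "pull (proj t)" t] pull_proj by simp
    then show ?thesis using total that i by metis
  qed
  have H_cont: "continuous_map ?MT ?PB H"
    unfolding pullback_topology_along_def continuous_map_in_subtopology continuous_map_pairwise
  proof (intro conjI)
    show "continuous_map ?MT ?BT (fst \<circ> H)" using proj_cont by (simp add: H_def o_def)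
    have "continuous_map ?MT \<tau> (\<lambda>t. if j < l then h j (proj t) else t \<beta>0)" for j
      using continuous_map_compose[OF proj_cont h_cont] evM[OF \<beta>0_carrier] by (simp add: o_def)
    moreover have "inj_on (snd (H t)) {..<l + 1}" if "t \<in> ?M" for t
      unfolding H_def snd_conv inj_on_restrict_eq
      using that total h_inj[of _ _ "proj t"] h_proj[OF that]
      by (auto simp: inj_on_def less_Suc_eq) metis+
    ultimately show "continuous_map ?MT (Conf_topology (l + 1) \<tau>) (snd \<circ> H)"
      unfolding Conf_topology_def continuous_map_in_subtopology continuous_map_componentwise
      by (auto simp: topM image_subset_iff) (auto simp: H_def)
    show "H \<in> topspace ?MT \<rightarrow> {(b, e). g b = forget_last l e}"
      by (auto simp: H_def g_def forget_last_def fun_eq_iff)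
  qed
  have PB: "s \<in> ?MB" "s \<in> B" "\<And>j. j < l \<Longrightarrow> x j = h j s" "x l \<in> carrier G" "inj_on x {..<l + 1}" "x \<in> extensional {..<l + 1}"
    if "(s, x) \<in> topspace ?PB" for s x
  proof -
    from that have x: "s \<in> ?MB" "x \<in> PiE {..<l + 1} (\<lambda>_. carrier G)" "inj_on x {..<l + 1}" "g s = forget_last l x"
      by (auto simp: pullback_topology_along_def topB Conf_topology_def G.topspace_eq)
    then show "s \<in> ?MB" "s \<in> B" "x l \<in> carrier G" "inj_on x {..<l + 1}" "x \<in> extensional {..<l + 1}"
      by (auto simp: base_iff PiE_iff)
    show "x j = h j s" if "j < l" for j
      using fun_cong[OF x(4), of j] that by (simp add: g_def forget_last_def)
  qed
  have K_mem: "K (s, x) \<in> ?M" if z: "(s, x) \<in> topspace ?PB" for s x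
  proof -
    note z' = PB[OF z]
    note gp = glue_pull[OF z'(2,4)]
    \<comment> \<open>Every section is some \<open>h j\<close>, so injectivity of x at l and j is
      exactly the avoidance of that section.\<close>
    have "x l \<noteq> F i (glue (x l) (pull s))" if i: "i \<in> I" for i
    proof -
      have "F i (glue (x l) (pull s)) = F i (pull s)" using gp(4) i by (intro F_cong) auto
      moreover obtain j where "j < l" "h j = restrict (\<lambda>s. F i (pull s)) ?MB" using hi[OF i] by blast
      ultimately have "F i (glue (x l) (pull s)) = x j" using z'(1,3) by simp
      moreover have "x l \<noteq> x j" using inj_onD[OF z'(5), of l j] \<open>j < l\<close> by auto
      ultimately show ?thesis by simp
    qed
    then show ?thesis using gp z'(1) by (simp add: total K_def)
  qed
  have PB_fst: "continuous_map ?PB ?BT fst"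
    unfolding pullback_topology_along_def by (rule continuous_map_subtopology_fst)
  have PB_snd: "continuous_map ?PB \<tau> (\<lambda>z. snd z l)"
  proof -
    have "continuous_map ?PB (Conf_topology (l + 1) \<tau>) snd"
      unfolding pullback_topology_along_def by (rule continuous_map_subtopology_snd)
    moreover have "continuous_map (Conf_topology (l + 1) \<tau>) \<tau> (\<lambda>x. x l)"
      unfolding Conf_topology_def by (intro continuous_map_from_subtopology continuous_map_product_projection) simp
    ultimately show ?thesis using continuous_map_compose[of ?PB "Conf_topology (l + 1) \<tau>" snd \<tau> "\<lambda>x. x l"] by (simp add: o_def)
  qed
  have K_cont: "continuous_map ?PB ?MT K"
    unfolding arr_complement_topology_def[of \<Gamma>] continuous_map_in_subtopology G.continuous_map_Hom_topology
  proof (intro conjI ballI)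
    fix a assume a: "a \<in> carrier \<Gamma>"
    have "continuous_map ?PB \<tau> (\<lambda>z. fst z (coset (pr a)))"
      using continuous_map_compose[OF PB_fst evB[OF pr_carrier[OF a]]] by (simp add: o_def)
    then have "continuous_map ?PB \<tau> (\<lambda>z. snd z l [^]\<^bsub>G\<^esub> kc a \<otimes>\<^bsub>G\<^esub> fst z (coset (pr a)))"
      by (intro G.continuous_map_mult G.continuous_map_int_pow PB_snd)
    then show "continuous_map ?PB \<tau> (\<lambda>z. K z a)"
      using a by (simp add: K_def glue_def pull_def pr_carrier)
  next
    show "K z \<in> T" if "z \<in> topspace ?PB" for z
      using K_mem[of "fst z" "snd z"] that total by (metis prod.collapse)
    show "K \<in> topspace ?PB \<rightarrow> ?M"
      using K_mem by auto
  qed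
  have "homeomorphic_maps ?MT ?PB H K"
    unfolding homeomorphic_maps_def
  proof (intro conjI ballI H_cont K_cont)
    fix t assume "t \<in> topspace ?MT"
    then have t: "t \<in> T" by (simp add: topM total)
    have "glue (t \<beta>0) (pull (proj t)) = t"
      using glue_pull[OF proj_B[OF t] T_closed[OF t \<beta>0_carrier]] pull_proj by (intro T_ext t) auto
    then show "K (H t) = t" by (simp add: K_def H_def)
  next
    fix z assume z: "z \<in> topspace ?PB"
    obtain s x where sx: "z = (s, x)" by fastforce
    note z' = PB[OF z[unfolded sx]]
    note gp = glue_pull[OF z'(2,4)]
    have "(\<lambda>j\<in>{..<l + 1}. if j < l then h j s else x l) = x"
      using z'(3,6) by (auto simp: fun_eq_iff extensional_def less_Suc_eq)
    then show "H (K z) = z" unfolding H_def K_def sx fst_conv snd_conv gp(2,3) by simp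
  qed
  then have "homeomorphic_map ?MT ?PB H" by (auto simp: homeomorphic_map_maps)
  then have "is_pullback_along ?MT ?BT proj (Conf_topology (l + 1) \<tau>) (forget_last l) g"
    unfolding is_pullback_along_def by (intro exI[of _ H]) (simp add: H_def)
  with g_cont show ?thesis by blast
qed

end

theorem theorem5p16:
  fixes \<Gamma> :: "('a, 'm) monoid_scheme" and G :: "('b, 'n) monoid_scheme"
    and \<tau> :: "'b topology" and d v r :: nat
    and \<A> :: "'a set" and Y :: "('a \<Rightarrow> 'b) set"
    and \<beta>0 :: 'a and \<Gamma>' \<Gamma>'' :: "'a set"
  assumes "connected_abelian_Lie_group G \<tau> d v"
    and "free_abelian_of_rank \<Gamma> r"
    and "abelian_arrangement \<Gamma> G \<tau> \<A>"
    and "admissible_subgroup \<Gamma> G \<beta>0 \<Gamma>' \<Gamma>'' Y"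
    and "essential (\<Gamma> Mod \<Gamma>') (quotient_arrangement \<Gamma> \<beta>0 \<Gamma>' \<Gamma>'' \<A>)"
    and "TM_ideal (layer_poset \<Gamma> G \<tau> \<A>) (layers \<Gamma> G \<tau> (sub_arrangement \<Gamma> \<beta>0 \<Gamma>'' \<A>))"
  shows "\<exists>(l::nat) g.
    continuous_map
      (arr_complement_topology (\<Gamma> Mod \<Gamma>') G \<tau> (quotient_arrangement \<Gamma> \<beta>0 \<Gamma>' \<Gamma>'' \<A>))
      (Conf_topology l \<tau>) g \<and>
    is_pullback_along
      (arr_complement_topology \<Gamma> G \<tau> \<A>)
      (arr_complement_topology (\<Gamma> Mod \<Gamma>') G \<tau> (quotient_arrangement \<Gamma> \<beta>0 \<Gamma>' \<Gamma>'' \<A>))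
      (Hom_projection \<Gamma> \<Gamma>' \<Gamma>'')
      (Conf_topology (l + 1) \<tau>) (forget_last l) g"
proof -
  interpret G: lie_target G \<tau> using assms(1) by (rule lie_target_of_connected_abelian_Lie_group)
  obtain X where "free_abelian_coords \<Gamma> X r" using free_abelian_of_rank_coords[OF assms(2)] by blast
  then interpret \<Gamma>: free_abelian_coords \<Gamma> X r .
  have A: "finite \<A>" "\<A> \<subseteq> carrier \<Gamma>" using assms(3) by (auto simp: abelian_arrangement_def)
  have adm: "subgroup \<Gamma>' \<Gamma>" "subgroup \<Gamma>'' \<Gamma>" "\<Gamma>' <#>\<^bsub>\<Gamma>\<^esub> \<Gamma>'' = carrier \<Gamma>" "\<Gamma>' \<inter> \<Gamma>'' = {\<one>\<^bsub>\<Gamma>\<^esub>}"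
    "\<beta>0 \<in> carrier \<Gamma>" "\<Gamma>' = generate \<Gamma> {\<beta>0}" "free_abelian_of_rank (\<Gamma>\<lparr>carrier := \<Gamma>'\<rparr>) 1"
    using assms(4) unfolding admissible_subgroup_def by blast+
  have \<Gamma>': "\<Gamma>' = range (\<lambda>k::int. \<beta>0 [^]\<^bsub>\<Gamma>\<^esub> k)"
    unfolding adm(6) \<Gamma>.generate_pow[OF adm(5)] by blast
  have ne: "\<beta>0 \<noteq> \<one>\<^bsub>\<Gamma>\<^esub>"
  proof
    assume "\<beta>0 = \<one>\<^bsub>\<Gamma>\<^esub>"
    then have "\<Gamma>' = {\<one>\<^bsub>\<Gamma>\<^esub>}" unfolding \<Gamma>' by auto
    moreover obtain Z where "free_abelian_coords (\<Gamma>\<lparr>carrier := \<Gamma>'\<rparr>) Z 1"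
      using free_abelian_of_rank_coords[OF adm(7)] by blast
    then interpret Z: free_abelian_coords "\<Gamma>\<lparr>carrier := \<Gamma>'\<rparr>" Z 1 .
    \<comment> \<open>Rank one provides two elements with different coordinates, whereas
      \<open>\<Gamma>'\<close> would have only one.\<close>
    obtain a b where "a \<in> \<Gamma>'" "b \<in> \<Gamma>'" "Z a = (\<lambda>i. 0)" "Z b = (\<lambda>i. if i = 0 then 1 else 0)"
      using Z.X_surj[of "\<lambda>i. 0"] Z.X_surj[of "\<lambda>i. if i = 0 then 1 else 0"] by auto
    ultimately show False by (metis singletonD zero_neq_one)
  qed
  interpret split_quotient G \<tau> \<Gamma> X r \<A> \<beta>0 \<Gamma>'' \<Gamma>'
  proof (intro split_quotient.intro split_arrangement.intro hom_space.intro
      split_arrangement_axioms.intro split_quotient_axioms.intro)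
    show "\<exists>k::int. \<exists>\<gamma>\<in>\<Gamma>''. a = \<beta>0 [^]\<^bsub>\<Gamma>\<^esub> k \<otimes>\<^bsub>\<Gamma>\<^esub> \<gamma>" if "a \<in> carrier \<Gamma>" for a
      using that unfolding adm(3)[symmetric] set_mult_def \<Gamma>' by blast
    show "k = 0" if "\<beta>0 [^]\<^bsub>\<Gamma>\<^esub> k \<in> \<Gamma>''" for k :: int
    proof (rule ccontr)
      assume "k \<noteq> 0"
      \<comment> \<open>The power lies in the trivial intersection of \<open>\<Gamma>'\<close> and
        \<open>\<Gamma>''\<close>; the coordinates show that \<Gamma> has no torsion.\<close>
      have "\<beta>0 [^]\<^bsub>\<Gamma>\<^esub> k = \<one>\<^bsub>\<Gamma>\<^esub>" using that adm(4) \<Gamma>' by blast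
      then have "k * X \<beta>0 i = 0" for i using \<Gamma>.X_int_pow[OF adm(5), of k i] by (simp add: \<Gamma>.X_one)
      then have "X \<beta>0 = X \<one>\<^bsub>\<Gamma>\<^esub>" using \<open>k \<noteq> 0\<close> by (auto simp: \<Gamma>.X_one fun_eq_iff)
      then show False using ne \<Gamma>.X_inj[OF adm(5) \<Gamma>.one_closed] by blast
    qed
  qed (fact A adm \<Gamma>' G.lie_target_axioms \<Gamma>.free_abelian_coords_axioms)+
  show ?thesis
    by (rule pullback_of_configurations) (use assms(5,6) in \<open>simp_all only: sub_arrangement_eq\<close>)
qed

end
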